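(* Let $(X_n)_{n\geq -1}$ be a second-order Galton--Watson process with immigration with generic offspring variables $\xi,\eta$ and generic immigration variable $\varepsilon$, such that $\xi$, $\eta$ and $\varepsilon$ are regularly varying with index $\alpha\in[1,\infty)$, $\mathbb{P}(\xi>x)\asymp\mathbb{P}(\eta>x)$, $\mathbb{P}(\xi>x)=O(\mathbb{P}(\varepsilon>x))$ and $\mathbb{P}(\eta>x)=O(\mathbb{P}(\varepsilon>x))$ as $x\to\infty$, $m_\xi,m_\eta,m_\varepsilon\in(0,\infty)$, and there exists $r\in(\alpha,\infty)$ such that $\mathbb{E}(X_0^r)<\infty$ and $\mathbb{E}(X_{-1}^r)<\infty$. Then for all $n\in\mathbb{N}$, writing $u(x) := (\mathbb{P}(\xi>x), \mathbb{P}(\eta>x))^\top$, \begin{align*} \mathbb{P}(X_n > x) &\sim \begin{bmatrix}\mathbb{E}(X_0)\\ \mathbb{E}(X_{-1})\end{bmatrix}^\top \sum_{k=0}^{n-1} m_k^\alpha \bigl(M^{n-k-1}\bigr)^\top u(x) + \begin{bmatrix} m_\varepsilon \\ 0\end{bmatrix}^\top \sum_{i=1}^{n-1}\sum_{j=0}^{n-i-1} m_j^\alpha \bigl(M^{n-i-j-1}\bigr)^\top u(x) \\ &\quad + \sum_{i=1}^n m_{n-i}^\alpha\,\mathbb{P}(\varepsilon>x) \end{align*} as $x\to\infty$, yielding that $X_n$ is regularly varying with index $\alpha$.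
   Context: A second-order Galton--Watson process with immigration $(X_n)_{n\geq -1}$ is defined by $X_n = \sum_{i=1}^{X_{n-1}} \xi_{n,i} + \sum_{j=1}^{X_{n-2}} \eta_{n,j} + \varepsilon_n$ for $n\in\mathbb{N}=\{1,2,\dots\}$, where $X_{-1}, X_0$ (initial values) and all $\xi_{n,i},\eta_{n,j},\varepsilon_n$ ($n,i,j\in\mathbb{N}$) are independent non-negative integer-valued random variables, the $\xi_{n,i}$ are identically distributed with generic copy $\xi$, the $\eta_{n,j}$ identically distributed with generic copy $\eta$, and the $\varepsilon_n$ identically distributed with generic copy $\varepsilon$. Write $m_\xi=\mathbb{E}(\xi)$, $m_\eta=\mathbb{E}(\eta)$, $m_\varepsilon=\mathbb{E}(\varepsilon)$, and $M := \begin{bmatrix} m_\xi & m_\eta\\ 1 & 0\end{bmatrix}$. Set $m_0:=1$ and for $k\in\mathbb{N}$, $m_k := \frac{\lambda_+^{k+1}-\lambda_-^{k+1}}{\lambda_+-\lambda_-}$ with $\lambda_\pm := \frac{m_\xi \pm \sqrt{m_\xi^2+4m_\eta}}{2}$. A non-negative random variable $X$ is regularly varying with index $\alpha\geq 0$ if $\lim_{x\to\infty}\mathbb{P}(X>qx)/\mathbb{P}(X>x) = q^{-\alpha}$ for all $q>0$. For positive functions, $f\sim g$ means $f/g\to1$, $f=O(g)$ means $\limsup f/g<\infty$, and $f\asymp g$ means $f=O(g)$ and $g=O(f)$, as $x\to\infty$. *)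

theory Defs
  imports "HOL-Probability.Probability" "HOL-Library.Landau_Symbols"
begin

(* Labels of the basic random variables of the process:
   X_{-1}, X_0, xi_{n,i}, eta_{n,j}, eps_n  (n,i,j \<ge> 1). *)
datatype label = LXm1 | LX0 | LXi nat nat | LEta nat nat | LEps nat

definition valid_label :: "label \<Rightarrow> bool" where
  "valid_label l = (case l of LXm1 \<Rightarrow> True | LX0 \<Rightarrow> True
     | LXi n i \<Rightarrow> n \<ge> 1 \<and> i \<ge> 1 | LEta n j \<Rightarrow> n \<ge> 1 \<and> j \<ge> 1 | LEps n \<Rightarrow> n \<ge> 1)"

definition basic_rv ::
  "('a \<Rightarrow> nat) \<Rightarrow> ('a \<Rightarrow> nat) \<Rightarrow> (nat \<Rightarrow> nat \<Rightarrow> 'a \<Rightarrow> nat) \<Rightarrow> (nat \<Rightarrow> nat \<Rightarrow> 'a \<Rightarrow> nat)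
   \<Rightarrow> (nat \<Rightarrow> 'a \<Rightarrow> nat) \<Rightarrow> label \<Rightarrow> 'a \<Rightarrow> nat" where
  "basic_rv Xm1 X0 xi eta eps l = (case l of LXm1 \<Rightarrow> Xm1 | LX0 \<Rightarrow> X0
     | LXi n i \<Rightarrow> xi n i | LEta n j \<Rightarrow> eta n j | LEps n \<Rightarrow> eps n)"

(* shifted process: gw2_aux ... k = X_{k-1} *)
fun gw2_aux ::
  "('a \<Rightarrow> nat) \<Rightarrow> ('a \<Rightarrow> nat) \<Rightarrow> (nat \<Rightarrow> nat \<Rightarrow> 'a \<Rightarrow> nat) \<Rightarrow> (nat \<Rightarrow> nat \<Rightarrow> 'a \<Rightarrow> nat)
   \<Rightarrow> (nat \<Rightarrow> 'a \<Rightarrow> nat) \<Rightarrow> nat \<Rightarrow> 'a \<Rightarrow> nat" where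
  "gw2_aux Xm1 X0 xi eta eps 0 \<omega> = Xm1 \<omega>"
| "gw2_aux Xm1 X0 xi eta eps (Suc 0) \<omega> = X0 \<omega>"
| "gw2_aux Xm1 X0 xi eta eps (Suc (Suc k)) \<omega> =
     (\<Sum>i = 1..gw2_aux Xm1 X0 xi eta eps (Suc k) \<omega>. xi (Suc k) i \<omega>)
   + (\<Sum>j = 1..gw2_aux Xm1 X0 xi eta eps k \<omega>. eta (Suc k) j \<omega>)
   + eps (Suc k) \<omega>"

(* The second-order Galton--Watson process with immigration X_n, n \<ge> -1. *)
definition gw2 ::
  "('a \<Rightarrow> nat) \<Rightarrow> ('a \<Rightarrow> nat) \<Rightarrow> (nat \<Rightarrow> nat \<Rightarrow> 'a \<Rightarrow> nat) \<Rightarrow> (nat \<Rightarrow> nat \<Rightarrow> 'a \<Rightarrow> nat)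
   \<Rightarrow> (nat \<Rightarrow> 'a \<Rightarrow> nat) \<Rightarrow> int \<Rightarrow> 'a \<Rightarrow> nat" where
  "gw2 Xm1 X0 xi eta eps n = gw2_aux Xm1 X0 xi eta eps (nat (n + 1))"

(* Standing assumptions of the model *)
definition gw2_model ::
  "'a measure \<Rightarrow> ('a \<Rightarrow> nat) \<Rightarrow> ('a \<Rightarrow> nat) \<Rightarrow> (nat \<Rightarrow> nat \<Rightarrow> 'a \<Rightarrow> nat) \<Rightarrow> (nat \<Rightarrow> nat \<Rightarrow> 'a \<Rightarrow> nat)
   \<Rightarrow> (nat \<Rightarrow> 'a \<Rightarrow> nat) \<Rightarrow> bool" where
  "gw2_model M Xm1 X0 xi eta eps \<longleftrightarrow>
     prob_space M \<and>
     prob_space.indep_vars M (\<lambda>_. count_space UNIV) (basic_rv Xm1 X0 xi eta eps)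
       {l. valid_label l} \<and>
     (\<forall>n\<ge>1. \<forall>i\<ge>1. distr M (count_space UNIV) (xi n i) = distr M (count_space UNIV) (xi 1 1)) \<and>
     (\<forall>n\<ge>1. \<forall>j\<ge>1. distr M (count_space UNIV) (eta n j) = distr M (count_space UNIV) (eta 1 1)) \<and>
     (\<forall>n\<ge>1. distr M (count_space UNIV) (eps n) = distr M (count_space UNIV) (eps 1))"

(* Regular variation of a non-negative random variable with index \<alpha> *)
definition regularly_varying :: "'a measure \<Rightarrow> ('a \<Rightarrow> real) \<Rightarrow> real \<Rightarrow> bool" where
  "regularly_varying M X \<alpha> \<longleftrightarrow> \<alpha> \<ge> 0 \<and>
     (\<forall>q>0. ((\<lambda>x. measure M {\<omega> \<in> space M. X \<omega> > q * x} / measure M {\<omega> \<in> space M. X \<omega> > x})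
              \<longlongrightarrow> q powr (-\<alpha>)) at_top)"

(* tail function x \<mapsto> P(Y > x) *)
definition tail :: "'a measure \<Rightarrow> ('a \<Rightarrow> nat) \<Rightarrow> real \<Rightarrow> real" where
  "tail M Y x = measure M {\<omega> \<in> space M. real (Y \<omega>) > x}"

(* lambda_+, lambda_- and m_k *)
definition lam_plus :: "real \<Rightarrow> real \<Rightarrow> real" where
  "lam_plus mxi meta = (mxi + sqrt (mxi^2 + 4 * meta)) / 2"
definition lam_minus :: "real \<Rightarrow> real \<Rightarrow> real" where
  "lam_minus mxi meta = (mxi - sqrt (mxi^2 + 4 * meta)) / 2"
definition mseq :: "real \<Rightarrow> real \<Rightarrow> nat \<Rightarrow> real" where
  "mseq mxi meta k = (if k = 0 then 1 else
     (lam_plus mxi meta ^ (k+1) - lam_minus mxi meta ^ (k+1)) / (lam_plus mxi meta - lam_minus mxi meta))"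

(* the matrix M and its powers *)
definition Mmat :: "real \<Rightarrow> real \<Rightarrow> real^2^2" where
  "Mmat mxi meta = (\<chi> i j. if i = 1 then (if j = 1 then mxi else meta) else (if j = 1 then 1 else 0))"

definition matpow :: "real^2^2 \<Rightarrow> nat \<Rightarrow> real^2^2" where
  "matpow A k = (((**) A) ^^ k) (mat 1)"

definition vec2 :: "real \<Rightarrow> real \<Rightarrow> real^2" where
  "vec2 a b = (\<chi> i. if i = 1 then a else b)"

end

theory Submission
  imports Defs
begin

text \<open>
  Write $F(x) = P(\varepsilon > x)$; all asymptotics hold up to $o(F)$. The core is a statement
  about one generation: if $(N_1, N_2)$ has finite mean and is independent of the offspring, then
  \[ P\Bigl(\sum_{i \le N_1} \xi_i + \sum_{j \le N_2} \eta_j + \varepsilon + b N_1 > x\Bigr)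
     = P(Y > x) + E(N_1) P(\xi > x) + E(N_2) P(\eta > x) + F(x) + o(F(x)), \]
  where $Y = (m_\xi + b) N_1 + m_\eta N_2$, provided that the tail of $Y$ is regularly varying up to
  $o(F)$. If $Y > (1 + \delta) x$, the sum exceeds $x$ with high probability by the law of
  large numbers. If $Y \le (1 - \delta) x$, a truncated Chernoff bound shows that the conditional
  probability is at most $C (1 + N_1 + N_2) F(x)$; by dominated convergence this part reduces to sums
  with fixed numbers of summands, where a single big jump dominates. The range in between is
  negligible as $\delta \to 0$ by regular variation. The theorem follows by induction on $n$ for
  all non-negative linear combinations $a X_n + b X_{n-1}$ simultaneously.
\<close>

section \<open>Regularly varying functions\<close>

text \<open>Two obstacles shape the estimates. Population sizes have tails of the same index as the
  offspring, so for \<open>\<alpha> = 1\<close> only their means can be relied on; the conditional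
  probability must be bounded linearly in the number n of summands and uniformly in n. Hence the
  truncation level is a fixed fraction of x, while the Chernoff exponent varies with log(n F(x)).
  Moreover, the tails of xi and eta are only O(F), with ratios to F that need not converge, and
  those of the initial values are o(F). Regular variation is therefore carried through the induction
  in the additive form \<open>regular\<close>, relative to F, which survives sums and o(F) errors.
  The quotient form is recovered only at the end, where immigration in the last generation keeps the
  limit above F. The summand b N_1 is what remains of a X_(n+1) + b X_n after division by a. Undoing
  this division produces a^alpha, and the passage from (a, b) to (a m_xi + b, a m_eta), started at
  (1, 0), has the m_k as successive first coordinates: this is the origin of the weights
  m_k^alpha.\<close>

lemma dyadic_bound:
  fixes f :: "real \<Rightarrow> real"
  assumes "0 < x0"
    and base: "\<And>x. x0 \<le> x \<Longrightarrow> x \<le> 2 * x0 \<Longrightarrow> f x \<le> B"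
    and step: "\<And>x. x0 \<le> x \<Longrightarrow> f x \<le> B \<Longrightarrow> f (2 * x) \<le> B"
    and "x0 \<le> x"
  shows "f x \<le> B"
proof -
  \<comment> \<open>Any point beyond \<open>x0\<close> reaches [x0, 2 * x0] after finitely many
    halvings, and each doubling on the way back preserves the bound.\<close>
  have *: "\<forall>x. x0 \<le> x \<and> x \<le> 2 ^ n * x0 \<longrightarrow> f x \<le> B" for n :: nat
  proof (induction n)
    case 0
    then show ?case using base assms(1) by auto
  next
    case (Suc n)
    show ?case
    proof (intro allI impI)
      fix x assume x: "x0 \<le> x \<and> x \<le> 2 ^ Suc n * x0"
      show "f x \<le> B"
      proof (cases "x \<le> 2 * x0")
        case True
        then show ?thesis using base x by auto
      next
        case False
        then have "x0 \<le> x / 2" "x / 2 \<le> 2 ^ n * x0" using x by auto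
        then have "f (2 * (x / 2)) \<le> B" using Suc step by blast
        then show ?thesis by simp
      qed
    qed
  qed
  obtain n :: nat where "x / x0 < 2 ^ n" using real_arch_pow[of 2 "x / x0"] by auto
  then have "x \<le> 2 ^ n * x0" using assms(1) by (simp add: field_simps)
  then show ?thesis using * assms(4) by blast
qed

lemma filterlim_scale: "0 < q \<Longrightarrow> filterlim (\<lambda>x. q * x) at_top (at_top :: real filter)"
  by (rule filterlim_tendsto_pos_mult_at_top[OF tendsto_const _ filterlim_ident])

locale rv_function =
  fixes F :: "real \<Rightarrow> real" and \<alpha> :: real
  assumes pos: "\<And>x. 0 < F x"
    and antimono: "\<And>x y. x \<le> y \<Longrightarrow> F y \<le> F x"
    and index_ge_1: "1 \<le> \<alpha>"
    and limit: "\<And>q. 0 < q \<Longrightarrow> ((\<lambda>x. F (q * x) / F x) \<longlongrightarrow> q powr (-\<alpha>)) at_top"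
begin

text \<open>A Potter bound. As \<rho> exceeds \<alpha>, the limit for q = 2 shows that x^\<rho> F x
  eventually does not decrease under doubling, so it stays away from 0. The doubling inequality is
  returned too, because the truncated second moment needs it.\<close>

lemma lower_bound:
  assumes "\<alpha> < \<rho>"
  obtains C x0 where "0 < C" "1 \<le> x0" "\<And>x. x0 \<le> x \<Longrightarrow> C * x powr (-\<rho>) \<le> F x"
    "\<And>x. x0 \<le> x \<Longrightarrow> F x \<le> 2 powr \<rho> * F (2 * x)"
proof -
  have "2 powr (-\<rho>) < (2 powr (-\<alpha>) :: real)" using assms by simp
  from order_tendstoD(1)[OF limit[of 2] this]
  have "\<forall>\<^sub>F x in at_top. 2 powr (-\<rho>) < F (2 * x) / F x" by simp
  then have "\<forall>\<^sub>F x in at_top. F x \<le> 2 powr \<rho> * F (2 * x)"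
  proof eventually_elim
    case (elim x)
    then have "2 powr (-\<rho>) * F x \<le> F (2 * x)" using pos[of x] by (simp add: field_simps)
    then show ?case by (simp add: powr_minus field_simps)
  qed
  then obtain x1 where x1: "\<And>x. x1 \<le> x \<Longrightarrow> F x \<le> 2 powr \<rho> * F (2 * x)"
    unfolding eventually_at_top_linorder by blast
  define x0 where "x0 = max 1 x1"
  \<comment> \<open>Each factor is replaced by its minimum on [x0, 2 * x0]: the power at the left
    end, \<open>F\<close> at the right end.\<close>
  define B where "B = 1 / (x0 powr \<rho> * F (2 * x0))"
  have \<rho>: "0 < \<rho>" using assms index_ge_1 by simp
  have B: "1 / (x powr \<rho> * F x) \<le> B" if "x0 \<le> x" for x
  proof (rule dyadic_bound[of x0 "\<lambda>x. 1 / (x powr \<rho> * F x)"])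
    show "0 < x0" "x0 \<le> x" using that by (auto simp: x0_def)
  next
    fix x assume x: "x0 \<le> x" "x \<le> 2 * x0"
    have "x0 powr \<rho> * F (2 * x0) \<le> x powr \<rho> * F x"
      using x \<rho> pos[of "2 * x0"] by (intro mult_mono powr_mono2 antimono) (auto simp: x0_def)
    then show "1 / (x powr \<rho> * F x) \<le> B"
      unfolding B_def using pos x by (intro divide_left_mono mult_pos_pos) (auto simp: x0_def)
  next
    fix x assume x: "x0 \<le> x" "1 / (x powr \<rho> * F x) \<le> B"
    have "x powr \<rho> * F x \<le> x powr \<rho> * (2 powr \<rho> * F (2 * x))"
      using x x1 by (intro mult_left_mono) (auto simp: x0_def)
    also have "\<dots> = (2 * x) powr \<rho> * F (2 * x)"
      using x by (simp add: powr_mult x0_def)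
    finally have "1 / ((2 * x) powr \<rho> * F (2 * x)) \<le> 1 / (x powr \<rho> * F x)"
      using pos x by (intro divide_left_mono) (auto simp: x0_def)
    then show "1 / ((2 * x) powr \<rho> * F (2 * x)) \<le> B" using x by simp
  qed
  have "0 < B" unfolding B_def using pos[of "2 * x0"] by (simp add: x0_def)
  moreover have "1 / B * x powr (-\<rho>) \<le> F x" if "x0 \<le> x" for x
    using B[OF that] that \<open>0 < B\<close> pos[of x] by (simp add: powr_minus field_simps x0_def)
  ultimately show thesis
    using x1 by (intro that[of "1 / B" x0]) (auto simp: x0_def)
qed

text \<open>The companion Potter bound: for \<rho> below \<alpha> the product x^\<rho> F x
  eventually does not increase under doubling.\<close>

lemma upper_bound:
  assumes "0 < \<rho>" "\<rho> < \<alpha>"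
  obtains C x0 where "0 < C" "1 \<le> x0" "\<And>x. x0 \<le> x \<Longrightarrow> F x \<le> C * x powr (-\<rho>)"
proof -
  have "2 powr (-\<alpha>) < (2 powr (-\<rho>) :: real)" using assms by simp
  from order_tendstoD(2)[OF limit[of 2] this]
  have "\<forall>\<^sub>F x in at_top. F (2 * x) / F x < 2 powr (-\<rho>)" by simp
  then have "\<forall>\<^sub>F x in at_top. 2 powr \<rho> * F (2 * x) \<le> F x"
  proof eventually_elim
    case (elim x)
    then have "F (2 * x) \<le> 2 powr (-\<rho>) * F x" using pos[of x] by (simp add: field_simps)
    then show ?case by (simp add: powr_minus field_simps)
  qed
  then obtain x1 where x1: "\<And>x. x1 \<le> x \<Longrightarrow> 2 powr \<rho> * F (2 * x) \<le> F x"
    unfolding eventually_at_top_linorder by blast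
  define x0 where "x0 = max 1 x1"
  define B where "B = (2 * x0) powr \<rho> * F x0"
  have B: "x powr \<rho> * F x \<le> B" if "x0 \<le> x" for x
  proof (rule dyadic_bound[of x0 "\<lambda>x. x powr \<rho> * F x"])
    show "0 < x0" "x0 \<le> x" using that by (auto simp: x0_def)
  next
    fix x assume x: "x0 \<le> x" "x \<le> 2 * x0"
    show "x powr \<rho> * F x \<le> B"
      unfolding B_def using x assms pos[of "x"]
      by (intro mult_mono powr_mono2 antimono) (auto simp: x0_def)
  next
    fix x assume x: "x0 \<le> x" "x powr \<rho> * F x \<le> B"
    have "(2 * x) powr \<rho> * F (2 * x) = x powr \<rho> * (2 powr \<rho> * F (2 * x))"
      using x by (simp add: powr_mult x0_def)
    also have "\<dots> \<le> x powr \<rho> * F x"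
      using x x1 by (intro mult_left_mono) (auto simp: x0_def)
    finally show "(2 * x) powr \<rho> * F (2 * x) \<le> B" using x by simp
  qed
  have "0 < B" unfolding B_def using pos[of "x0"] by (simp add: x0_def)
  moreover have "F x \<le> B * x powr (-\<rho>)" if "x0 \<le> x" for x
    using B[OF that] that pos[of x] by (simp add: powr_minus field_simps x0_def)
  ultimately show thesis
    by (intro that[of B x0]) (auto simp: x0_def)
qed

lemma tendsto_0: "(F \<longlongrightarrow> 0) at_top"
proof -
  obtain C x0 where C: "0 < C" "1 \<le> x0" "\<And>x. x0 \<le> x \<Longrightarrow> F x \<le> C * x powr (-(1/2))"
    using upper_bound[of "1/2"] index_ge_1 by auto
  have "((\<lambda>x::real. C * x powr (-(1/2))) \<longlongrightarrow> C * 0) at_top"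
    by (intro tendsto_mult tendsto_const tendsto_neg_powr filterlim_ident) auto
  moreover have "\<forall>\<^sub>F x in at_top. F x \<le> C * x powr (-(1/2))"
    using C(3) unfolding eventually_at_top_linorder by blast
  moreover have "\<forall>\<^sub>F x in at_top. 0 \<le> F x" using pos by (simp add: less_imp_le)
  ultimately show ?thesis
    using tendsto_sandwich[of "\<lambda>_. 0" F at_top] by auto
qed

text \<open>Markov's inequality with r-th moments gives tails of order x^(-r), so this makes the
  initial values negligible. An exponent strictly between \<alpha> and r pays for the small power
  that the Potter bound loses.\<close>

lemma powr_smallo:
  assumes "\<alpha> < r"
  shows "(\<lambda>x. x powr (-r)) \<in> o(F)"
proof -
  define \<rho> where "\<rho> = (\<alpha> + r) / 2"
  have \<rho>: "\<alpha> < \<rho>" "\<rho> < r" using assms by (auto simp: \<rho>_def)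
  obtain C x0 where C: "0 < C" "1 \<le> x0" "\<And>x. x0 \<le> x \<Longrightarrow> C * x powr (-\<rho>) \<le> F x"
    using lower_bound[OF \<rho>(1)] by metis
  have "(\<lambda>x. x powr (-r)) \<in> o(\<lambda>x::real. x powr (-\<rho>))"
    using \<rho> by (subst powr_smallo_iff[OF filterlim_ident]) auto
  also have "(\<lambda>x::real. x powr (-\<rho>)) \<in> O(F)"
  proof (rule bigoI[of _ "1 / C"])
    show "\<forall>\<^sub>F x in at_top. norm (x powr (-\<rho>)) \<le> 1 / C * norm (F x)"
      using eventually_ge_at_top[of x0]
    proof eventually_elim
      case (elim x)
      then show ?case using C(1) C(3)[of x] pos[of x] by (simp add: field_simps)
    qed
  qed
  finally show ?thesis .
qed

section \<open>Landau calculus relative to \<open>F\<close> under rescaling of the argument\<close>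

lemma scale_bigo:
  assumes "0 < q"
  shows "(\<lambda>x. F (q * x)) \<in> O(F)"
  using pos by (intro bigoI_tendsto[OF limit[OF assms]]) (simp add: less_imp_neq[symmetric])

lemma smallo_scale:
  assumes "f \<in> o(F)" "0 < q"
  shows "(\<lambda>x. f (q * x)) \<in> o(F)"
  using landau_o.small.compose[OF assms(1) filterlim_scale[OF assms(2)]] scale_bigo[OF assms(2)]
  by (rule landau_o.small_big_trans)

lemma bigo_scale:
  assumes "f \<in> O(F)" "0 < q"
  shows "(\<lambda>x. f (q * x)) \<in> O(F)"
  using landau_o.big.compose[OF assms(1) filterlim_scale[OF assms(2)]] scale_bigo[OF assms(2)]
  by (rule landau_o.big_trans)

text \<open>\<open>F\<close> tends to 0, so one factor is o(1). Such products arise as the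
  probability that two independent variables are large together.\<close>

lemma bigo_mult_smallo:
  assumes "f \<in> O(F)" "g \<in> O(F)"
  shows "(\<lambda>x. f x * g x) \<in> o(F)"
proof -
  have "F \<in> o(\<lambda>_. 1)" using tendsto_0 by (intro smalloI_tendsto) auto
  then have "g \<in> o(\<lambda>_. 1)" using assms(2) landau_o.big_small_trans by blast
  then show ?thesis using landau_o.big_small_mult[OF assms(1)] by force
qed

lemma smalloI:
  assumes "\<And>e. 0 < e \<Longrightarrow> \<forall>\<^sub>F x in at_top. \<bar>f x\<bar> \<le> e * F x"
  shows "f \<in> o(F)"
  using assms pos by (intro landau_o.smallI) (simp add: less_imp_le)

lemma smalloD: "f \<in> o(F) \<Longrightarrow> 0 < e \<Longrightarrow> \<forall>\<^sub>F x in at_top. \<bar>f x\<bar> \<le> e * F x"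
  using landau_o.smallD[of f at_top F e] pos by (simp add: less_imp_le)

lemma bigoD:
  assumes "f \<in> O(F)"
  obtains C where "0 < C" "\<forall>\<^sub>F x in at_top. \<bar>f x\<bar> \<le> C * F x"
  using landau_o.bigE[OF assms] pos by (auto simp: less_imp_le)

text \<open>Regular variation in additive form, with errors measured against \<open>F\<close>. It
  admits functions that vanish or are o(F), and it is closed under sums, multiples and o(F)
  perturbations; the quotient form is not.\<close>

definition regular :: "(real \<Rightarrow> real) \<Rightarrow> bool" where
  "regular f \<longleftrightarrow> f \<in> O(F) \<and> (\<forall>q>0. (\<lambda>x. f (q * x) - q powr (-\<alpha>) * f x) \<in> o(F))"

lemma regular_bigo: "regular f \<Longrightarrow> f \<in> O(F)"
  and regular_scale: "regular f \<Longrightarrow> 0 < q \<Longrightarrow> (\<lambda>x. f (q * x) - q powr (-\<alpha>) * f x) \<in> o(F)"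
  by (auto simp: regular_def)

lemma regular_smallo: "f \<in> o(F) \<Longrightarrow> regular f"
  unfolding regular_def
  by (auto intro!: landau_o.small_imp_big sum_in_smallo(2) smallo_scale simp: powr_def)

lemma regular_add:
  assumes "regular f" "regular g"
  shows "regular (\<lambda>x. f x + g x)"
  unfolding regular_def
proof (intro conjI allI impI)
  show "(\<lambda>x. f x + g x) \<in> O(F)" using assms by (intro sum_in_bigo regular_bigo)
  fix q :: real assume "0 < q"
  then have "(\<lambda>x. (f (q * x) - q powr (-\<alpha>) * f x) + (g (q * x) - q powr (-\<alpha>) * g x)) \<in> o(F)"
    using assms by (intro sum_in_smallo regular_scale)
  then show "(\<lambda>x. f (q * x) + g (q * x) - q powr (-\<alpha>) * (f x + g x)) \<in> o(F)"
    by (simp add: algebra_simps)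
qed

lemma regular_cmult:
  assumes "regular f"
  shows "regular (\<lambda>x. c * f x)"
  unfolding regular_def
proof (intro conjI allI impI)
  show "(\<lambda>x. c * f x) \<in> O(F)" using regular_bigo[OF assms] by simp
  fix q :: real assume "0 < q"
  then have "(\<lambda>x. c * (f (q * x) - q powr (-\<alpha>) * f x)) \<in> o(F)"
    using regular_scale[OF assms] by (cases "c = 0") auto
  then show "(\<lambda>x. c * f (q * x) - q powr (-\<alpha>) * (c * f x)) \<in> o(F)"
    by (simp add: algebra_simps)
qed

lemma regular_sum:
  assumes "finite I" "\<And>i. i \<in> I \<Longrightarrow> regular (f i)"
  shows "regular (\<lambda>x. \<Sum>i\<in>I. f i x)"
  using assms by (induction I rule: finite_induct) (auto intro: regular_add regular_smallo)

lemma regular_smallo_diff: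
  assumes "regular f" "(\<lambda>x. g x - f x) \<in> o(F)"
  shows "regular g"
  using regular_add[OF assms(1) regular_smallo[OF assms(2)]] by simp

lemma regular_limit:
  assumes "f \<in> O(F)" "\<And>x. f x \<noteq> 0" "\<And>q. 0 < q \<Longrightarrow> ((\<lambda>x. f (q * x) / f x) \<longlongrightarrow> q powr (-\<alpha>)) at_top"
  shows "regular f"
  unfolding regular_def
proof (intro conjI allI impI assms(1))
  fix q :: real assume q: "0 < q"
  have "((\<lambda>x. f (q * x) / f x - q powr (-\<alpha>)) \<longlongrightarrow> q powr (-\<alpha>) - q powr (-\<alpha>)) at_top"
    by (intro tendsto_intros assms q)
  moreover have "(f (q * x) - q powr (-\<alpha>) * f x) / f x = f (q * x) / f x - q powr (-\<alpha>)" for x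
    using assms(2)[of x] by (simp add: field_simps)
  ultimately have "(\<lambda>x. f (q * x) - q powr (-\<alpha>) * f x) \<in> o(f)"
    using assms(2) by (intro smalloI_tendsto) (simp_all only: diff_self, auto)
  then show "(\<lambda>x. f (q * x) - q powr (-\<alpha>) * f x) \<in> o(F)"
    using assms(1) by (rule landau_o.small_big_trans)
qed

lemma regular_F: "regular F"
  using pos limit by (intro regular_limit) (auto simp: less_imp_neq[symmetric])

text \<open>Continuity of \<open>q powr (-\<alpha>)\<close> at q = 1. This is how the window between
  (1 - \<delta>) x and (1 + \<delta>) x is made negligible.\<close>

lemma regular_near_1:
  assumes "regular f" "0 < e"
  obtains \<delta> where "0 < \<delta>" "\<delta> < 1"
    "\<forall>\<^sub>F x in at_top. \<bar>f ((1 - \<delta>) * x) - f x\<bar> \<le> e * F x"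
    "\<forall>\<^sub>F x in at_top. \<bar>f ((1 + \<delta>) * x) - f x\<bar> \<le> e * F x"
proof -
  obtain C where C: "0 < C" "\<forall>\<^sub>F x in at_top. \<bar>f x\<bar> \<le> C * F x"
    using bigoD[OF regular_bigo[OF assms(1)]] by blast
  have lim1: "((\<lambda>\<delta>::real. (1 - \<delta>) powr (-\<alpha>)) \<longlongrightarrow> (1 - 0) powr (-\<alpha>)) (at_right 0)"
    by (intro tendsto_intros) auto
  have lim2: "((\<lambda>\<delta>::real. (1 + \<delta>) powr (-\<alpha>)) \<longlongrightarrow> (1 + 0) powr (-\<alpha>)) (at_right 0)"
    by (intro tendsto_intros) auto
  \<comment> \<open>Since |f| is at most C * F, this closeness of the powers costs e / 2 * F;
    regularity of f at the scale q costs the other half.\<close>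
  have e: "0 < e / (2 * C)" using assms(2) C(1) by simp
  have "\<forall>\<^sub>F \<delta>::real in at_right 0. \<bar>(1 - \<delta>) powr (-\<alpha>) - 1\<bar> < e / (2 * C)
      \<and> \<bar>(1 + \<delta>) powr (-\<alpha>) - 1\<bar> < e / (2 * C) \<and> 0 < \<delta> \<and> \<delta> < 1"
    using tendstoD[OF lim1 e] tendstoD[OF lim2 e] eventually_at_right_real[OF zero_less_one]
    by eventually_elim (auto simp: dist_real_def)
  then obtain \<delta> :: real where \<delta>: "\<bar>(1 - \<delta>) powr (-\<alpha>) - 1\<bar> < e / (2 * C)"
      "\<bar>(1 + \<delta>) powr (-\<alpha>) - 1\<bar> < e / (2 * C)" "0 < \<delta>" "\<delta> < 1"
    using eventually_happens[of _ "at_right (0::real)"] by (metis (mono_tags, lifting) trivial_limit_at_right_real)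
  have main: "\<forall>\<^sub>F x in at_top. \<bar>f (q * x) - f x\<bar> \<le> e * F x"
    if q: "0 < q" "\<bar>q powr (-\<alpha>) - 1\<bar> < e / (2 * C)" for q
  proof -
    have "0 < e / 2" using assms(2) by simp
    from smalloD[OF regular_scale[OF assms(1) q(1)] this] C(2)
    show ?thesis
    proof eventually_elim
      case (elim x)
      have "\<bar>f (q * x) - f x\<bar> \<le> \<bar>f (q * x) - q powr (-\<alpha>) * f x\<bar> + \<bar>(q powr (-\<alpha>) - 1) * f x\<bar>"
        by (simp add: algebra_simps)
      also have "\<bar>(q powr (-\<alpha>) - 1) * f x\<bar> \<le> e / (2 * C) * (C * F x)"
        unfolding abs_mult using q elim C by (intro mult_mono) auto
      also have "\<dots> = e / 2 * F x" using C(1) by simp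
      finally show ?case using elim by simp
    qed
  qed
  show thesis
    using \<delta> main[of "1 - \<delta>"] main[of "1 + \<delta>"] by (intro that[of \<delta>]) auto
qed

text \<open>A constant c is below \<delta> * x for large x, so monotonicity places f (x - c) between
  f x and f ((1 - \<delta>) * x).\<close>

lemma regular_shift:
  assumes "regular f" "\<And>x y. x \<le> y \<Longrightarrow> f y \<le> f x" "0 \<le> c"
  shows "(\<lambda>x. f (x - c) - f x) \<in> o(F)"
proof (rule smalloI)
  fix e :: real assume "0 < e"
  then obtain \<delta> where \<delta>: "0 < \<delta>" "\<delta> < 1" "\<forall>\<^sub>F x in at_top. \<bar>f ((1 - \<delta>) * x) - f x\<bar> \<le> e * F x"
    using regular_near_1[OF assms(1)] by metis
  show "\<forall>\<^sub>F x in at_top. \<bar>f (x - c) - f x\<bar> \<le> e * F x"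
    using \<delta>(3) eventually_ge_at_top[of "c / \<delta>"]
  proof eventually_elim
    case (elim x)
    then have "(1 - \<delta>) * x \<le> x - c" using \<delta> by (simp add: field_simps)
    then have "f (x - c) \<le> f ((1 - \<delta>) * x)" by (rule assms(2))
    moreover have "f x \<le> f (x - c)" using assms by auto
    ultimately show ?case using elim by auto
  qed
qed

end

section \<open>Exponential bounds for sums of independent variables\<close>

text \<open>Second-order Taylor expansion. As y is at most L, the remainder splits off y^2 / L^2,
  and the remaining (s L)^2 / 2 is absorbed by a second factor exp(s L). Only a truncated second
  moment then enters the exponential moment.\<close>

lemma exp_le_truncated:
  fixes s y L :: real
  assumes "0 \<le> s" "0 \<le> y" "y \<le> L" "0 < L"
  shows "exp (s * y) \<le> 1 + s * y + y\<^sup>2 * (exp (2 * s * L) / L\<^sup>2)"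
proof -
  obtain t where t: "\<bar>t\<bar> \<le> \<bar>s * y\<bar>" "exp (s * y) = 1 + s * y + exp t / 2 * (s * y)\<^sup>2"
    using Maclaurin_exp_le[of "s * y" 2] by (auto simp: numeral_2_eq_2)
  have sy: "0 \<le> s * y" "s * y \<le> s * L" using assms by (auto intro: mult_left_mono)
  have "exp t * (s * y)\<^sup>2 / 2 \<le> exp (s * L) * ((s * L)\<^sup>2 / 2) * (y\<^sup>2 / L\<^sup>2)"
    using t(1) sy assms by (auto simp: power_mult_distrib intro!: mult_right_mono)
  also have "\<dots> \<le> exp (s * L) * exp (s * L) * (y\<^sup>2 / L\<^sup>2)"
  proof (intro mult_right_mono mult_left_mono)
    have "0 \<le> s * L" using assms by simp
    then show "(s * L)\<^sup>2 / 2 \<le> exp (s * L)"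
      using exp_lower_Taylor_quadratic[of "s * L"] by linarith
  qed auto
  also have "\<dots> = y\<^sup>2 * (exp (2 * s * L) / L\<^sup>2)"
    by (simp add: exp_add[symmetric])
  finally show ?thesis using t(2) by simp
qed

context prob_space
begin

abbreviation upper_tail :: "('a \<Rightarrow> real) \<Rightarrow> real \<Rightarrow> real" where
  "upper_tail X x \<equiv> prob {\<omega> \<in> space M. x < X \<omega>}"

lemma upper_tail_antimono:
  assumes [measurable]: "X \<in> borel_measurable M" and "x \<le> y"
  shows "upper_tail X y \<le> upper_tail X x"
  using assms(2) by (intro finite_measure_mono) auto

text \<open>\<open>Z0\<close> serves only as a carrier of the common law; it need not belong to the
  family.\<close>

definition iid_copies :: "('i \<Rightarrow> 'a \<Rightarrow> real) \<Rightarrow> 'i set \<Rightarrow> ('a \<Rightarrow> real) \<Rightarrow> bool" where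
  "iid_copies Z I Z0 \<longleftrightarrow> finite I \<and> indep_vars (\<lambda>_. borel) Z I \<and>
     (\<forall>i\<in>I. distr M borel (Z i) = distr M borel Z0)"

lemma iid_copies_measurable: "iid_copies Z I Z0 \<Longrightarrow> i \<in> I \<Longrightarrow> Z i \<in> borel_measurable M"
  by (auto simp: iid_copies_def indep_vars_def)

lemma expectation_cong_distr:
  fixes f g h :: "_ \<Rightarrow> real"
  assumes [measurable]: "f \<in> borel_measurable M" "g \<in> borel_measurable M" "h \<in> borel_measurable borel"
    and "distr M borel f = distr M borel g"
  shows "expectation (\<lambda>\<omega>. h (f \<omega>)) = expectation (\<lambda>\<omega>. h (g \<omega>))"
  using integral_distr[of f M borel h] integral_distr[of g M borel h] assms(4) by simp

lemma upper_tail_cong_distr: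
  assumes [measurable]: "f \<in> borel_measurable M" "g \<in> borel_measurable M"
    and "distr M borel f = distr M borel g"
  shows "upper_tail f x = upper_tail g x"
proof -
  have *: "measure (distr M borel h) {x<..} = upper_tail h x" if [measurable]: "h \<in> borel_measurable M" for h
    by (subst measure_distr) (auto intro!: arg_cong[where f = prob])
  show ?thesis using *[of f] *[of g] assms(3) by simp
qed

text \<open>The transformation h is left free so that one Chernoff bound serves the upper deviation
  (h z = s * min z L) and the lower one (h z = - s * min z A).\<close>

lemma exp_markov_iid:
  assumes iid: "iid_copies Z I Z0" and [measurable]: "Z0 \<in> borel_measurable M"
    and h[measurable]: "h \<in> borel_measurable borel" and int0: "integrable M (\<lambda>\<omega>. exp (h (Z0 \<omega>)))"
  shows "prob {\<omega> \<in> space M. t \<le> (\<Sum>i\<in>I. h (Z i \<omega>))}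
    \<le> exp (-t) * expectation (\<lambda>\<omega>. exp (h (Z0 \<omega>))) ^ card I"
proof -
  have fin: "finite I" using iid by (simp add: iid_copies_def)
  note [measurable] = iid_copies_measurable[OF iid]
  have int: "integrable M (\<lambda>\<omega>. exp (h (Z i \<omega>)))" if [measurable]: "i \<in> I" for i
    using int0 iid that integrable_distr_eq[of Z0 M borel "\<lambda>z. exp (h z)"]
      integrable_distr_eq[of "Z i" M borel "\<lambda>z. exp (h z)"] by (simp add: iid_copies_def)
  have "indep_vars (\<lambda>_. borel) (\<lambda>i \<omega>. exp (h (Z i \<omega>))) I"
    by (rule indep_vars_compose2[where M' = "\<lambda>_. borel"]) (use iid in \<open>auto simp: iid_copies_def\<close>)
  note prod = indep_vars_lebesgue_integral[OF fin this int] indep_vars_integrable[OF fin this int]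
  have eq: "exp (\<Sum>i\<in>I. h (Z i \<omega>)) = (\<Prod>i\<in>I. exp (h (Z i \<omega>)))" for \<omega>
    using fin by (rule exp_sum)
  have "prob {\<omega> \<in> space M. t \<le> (\<Sum>i\<in>I. h (Z i \<omega>))}
      = prob {\<omega> \<in> space M. exp t \<le> exp (\<Sum>i\<in>I. h (Z i \<omega>))}" by simp
  also have "\<dots> \<le> expectation (\<lambda>\<omega>. exp (\<Sum>i\<in>I. h (Z i \<omega>))) / exp t"
    using prod(2) by (intro integral_Markov_inequality_measure[where A = "{}"]) (simp_all add: eq prod_nonneg)
  also have "expectation (\<lambda>\<omega>. exp (\<Sum>i\<in>I. h (Z i \<omega>))) = (\<Prod>i\<in>I. expectation (\<lambda>\<omega>. exp (h (Z i \<omega>))))"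
    using prod(1) by (simp add: eq)
  also have "\<dots> = (\<Prod>i\<in>I. expectation (\<lambda>\<omega>. exp (h (Z0 \<omega>))))"
    using iid by (intro prod.cong refl expectation_cong_distr[where h = "\<lambda>z. exp (h z)"])
      (auto simp: iid_copies_def iid_copies_measurable[OF iid])
  finally show ?thesis by (simp add: exp_minus field_simps)
qed

lemma truncated_sum_upper:
  assumes iid: "iid_copies Z I Z0" and int: "integrable M Z0" and nonneg: "\<And>\<omega>. 0 \<le> Z0 \<omega>"
    and s: "0 \<le> s" and L: "0 < L"
  shows "prob {\<omega> \<in> space M. real (card I) * expectation Z0 + d \<le> (\<Sum>i\<in>I. min (Z i \<omega>) L)}
    \<le> exp (- s * d + real (card I) * expectation (\<lambda>\<omega>. (min (Z0 \<omega>) L)\<^sup>2) * exp (2 * s * L) / L\<^sup>2)"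
\<comment> \<open>The event is rescaled by s below, which needs s > 0. For s = 0 the right-hand side
  is at least 1.\<close>
proof (cases "s = 0")
  case True
  have "0 \<le> real (card I) * expectation (\<lambda>\<omega>. (min (Z0 \<omega>) L)\<^sup>2) * exp (2 * s * L) / L\<^sup>2"
    by (intro divide_nonneg_nonneg mult_nonneg_nonneg integral_nonneg_AE) auto
  then show ?thesis using True by (intro order_trans[OF prob_le_1]) simp
next
  case False
  then have s: "0 < s" using s by simp
  have [measurable]: "Z0 \<in> borel_measurable M" using int by simp
  let ?m = "expectation Z0" and ?g = "expectation (\<lambda>\<omega>. (min (Z0 \<omega>) L)\<^sup>2)"
  have ig: "integrable M (\<lambda>\<omega>. (min (Z0 \<omega>) L)\<^sup>2)"
    using L nonneg by (intro integrable_const_bound[of _ "L\<^sup>2"]) (auto simp: min_def intro!: power_mono)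
  have "expectation (\<lambda>\<omega>. exp (s * min (Z0 \<omega>) L))
      \<le> expectation (\<lambda>\<omega>. 1 + s * Z0 \<omega> + (min (Z0 \<omega>) L)\<^sup>2 * (exp (2 * s * L) / L\<^sup>2))"
  proof (rule integral_mono)
    show "integrable M (\<lambda>\<omega>. exp (s * min (Z0 \<omega>) L))"
      using s by (intro integrable_const_bound[of _ "exp (s * L)"]) auto
    show "integrable M (\<lambda>\<omega>. 1 + s * Z0 \<omega> + (min (Z0 \<omega>) L)\<^sup>2 * (exp (2 * s * L) / L\<^sup>2))"
      using int ig by (intro Bochner_Integration.integrable_add integrable_mult_right integrable_mult_left) auto
    fix \<omega>
    have "exp (s * min (Z0 \<omega>) L) \<le> 1 + s * min (Z0 \<omega>) L + (min (Z0 \<omega>) L)\<^sup>2 * (exp (2 * s * L) / L\<^sup>2)"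
      using s L nonneg by (intro exp_le_truncated) auto
    \<comment> \<open>The truncation is dropped in the linear term only, so that the true mean
      appears while the quadratic term keeps the truncated second moment.\<close>
    also have "s * min (Z0 \<omega>) L \<le> s * Z0 \<omega>" using s by simp
    finally show "exp (s * min (Z0 \<omega>) L) \<le> 1 + s * Z0 \<omega> + (min (Z0 \<omega>) L)\<^sup>2 * (exp (2 * s * L) / L\<^sup>2)"
      by simp
  qed
  also have "\<dots> = 1 + (s * ?m + ?g * (exp (2 * s * L) / L\<^sup>2))"
    using int ig by (simp add: prob_space)
  also have "\<dots> \<le> exp (s * ?m + ?g * (exp (2 * s * L) / L\<^sup>2))"
    by (rule exp_ge_add_one_self)
  finally have E: "expectation (\<lambda>\<omega>. exp (s * min (Z0 \<omega>) L)) \<le> exp (s * ?m + ?g * (exp (2 * s * L) / L\<^sup>2))" .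
  have "prob {\<omega> \<in> space M. real (card I) * ?m + d \<le> (\<Sum>i\<in>I. min (Z i \<omega>) L)}
      = prob {\<omega> \<in> space M. s * (real (card I) * ?m + d) \<le> (\<Sum>i\<in>I. s * min (Z i \<omega>) L)}"
    using s by (simp add: sum_distrib_left[symmetric])
  also have "\<dots> \<le> exp (- (s * (real (card I) * ?m + d)))
      * expectation (\<lambda>\<omega>. exp (s * min (Z0 \<omega>) L)) ^ card I"
    using s by (intro exp_markov_iid[OF iid, where h = "\<lambda>z. s * min z L"]
        integrable_const_bound[of _ "exp (s * L)"]) auto
  also have "\<dots> \<le> exp (- (s * (real (card I) * ?m + d))) * exp (s * ?m + ?g * (exp (2 * s * L) / L\<^sup>2)) ^ card I"
    using E by (intro mult_left_mono power_mono) auto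
  also have "\<dots> = exp (- s * d + real (card I) * ?g * exp (2 * s * L) / L\<^sup>2)"
    by (simp add: exp_of_nat_mult[symmetric] exp_add[symmetric] algebra_simps)
  finally show ?thesis .
qed

text \<open>Non-negative summands can be truncated from above without raising the sum, so downward
  deviations are exponentially unlikely even without a second moment. The rate depends only on the
  law and \<delta>, hence is uniform in the number of summands; y may be any majorant of the mean of
  the sum.\<close>

lemma iid_sum_lower:
  fixes Z0 :: "'a \<Rightarrow> real"
  assumes int: "integrable M Z0" and nonneg: "\<And>\<omega>. 0 \<le> Z0 \<omega>" and m: "0 < expectation Z0"
    and \<delta>: "0 < \<delta>"
  obtains s where "0 < s"
    "\<And>(Z :: 'i \<Rightarrow> 'a \<Rightarrow> real) I y. iid_copies Z I Z0 \<Longrightarrow> real (card I) * expectation Z0 \<le> y \<Longrightarrow>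
       prob {\<omega> \<in> space M. (\<Sum>i\<in>I. Z i \<omega>) \<le> real (card I) * expectation Z0 - \<delta> * y} \<le> exp (- s * y)"
proof -
  have [measurable]: "Z0 \<in> borel_measurable M" using int by simp
  let ?m = "expectation Z0"
  \<comment> \<open>Chosen so that card I * \<gamma> is at most half of the allowed deviation
    \<delta> * y.\<close>
  define \<gamma> where "\<gamma> = \<delta> * ?m / 2"
  have \<gamma>: "0 < \<gamma>" using \<delta> m by (simp add: \<gamma>_def)
  have "(\<lambda>k. expectation (\<lambda>\<omega>. min (Z0 \<omega>) (real k))) \<longlonglongrightarrow> ?m"
  proof (rule integral_dominated_convergence[where w = Z0])
    show "AE \<omega> in M. (\<lambda>k. min (Z0 \<omega>) (real k)) \<longlonglongrightarrow> Z0 \<omega>"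
    proof (rule AE_I2)
      fix \<omega>
      have "\<forall>\<^sub>F k in sequentially. min (Z0 \<omega>) (real k) = Z0 \<omega>"
        using eventually_ge_at_top[of "nat \<lceil>Z0 \<omega>\<rceil>"] by eventually_elim linarith
      then show "(\<lambda>k. min (Z0 \<omega>) (real k)) \<longlonglongrightarrow> Z0 \<omega>" by (rule tendsto_eventually)
    qed
  qed (use int nonneg in auto)
  then have "\<forall>\<^sub>F k in sequentially. ?m - \<gamma> / 2 < expectation (\<lambda>\<omega>. min (Z0 \<omega>) (real k))"
    using \<gamma> by (intro order_tendstoD) auto
  then have "\<forall>\<^sub>F k in sequentially. ?m - \<gamma> / 2 < expectation (\<lambda>\<omega>. min (Z0 \<omega>) (real k)) \<and> 0 < k"
    using eventually_gt_at_top[of "0::nat"] by eventually_elim auto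
  then obtain k where k: "?m - \<gamma> / 2 < expectation (\<lambda>\<omega>. min (Z0 \<omega>) (real k))" "0 < k"
    using eventually_happens'[OF sequentially_bot] by blast
  define A where "A = real k"
  have A: "0 < A" "?m - \<gamma> / 2 < expectation (\<lambda>\<omega>. min (Z0 \<omega>) A)" using k by (auto simp: A_def)
  \<comment> \<open>Makes (s A)^2 = s * \<gamma>: the quadratic Taylor term and the mean lost by
    truncation then cost s * \<gamma> / 2 each.\<close>
  define s where "s = \<gamma> / A\<^sup>2"
  have s: "0 < s" "s * A\<^sup>2 = \<gamma>" using \<gamma> A by (auto simp: s_def)
  have "expectation (\<lambda>\<omega>. exp (- s * min (Z0 \<omega>) A))
      \<le> expectation (\<lambda>\<omega>. 1 - s * min (Z0 \<omega>) A + s * \<gamma> / 2)"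
  proof (rule integral_mono)
    have "integrable M (\<lambda>\<omega>. min (Z0 \<omega>) A)"
      using A nonneg by (intro integrable_const_bound[of _ A]) (auto simp: min_def)
    then show "integrable M (\<lambda>\<omega>. 1 - s * min (Z0 \<omega>) A + s * \<gamma> / 2)" by simp
    show "integrable M (\<lambda>\<omega>. exp (- s * min (Z0 \<omega>) A))"
      using s A nonneg by (intro integrable_const_bound[of _ 1]) auto
    fix \<omega>
    define u where "u = s * min (Z0 \<omega>) A"
    have u: "0 \<le> u" "u \<le> s * A" using s A nonneg[of \<omega>] by (auto simp: u_def)
    obtain t where t: "\<bar>t\<bar> \<le> \<bar>-u\<bar>" "exp (-u) = 1 - u + u\<^sup>2 / 2 + exp t / 6 * (-u)^3"
      using Maclaurin_exp_le[of "-u" 3] by (auto simp: numeral_3_eq_3 numeral_2_eq_2)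
    have "exp t / 6 * (-u)^3 = - (exp t / 6 * u ^ 3)" by simp
    also have "\<dots> \<le> 0" using u by simp
    finally have "exp (-u) \<le> 1 - u + u\<^sup>2 / 2" using t(2) by simp
    also have "u\<^sup>2 \<le> (s * A)\<^sup>2" using u by (intro power_mono) auto
    also have "(s * A)\<^sup>2 = s * \<gamma>" using s(2) by (simp add: power2_eq_square algebra_simps flip: s(2))
    finally show "exp (- s * min (Z0 \<omega>) A) \<le> 1 - s * min (Z0 \<omega>) A + s * \<gamma> / 2"
      by (simp add: u_def)
  qed
  also have "\<dots> = 1 - s * expectation (\<lambda>\<omega>. min (Z0 \<omega>) A) + s * \<gamma> / 2"
  proof -
    have "integrable M (\<lambda>\<omega>. min (Z0 \<omega>) A)"
      using A nonneg by (intro integrable_const_bound[of _ A]) (auto simp: min_def)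
    then show ?thesis by (simp add: prob_space)
  qed
  also have "\<dots> \<le> 1 - s * (?m - \<gamma> / 2) + s * \<gamma> / 2"
    using A s by simp
  also have "\<dots> = 1 + (- s * (?m - \<gamma>))" by (simp add: algebra_simps)
  also have "\<dots> \<le> exp (- s * (?m - \<gamma>))" by (rule exp_ge_add_one_self)
  finally have E: "expectation (\<lambda>\<omega>. exp (- s * min (Z0 \<omega>) A)) \<le> exp (- s * (?m - \<gamma>))" .
  show thesis
  proof (rule that[of "s * \<delta> / 2"])
    show "0 < s * \<delta> / 2" using s \<delta> by simp
    fix Z :: "'i \<Rightarrow> 'a \<Rightarrow> real" and I y
    assume iid: "iid_copies Z I Z0" and y: "real (card I) * ?m \<le> y"
    note [measurable] = iid_copies_measurable[OF iid]
    let ?t = "real (card I) * ?m - \<delta> * y"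
    have "prob {\<omega> \<in> space M. (\<Sum>i\<in>I. Z i \<omega>) \<le> ?t}
        \<le> prob {\<omega> \<in> space M. - s * ?t \<le> (\<Sum>i\<in>I. - s * min (Z i \<omega>) A)}"
    proof (rule finite_measure_mono)
      show "{\<omega> \<in> space M. (\<Sum>i\<in>I. Z i \<omega>) \<le> ?t} \<subseteq> {\<omega> \<in> space M. - s * ?t \<le> (\<Sum>i\<in>I. - s * min (Z i \<omega>) A)}"
      proof safe
        fix \<omega> assume "(\<Sum>i\<in>I. Z i \<omega>) \<le> ?t"
        moreover have "(\<Sum>i\<in>I. min (Z i \<omega>) A) \<le> (\<Sum>i\<in>I. Z i \<omega>)" by (intro sum_mono) auto
        ultimately have "s * (\<Sum>i\<in>I. min (Z i \<omega>) A) \<le> s * ?t" using s by (intro mult_left_mono) auto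
        then show "- s * ?t \<le> (\<Sum>i\<in>I. - s * min (Z i \<omega>) A)"
          by (simp add: sum_distrib_left sum_negf)
      qed
    qed simp
    also have "\<dots> \<le> exp (- (- s * ?t)) * expectation (\<lambda>\<omega>. exp (- s * min (Z0 \<omega>) A)) ^ card I"
      using s A nonneg by (intro exp_markov_iid[OF iid, where h = "\<lambda>z. - s * min z A"]
          integrable_const_bound[of _ 1]) auto
    also have "\<dots> \<le> exp (- (- s * ?t)) * exp (- s * (?m - \<gamma>)) ^ card I"
      using E by (intro mult_left_mono power_mono) auto
    also have "\<dots> = exp (s * (real (card I) * \<gamma> - \<delta> * y))"
      by (simp add: exp_of_nat_mult[symmetric] exp_add[symmetric] algebra_simps)
    also have "\<dots> \<le> exp (- (s * \<delta> / 2) * y)"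
    proof -
      have "real (card I) * \<gamma> = \<delta> / 2 * (real (card I) * ?m)" by (simp add: \<gamma>_def)
      also have "\<dots> \<le> \<delta> / 2 * y" using y \<delta> by (intro mult_left_mono) auto
      finally have "s * (real (card I) * \<gamma> - \<delta> * y) \<le> s * (- (\<delta> / 2 * y))"
        using s by (intro mult_left_mono) auto
      then show ?thesis by simp
    qed
    finally show "prob {\<omega> \<in> space M. (\<Sum>i\<in>I. Z i \<omega>) \<le> ?t} \<le> exp (- (s * \<delta> / 2) * y)" .
  qed
qed

end

section \<open>Sums of independent variables with regularly varying tails\<close>

text \<open>A Karamata-type estimate. Passing from x to 2 * x adds at most 4 x^2 P(Z > x), which is
  of order x^2 G x, whereas x^2 G x itself grows at least by the factor 4 / 2^\<rho> > 1. The
  contributions are dominated by the last one.\<close>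

lemma (in prob_space) truncated_second_moment_bound:
  fixes Z :: "'a \<Rightarrow> real" and G :: "real \<Rightarrow> real"
  assumes [measurable]: "Z \<in> borel_measurable M" and nonneg: "\<And>\<omega>. 0 \<le> Z \<omega>"
    and G_pos: "\<And>x. x0 \<le> x \<Longrightarrow> 0 < G x" and G_anti: "\<And>x y. x0 \<le> x \<Longrightarrow> x \<le> y \<Longrightarrow> G y \<le> G x" and x0: "0 < x0"
    and tail: "\<And>x. x0 \<le> x \<Longrightarrow> upper_tail Z x \<le> C * G x"
    and doubling: "\<And>x. x0 \<le> x \<Longrightarrow> G x \<le> 2 powr \<rho> * G (2 * x)" and \<rho>: "\<rho> < 2" and C: "0 < C"
  obtains B where "0 < B" "\<And>L. x0 \<le> L \<Longrightarrow> expectation (\<lambda>\<omega>. (min (Z \<omega>) L)\<^sup>2) \<le> B * L\<^sup>2 * G L"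
proof -
  let ?g = "\<lambda>L. expectation (\<lambda>\<omega>. (min (Z \<omega>) L)\<^sup>2)"
  define \<theta> :: real where "\<theta> = 2 powr \<rho> / 4"
  have "2 powr \<rho> < (2::real) powr 2" using \<rho> by (intro powr_less_mono) auto
  then have \<theta>: "0 < \<theta>" "\<theta> < 1" by (auto simp: \<theta>_def)
  \<comment> \<open>The second entry is the fixed point of the map B to (B + 4 * C) * \<theta>
    performed by one doubling; the first covers the initial interval.\<close>
  define B where "B = max (1 / G (2 * x0)) (4 * C * \<theta> / (1 - \<theta>))"
  have Gx0: "0 < G (2 * x0)" using G_pos x0 by simp
  have B: "0 < B" "1 / G (2 * x0) \<le> B" "(B + 4 * C) * \<theta> \<le> B"
  proof -
    show "0 < B" using Gx0 by (simp add: B_def less_max_iff_disj)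
    show "1 / G (2 * x0) \<le> B" by (simp add: B_def)
    have "4 * C * \<theta> / (1 - \<theta>) \<le> B" by (simp add: B_def)
    then show "(B + 4 * C) * \<theta> \<le> B" using \<theta> by (simp add: field_simps)
  qed
  have int: "integrable M (\<lambda>\<omega>. (min (Z \<omega>) L)\<^sup>2)" if "0 \<le> L" for L
    using that nonneg by (intro integrable_const_bound[of _ "L\<^sup>2"]) (auto simp: min_def intro!: power_mono)
  have "?g L / (L\<^sup>2 * G L) \<le> B" if "x0 \<le> L" for L
  proof (rule dyadic_bound[of x0 "\<lambda>L. ?g L / (L\<^sup>2 * G L)"])
    show "0 < x0" "x0 \<le> L" by fact+
  next
    fix x assume x: "x0 \<le> x" "x \<le> 2 * x0"
    have "?g x \<le> expectation (\<lambda>\<omega>. x\<^sup>2)"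
      using x x0 nonneg int[of x] by (intro integral_mono power_mono) auto
    then have "?g x \<le> x\<^sup>2" by (simp add: prob_space)
    then have "?g x / (x\<^sup>2 * G x) \<le> x\<^sup>2 / (x\<^sup>2 * G x)"
      using x x0 G_pos[of x] by (intro divide_right_mono) auto
    also have "\<dots> = 1 / G x" using x x0 by simp
    also have "\<dots> \<le> 1 / G (2 * x0)"
      using x x0 G_pos[of x] Gx0 by (intro divide_left_mono G_anti) auto
    finally show "?g x / (x\<^sup>2 * G x) \<le> B" using B by simp
  next
    fix x assume x: "x0 \<le> x" "?g x / (x\<^sup>2 * G x) \<le> B"
    have Gx: "0 < G x" "0 < G (2 * x)" using x x0 G_pos by auto
    have ind: "integrable M (indicat_real {\<omega> \<in> space M. x < Z \<omega>})"
      by (intro integrable_const_bound[of _ 1]) auto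
    have "?g (2 * x) \<le> expectation (\<lambda>\<omega>. (min (Z \<omega>) x)\<^sup>2 + 4 * x\<^sup>2 * indicator {\<omega> \<in> space M. x < Z \<omega>} \<omega>)"
    proof (intro integral_mono int Bochner_Integration.integrable_add integrable_mult_right)
      fix \<omega> assume "\<omega> \<in> space M"
      have "Z \<omega> \<le> x \<or> (min (Z \<omega>) (2 * x))\<^sup>2 \<le> (2 * x)\<^sup>2"
        using nonneg[of \<omega>] x x0 by (intro disjI2 power_mono) auto
      then show "(min (Z \<omega>) (2 * x))\<^sup>2 \<le> (min (Z \<omega>) x)\<^sup>2 + 4 * x\<^sup>2 * indicator {\<omega> \<in> space M. x < Z \<omega>} \<omega>"
        using \<open>\<omega> \<in> space M\<close> x x0 by (cases "x < Z \<omega>") (auto simp: power_mult_distrib intro: order_trans)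
    qed (use x x0 ind in auto)
    also have "\<dots> = ?g x + 4 * x\<^sup>2 * upper_tail Z x"
    proof -
      have "{\<omega> \<in> space M. x < Z \<omega>} \<inter> space M = {\<omega> \<in> space M. x < Z \<omega>}" by auto
      then show ?thesis using x x0 int[of x] ind by simp
    qed
    also have "\<dots> \<le> B * (x\<^sup>2 * G x) + 4 * x\<^sup>2 * (C * G x)"
      using x x0 Gx tail[of x] by (intro add_mono mult_left_mono) (auto simp: field_simps)
    also have "\<dots> = (B + 4 * C) * x\<^sup>2 * G x" by (simp add: algebra_simps)
    also have "\<dots> \<le> (B + 4 * C) * x\<^sup>2 * (2 powr \<rho> * G (2 * x))"
      using doubling x B C by (intro mult_left_mono) auto
    also have "\<dots> = ((B + 4 * C) * \<theta>) * ((2 * x)\<^sup>2 * G (2 * x))"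
      by (simp add: \<theta>_def power_mult_distrib)
    also have "\<dots> \<le> B * ((2 * x)\<^sup>2 * G (2 * x))"
      using B Gx by (intro mult_right_mono) auto
    finally show "?g (2 * x) / ((2 * x)\<^sup>2 * G (2 * x)) \<le> B"
      using Gx x x0 by (simp add: field_simps)
  qed
  then show thesis
    using that[of B] B(1) G_pos x0 by (simp add: field_simps)
qed

locale rv_prob = prob_space M + rv_function F \<alpha> for M :: "'a measure" and F \<alpha>
begin

text \<open>One big jump: if the sum exceeds x, one variable exceeds (1 - \<delta>) * x or both
  exceed \<delta> * x, and the latter has probability o(F) by independence. Conversely,
  inclusion-exclusion loses only the product of the two tails.\<close>

lemma tail_add_indep:
  assumes ind: "indep_var borel W borel Z"
    and nonneg: "\<And>\<omega>. \<omega> \<in> space M \<Longrightarrow> 0 \<le> W \<omega>" "\<And>\<omega>. \<omega> \<in> space M \<Longrightarrow> 0 \<le> Z \<omega>"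
    and reg: "regular (upper_tail W)" "regular (upper_tail Z)"
  shows "(\<lambda>x. upper_tail (\<lambda>\<omega>. W \<omega> + Z \<omega>) x - (upper_tail W x + upper_tail Z x)) \<in> o(F)"
proof (rule smalloI)
  fix e :: real assume e: "0 < e"
  have [measurable]: "W \<in> borel_measurable M" "Z \<in> borel_measurable M"
    using ind by (auto dest: indep_var_rv1 indep_var_rv2)
  have prod: "prob ({\<omega> \<in> space M. x < W \<omega>} \<inter> {\<omega> \<in> space M. x < Z \<omega>}) = upper_tail W x * upper_tail Z x" for x
  proof -
    have "prob ((\<lambda>\<omega>. (W \<omega>, Z \<omega>)) -` ({x<..} \<times> {x<..}) \<inter> space M)
        = prob (W -` {x<..} \<inter> space M) * prob (Z -` {x<..} \<inter> space M)"
      by (rule indep_varD[OF ind]) auto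
    moreover have "(\<lambda>\<omega>. (W \<omega>, Z \<omega>)) -` ({x<..} \<times> {x<..}) \<inter> space M
        = {\<omega> \<in> space M. x < W \<omega>} \<inter> {\<omega> \<in> space M. x < Z \<omega>}" by auto
    moreover have "V -` {x<..} \<inter> space M = {\<omega> \<in> space M. x < V \<omega>}" for V :: "'a \<Rightarrow> real" by auto
    ultimately show ?thesis by simp
  qed
  let ?s = "\<lambda>x. upper_tail W x + upper_tail Z x"
  have "0 < e / 2" using e by simp
  then obtain \<delta> where \<delta>: "0 < \<delta>" "\<delta> < 1" "\<forall>\<^sub>F x in at_top. \<bar>?s ((1 - \<delta>) * x) - ?s x\<bar> \<le> e / 2 * F x"
    by (rule regular_near_1[OF regular_add[OF reg]])
  have "(\<lambda>x. upper_tail W (q * x) * upper_tail Z (q * x)) \<in> o(F)" if "0 < q" for q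
    using reg that by (intro bigo_mult_smallo bigo_scale regular_bigo)
  then have "\<forall>\<^sub>F x in at_top. \<bar>upper_tail W (q * x) * upper_tail Z (q * x)\<bar> \<le> e / 2 * F x" if "0 < q" for q
    using that e by (intro smalloD) auto
  from \<delta>(3) this[OF \<delta>(1)] this[OF zero_less_one]
  show "\<forall>\<^sub>F x in at_top. \<bar>upper_tail (\<lambda>\<omega>. W \<omega> + Z \<omega>) x - ?s x\<bar> \<le> e * F x"
  proof eventually_elim
    case (elim x)
    have "upper_tail (\<lambda>\<omega>. W \<omega> + Z \<omega>) x
      \<le> prob ({\<omega> \<in> space M. (1 - \<delta>) * x < W \<omega>} \<union> {\<omega> \<in> space M. (1 - \<delta>) * x < Z \<omega>}
          \<union> ({\<omega> \<in> space M. \<delta> * x < W \<omega>} \<inter> {\<omega> \<in> space M. \<delta> * x < Z \<omega>}))"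
      by (intro finite_measure_mono) (auto simp: algebra_simps)
    also have "\<dots> \<le> prob ({\<omega> \<in> space M. (1 - \<delta>) * x < W \<omega>} \<union> {\<omega> \<in> space M. (1 - \<delta>) * x < Z \<omega>})
        + prob ({\<omega> \<in> space M. \<delta> * x < W \<omega>} \<inter> {\<omega> \<in> space M. \<delta> * x < Z \<omega>})"
      by (intro measure_Un_le) auto
    also have "prob ({\<omega> \<in> space M. (1 - \<delta>) * x < W \<omega>} \<union> {\<omega> \<in> space M. (1 - \<delta>) * x < Z \<omega>}) \<le> ?s ((1 - \<delta>) * x)"
      by (intro measure_Un_le) auto
    also note prod
    finally have upper: "upper_tail (\<lambda>\<omega>. W \<omega> + Z \<omega>) x \<le> ?s ((1 - \<delta>) * x) + upper_tail W (\<delta> * x) * upper_tail Z (\<delta> * x)"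
      by simp
    have "?s x - upper_tail W x * upper_tail Z x
        = prob ({\<omega> \<in> space M. x < W \<omega>} \<union> {\<omega> \<in> space M. x < Z \<omega>})"
      using measure_Un3[of "{\<omega> \<in> space M. x < W \<omega>}" M "{\<omega> \<in> space M. x < Z \<omega>}"] prod[of x]
      by (simp add: fmeasurable_eq_sets)
    also have "\<dots> \<le> upper_tail (\<lambda>\<omega>. W \<omega> + Z \<omega>) x"
      by (intro finite_measure_mono) (auto dest: nonneg)
    finally have lower: "?s x - upper_tail W x * upper_tail Z x \<le> upper_tail (\<lambda>\<omega>. W \<omega> + Z \<omega>) x" .
    have "upper_tail W x * upper_tail Z x \<le> e / 2 * F x"
      "upper_tail W (\<delta> * x) * upper_tail Z (\<delta> * x) \<le> e / 2 * F x"
      "?s ((1 - \<delta>) * x) - ?s x \<le> e / 2 * F x"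
      using abs_le_D1[OF elim(1)] abs_le_D1[OF elim(2)] abs_le_D1[OF elim(3)] by auto
    moreover have "0 < e * F x" using e pos by simp
    ultimately show ?case using upper lower by (intro abs_leI) linarith+
  qed
qed

lemma tail_sum_indep:
  assumes "finite I" "indep_vars (\<lambda>_. borel) Z I"
    and "\<And>i \<omega>. i \<in> I \<Longrightarrow> \<omega> \<in> space M \<Longrightarrow> 0 \<le> Z i \<omega>" and "\<And>i. i \<in> I \<Longrightarrow> regular (upper_tail (Z i))"
  shows "(\<lambda>x. upper_tail (\<lambda>\<omega>. \<Sum>i\<in>I. Z i \<omega>) x - (\<Sum>i\<in>I. upper_tail (Z i) x)) \<in> o(F)"
  using assms
proof (induction I rule: finite_induct)
  case empty
  show ?case
  proof (rule smalloI)
    fix e :: real assume e: "0 < e"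
    show "\<forall>\<^sub>F x in at_top. \<bar>upper_tail (\<lambda>\<omega>. \<Sum>i\<in>{}. Z i \<omega>) x - (\<Sum>i\<in>{}. upper_tail (Z i) x)\<bar> \<le> e * F x"
      \<comment> \<open>A negative x is exceeded by the empty sum, whose tail vanishes only from 0
        on.\<close>
      using eventually_ge_at_top[of "0::real"]
      by eventually_elim (use e pos in \<open>auto simp: less_imp_le\<close>)
  qed
next
  case (insert i I)
  have ind: "indep_vars (\<lambda>_. borel) Z I" using insert.prems(1) by (rule indep_vars_subset) auto
  have IH: "(\<lambda>x. upper_tail (\<lambda>\<omega>. \<Sum>i\<in>I. Z i \<omega>) x - (\<Sum>i\<in>I. upper_tail (Z i) x)) \<in> o(F)"
    using insert.prems by (intro insert.IH ind) auto
  have "regular (\<lambda>x. \<Sum>i\<in>I. upper_tail (Z i) x)"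
    using insert by (intro regular_sum) auto
  then have reg: "regular (upper_tail (\<lambda>\<omega>. \<Sum>i\<in>I. Z i \<omega>))"
    using IH by (rule regular_smallo_diff)
  have "(\<lambda>x. upper_tail (\<lambda>\<omega>. Z i \<omega> + (\<Sum>i\<in>I. Z i \<omega>)) x
      - (upper_tail (Z i) x + upper_tail (\<lambda>\<omega>. \<Sum>i\<in>I. Z i \<omega>) x)) \<in> o(F)"
    using insert reg by (intro tail_add_indep indep_vars_sum sum_nonneg) auto
  from sum_in_smallo(1)[OF this IH] show ?case
    using insert by (simp add: algebra_simps)
qed

text \<open>Bounds the variance term of the Chernoff exponent by a positive power of n * F L, which
  a small exponent s can later cancel. For \<alpha> < 2 the truncated second moment is O(L^2 F L)
  and the power is 1. For \<alpha> at least 2 that order fails in general, and a detour through pure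
  powers of L is made.\<close>

lemma truncated_second_moment_powr:
  fixes Z :: "'a \<Rightarrow> real"
  assumes Z[measurable]: "Z \<in> borel_measurable M" and nonneg: "\<And>\<omega>. 0 \<le> Z \<omega>"
    and tail: "upper_tail Z \<in> O(F)"
  obtains \<kappa> where "0 < \<kappa>" "\<And>c. 0 < c \<Longrightarrow> \<exists>C>0. \<exists>x0>0. \<forall>L\<ge>x0. \<forall>n. 1 \<le> n \<longrightarrow> n \<le> c * L \<longrightarrow>
    n * expectation (\<lambda>\<omega>. (min (Z \<omega>) L)\<^sup>2) / L\<^sup>2 \<le> C * (n * F L) powr (2 * \<kappa>)"
proof -
  let ?g = "\<lambda>L. expectation (\<lambda>\<omega>. (min (Z \<omega>) L)\<^sup>2)"
  obtain C0 where C0: "0 < C0" "\<forall>\<^sub>F x in at_top. \<bar>upper_tail Z x\<bar> \<le> C0 * F x"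
    using bigoD[OF tail] by blast
  then obtain x1 where x1: "\<And>x. x1 \<le> x \<Longrightarrow> upper_tail Z x \<le> C0 * F x"
    unfolding eventually_at_top_linorder using abs_le_D1 by blast
  show thesis
  proof (cases "\<alpha> < 2")
    case True
    define \<rho> where "\<rho> = (\<alpha> + 2) / 2"
    have \<rho>: "\<alpha> < \<rho>" "\<rho> < 2" using True by (auto simp: \<rho>_def)
    obtain x2 where x2: "1 \<le> x2" "\<And>x. x2 \<le> x \<Longrightarrow> F x \<le> 2 powr \<rho> * F (2 * x)"
      using lower_bound[OF \<rho>(1)] by metis
    define x0 where "x0 = max x1 x2"
    have x0: "0 < x0" using x2 by (auto simp: x0_def)
    obtain B where B: "0 < B" "\<And>L. x0 \<le> L \<Longrightarrow> ?g L \<le> B * L\<^sup>2 * F L"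
    proof (rule truncated_second_moment_bound[OF Z nonneg, of x0 F C0 \<rho>])
      show "upper_tail Z x \<le> C0 * F x" "F x \<le> 2 powr \<rho> * F (2 * x)" if "x0 \<le> x" for x
        using that x1 x2 by (auto simp: x0_def)
    qed (use x0 pos antimono C0 \<rho> in auto)
    show thesis
    proof (rule that[of "1/2"], goal_cases)
      case (2 c)
      have "n * ?g L / L\<^sup>2 \<le> B * (n * F L) powr (2 * (1/2))" if "x0 \<le> L" "1 \<le> n" for n L
      proof -
        have "n * ?g L / L\<^sup>2 \<le> n * (B * L\<^sup>2 * F L) / L\<^sup>2"
          using that B by (intro divide_right_mono mult_left_mono) auto
        also have "\<dots> = B * (n * F L)" using that x0 by simp
        finally show ?thesis using that pos[of L] by simp
      qed
      then show ?case using B x0 by blast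
    qed simp
  next
    case False
    \<comment> \<open>Any exponent strictly between 1 and 2 would do: below 2 for the truncated
      second moment (and thus below \<alpha>), above 1 to beat the factor n, which is at most c *
      L.\<close>
    obtain C1 x2 where C1: "0 < C1" "1 \<le> x2" "\<And>x. x2 \<le> x \<Longrightarrow> F x \<le> C1 * x powr (-(7/4))"
      using upper_bound[of "7/4"] False by auto
    obtain C2 x3 where C2: "0 < C2" "1 \<le> x3" "\<And>x. x3 \<le> x \<Longrightarrow> C2 * x powr (-(\<alpha> + 1)) \<le> F x"
      using lower_bound[of "\<alpha> + 1"] less_add_one by metis
    define x0 where "x0 = max x1 (max x2 x3)"
    have x0: "1 \<le> x0" using C1 by (auto simp: x0_def)
    obtain B where B: "0 < B" "\<And>L. x0 \<le> L \<Longrightarrow> ?g L \<le> B * L\<^sup>2 * L powr (-(7/4))"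
    proof (rule truncated_second_moment_bound[OF Z nonneg, of x0 "\<lambda>x. x powr (-(7/4))" "C0 * C1" "7/4"])
      fix x assume x: "x0 \<le> x"
      have "upper_tail Z x \<le> C0 * F x" using x x1 by (auto simp: x0_def)
      also have "\<dots> \<le> C0 * (C1 * x powr (-(7/4)))" using x C0 C1 by (intro mult_left_mono) (auto simp: x0_def)
      finally show "upper_tail Z x \<le> C0 * C1 * x powr (-(7/4))" by simp
      show "x powr (-(7/4)) \<le> 2 powr (7/4) * (2 * x) powr (-(7/4))"
        using x x0 by (simp add: powr_mult powr_minus)
      show "y powr (-(7/4)) \<le> x powr (-(7/4))" if "x \<le> y" for y
        using that x x0 by (intro powr_mono2') auto
    qed (use x0 C0 C1 in auto)
    \<comment> \<open>After n is bounded by c * L there remains L^(-3/4); as F L is at least of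
      order L^(-(\<alpha> + 1)), this is at most a constant times (F L)^(2 \<kappa>).\<close>
    define \<kappa> where "\<kappa> = 3 / (8 * (\<alpha> + 1))"
    have \<kappa>: "0 < \<kappa>" "(\<alpha> + 1) * (2 * \<kappa>) = 3/4" using index_ge_1 by (auto simp: \<kappa>_def field_simps)
    show thesis
    proof (rule that[of \<kappa>], goal_cases)
      case (2 c)
      have "n * ?g L / L\<^sup>2 \<le> (c * B / C2 powr (2 * \<kappa>)) * (n * F L) powr (2 * \<kappa>)"
        if L: "x0 \<le> L" and n: "1 \<le> n" "n \<le> c * L" for n L
      proof -
        have "n * ?g L / L\<^sup>2 \<le> n * (B * L\<^sup>2 * L powr (-(7/4))) / L\<^sup>2"
          using L n B by (intro divide_right_mono mult_left_mono) auto
        also have "\<dots> = n * (B * L powr (-(7/4)))" using L x0 by simp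
        also have "\<dots> \<le> (c * L) * (B * L powr (-(7/4)))" using n B by (intro mult_right_mono) auto
        also have "\<dots> = c * B * (L powr 1 * L powr (-(7/4)))" using L x0 by simp
        also have "L powr 1 * L powr (-(7/4)) = L powr (-(3/4))" by (simp only: powr_add[symmetric]) simp
        also have "L powr (-(3/4)) = (L powr (-(\<alpha> + 1))) powr (2 * \<kappa>)"
          unfolding powr_powr using \<kappa>(2) by (metis minus_mult_left)
        also have "\<dots> = (C2 * L powr (-(\<alpha> + 1))) powr (2 * \<kappa>) / C2 powr (2 * \<kappa>)"
          using C2 by (simp add: powr_mult)
        also have "(C2 * L powr (-(\<alpha> + 1))) powr (2 * \<kappa>) \<le> (n * F L) powr (2 * \<kappa>)"
        proof (rule powr_mono2)
          have "C2 * L powr (-(\<alpha> + 1)) \<le> 1 * F L" using C2(3)[of L] L by (simp add: x0_def)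
          also have "\<dots> \<le> n * F L" using n pos[of L] by (intro mult_right_mono) auto
          finally show "C2 * L powr (-(\<alpha> + 1)) \<le> n * F L" .
        qed (use \<kappa> C2 in auto)
        finally show ?thesis using 2 B by (simp add: divide_right_mono mult_left_mono)
      qed
      moreover have "0 < c * B / C2 powr (2 * \<kappa>)" "0 < x0" using 2 B C2 x0 by auto
      ultimately show ?case by blast
    qed (use \<kappa> in auto)
  qed
qed

text \<open>The exponent \<open>s\<close> of the Chernoff bound is chosen such that \<open>exp (s * L)\<close> is a small
  negative power of \<open>card I * F L\<close>; this works uniformly in \<open>card I\<close> even if \<open>\<alpha> = 1\<close>.\<close>

lemma iid_sum_upper:
  fixes Z0 :: "'a \<Rightarrow> real"
  assumes int: "integrable M Z0" and nonneg: "\<And>\<omega>. 0 \<le> Z0 \<omega>" and tail: "upper_tail Z0 \<in> O(F)"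
    and \<delta>: "0 < \<delta>" and c: "0 < c"
  obtains C x0 where "0 < C" "0 < x0"
    "\<And>(Z :: 'i \<Rightarrow> 'a \<Rightarrow> real) I x. iid_copies Z I Z0 \<Longrightarrow> x0 \<le> x \<Longrightarrow> real (card I) \<le> c * x \<Longrightarrow>
       prob {\<omega> \<in> space M. real (card I) * expectation Z0 + \<delta> * x < (\<Sum>i\<in>I. Z i \<omega>)} \<le> C * real (card I) * F x"
proof -
  have [measurable]: "Z0 \<in> borel_measurable M" using int by simp
  let ?m = "expectation Z0" and ?g = "\<lambda>L. expectation (\<lambda>\<omega>. (min (Z0 \<omega>) L)\<^sup>2)"
  obtain \<kappa> where \<kappa>: "0 < \<kappa>" "\<And>c. 0 < c \<Longrightarrow> \<exists>C>0. \<exists>x0>0. \<forall>L\<ge>x0. \<forall>n. 1 \<le> n \<longrightarrow> n \<le> c * L \<longrightarrow>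
      n * ?g L / L\<^sup>2 \<le> C * (n * F L) powr (2 * \<kappa>)"
    by (rule truncated_second_moment_powr[OF _ nonneg tail]) auto
  \<comment> \<open>With truncation at L = \<theta> * x and s * L = - \<kappa> * ln w, the gain
    exp(- s * \<delta> * x) is exactly w.\<close>
  define \<theta> where "\<theta> = \<kappa> * \<delta>"
  have \<theta>: "0 < \<theta>" using \<kappa> \<delta> by (simp add: \<theta>_def)
  obtain C1 x1 where C1: "0 < C1" "0 < x1" "\<And>L n. x1 \<le> L \<Longrightarrow> 1 \<le> n \<Longrightarrow> n \<le> c / \<theta> * L \<Longrightarrow>
      n * ?g L / L\<^sup>2 \<le> C1 * (n * F L) powr (2 * \<kappa>)"
    using \<kappa>(2)[of "c / \<theta>"] c \<theta> by (metis divide_pos_pos)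
  obtain C2 where C2: "0 < C2" "\<forall>\<^sub>F x in at_top. \<bar>upper_tail Z0 x\<bar> \<le> C2 * F x"
    using bigoD[OF tail] by blast
  then obtain x2 where x2: "\<And>x. x2 \<le> x \<Longrightarrow> upper_tail Z0 x \<le> C2 * F x"
    unfolding eventually_at_top_linorder using abs_le_D1 by blast
  obtain C3 where C3: "0 < C3" "\<forall>\<^sub>F x in at_top. \<bar>F (\<theta> * x)\<bar> \<le> C3 * F x"
    using bigoD[OF scale_bigo[OF \<theta>]] by blast
  then obtain x3 where x3: "\<And>x. x3 \<le> x \<Longrightarrow> F (\<theta> * x) \<le> C3 * F x"
    unfolding eventually_at_top_linorder using abs_le_D1 by blast
  define x0 where "x0 = max (x1 / \<theta>) (max (x2 / \<theta>) x3)"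
  have x0: "0 < x0" using C1 \<theta> by (auto simp: x0_def less_max_iff_disj)
  define C where "C = C2 + exp C1 + 1"
  have C: "0 < C" using C2 by (simp add: C_def add_pos_pos)
  show thesis
  proof (rule that[of "C * C3" x0])
    show "0 < C * C3" "0 < x0" using C C3 x0 by auto
    fix Z :: "'i \<Rightarrow> 'a \<Rightarrow> real" and I x
    assume iid: "iid_copies Z I Z0" and x: "x0 \<le> x" and card: "real (card I) \<le> c * x"
    note [measurable] = iid_copies_measurable[OF iid]
    define n where "n = real (card I)"
    define L where "L = \<theta> * x"
    have fin: "finite I" using iid by (simp add: iid_copies_def)
    have x_pos: "0 < x" using x x0 by simp
    have L: "0 < L" "x1 \<le> L" "x2 \<le> L" using x x_pos \<theta> by (auto simp: L_def x0_def field_simps)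
    have FL: "F L \<le> C3 * F x" using x x3 by (auto simp: L_def x0_def)
    let ?P = "prob {\<omega> \<in> space M. n * ?m + \<delta> * x < (\<Sum>i\<in>I. Z i \<omega>)}"
    have "?P \<le> C * (n * F L)"
    proof (cases "I = {}")
      case True
      have "\<not> (\<delta> * x < 0)" using \<delta> x x0 by (simp add: not_less)
      then show ?thesis using True by (simp add: n_def)
    next
      case False
      then have n: "1 \<le> n" using fin by (simp add: n_def Suc_leI card_gt_0_iff)
      define w where "w = n * F L"
      have w: "0 < w" using n pos by (simp add: w_def)
      show ?thesis
      \<comment> \<open>Here w = n * F L is the claimed order. If it exceeds 1 the bound is trivial;
        otherwise ln w is at most 0 and the exponent s below is admissible.\<close>
      proof (cases "1 < w")
        case True
        have "?P \<le> 1" by simp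
        also have "\<dots> \<le> 1 * w" using True by simp
        also have "\<dots> \<le> C * w" using w C2 by (intro mult_right_mono) (auto simp: C_def)
        finally show ?thesis by (simp add: w_def)
      next
        case False
        \<comment> \<open>The factor exp(2 * s * L) becomes w^(-2 \<kappa>), which cancels the power
          w^(2 \<kappa>) bounding the variance term; the latter contributes only a constant.\<close>
        define s where "s = - \<kappa> * ln w / L"
        have "ln w \<le> 0" using False w by simp
        then have s: "0 \<le> s" using \<kappa>(1) L(1) by (simp add: s_def mult_le_0_iff divide_nonpos_pos)
        have sL: "s * L = - \<kappa> * ln w" using L by (simp add: s_def)
        have "exp (2 * s * L) = w powr (- (2 * \<kappa>))"
          using w sL by (simp add: powr_def mult.assoc)
        have ev: "(\<Union>i\<in>I. {\<omega> \<in> space M. L < Z i \<omega>}) \<in> events"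
            "{\<omega> \<in> space M. n * ?m + \<delta> * x \<le> (\<Sum>i\<in>I. min (Z i \<omega>) L)} \<in> events"
          using fin by (auto intro!: sets.finite_UN)
        have "?P \<le> prob ((\<Union>i\<in>I. {\<omega> \<in> space M. L < Z i \<omega>})
            \<union> {\<omega> \<in> space M. n * ?m + \<delta> * x \<le> (\<Sum>i\<in>I. min (Z i \<omega>) L)})"
        proof (rule finite_measure_mono)
          show "{\<omega> \<in> space M. n * ?m + \<delta> * x < (\<Sum>i\<in>I. Z i \<omega>)}
            \<subseteq> (\<Union>i\<in>I. {\<omega> \<in> space M. L < Z i \<omega>}) \<union> {\<omega> \<in> space M. n * ?m + \<delta> * x \<le> (\<Sum>i\<in>I. min (Z i \<omega>) L)}"
          proof
            fix \<omega> assume \<omega>: "\<omega> \<in> {\<omega> \<in> space M. n * ?m + \<delta> * x < (\<Sum>i\<in>I. Z i \<omega>)}"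
            show "\<omega> \<in> (\<Union>i\<in>I. {\<omega> \<in> space M. L < Z i \<omega>}) \<union> {\<omega> \<in> space M. n * ?m + \<delta> * x \<le> (\<Sum>i\<in>I. min (Z i \<omega>) L)}"
            proof (cases "\<exists>i\<in>I. L < Z i \<omega>")
              case False
              then have "(\<Sum>i\<in>I. min (Z i \<omega>) L) = (\<Sum>i\<in>I. Z i \<omega>)" by (intro sum.cong) auto
              then show ?thesis using \<omega> by auto
            qed (use \<omega> in auto)
          qed
        qed (use ev in auto)
        also have "\<dots> \<le> prob (\<Union>i\<in>I. {\<omega> \<in> space M. L < Z i \<omega>})
            + prob {\<omega> \<in> space M. n * ?m + \<delta> * x \<le> (\<Sum>i\<in>I. min (Z i \<omega>) L)}"
          using ev by (rule measure_Un_le)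
        also have "prob (\<Union>i\<in>I. {\<omega> \<in> space M. L < Z i \<omega>}) \<le> (\<Sum>i\<in>I. upper_tail (Z i) L)"
          using fin by (intro finite_measure_subadditive_finite) auto
        also have "\<dots> = (\<Sum>i\<in>I. upper_tail Z0 L)"
          using iid by (intro sum.cong upper_tail_cong_distr) (auto simp: iid_copies_def)
        also have "\<dots> \<le> C2 * w"
          using x2[OF L(3)] n by (simp add: n_def w_def mult.left_commute mult_left_mono)
        also have "prob {\<omega> \<in> space M. n * ?m + \<delta> * x \<le> (\<Sum>i\<in>I. min (Z i \<omega>) L)}
            \<le> exp (- s * (\<delta> * x) + n * ?g L * exp (2 * s * L) / L\<^sup>2)"
          unfolding n_def by (rule truncated_sum_upper[OF iid int nonneg s L(1)])
        also have "\<dots> \<le> exp (ln w + C1)"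
        proof -
          have "- s * (\<delta> * x) = ln w"
            using x x0 \<theta> \<kappa> \<delta> by (simp add: s_def L_def \<theta>_def field_simps)
          moreover have "n * ?g L * exp (2 * s * L) / L\<^sup>2 \<le> C1"
          proof -
            have "n * ?g L * exp (2 * s * L) / L\<^sup>2 = (n * ?g L / L\<^sup>2) * w powr (- (2 * \<kappa>))"
              using \<open>exp (2 * s * L) = _\<close> by simp
            also have "\<dots> \<le> (C1 * w powr (2 * \<kappa>)) * w powr (- (2 * \<kappa>))"
              unfolding w_def using card \<theta> L n
              by (intro mult_right_mono C1(3)) (auto simp: n_def L_def)
            also have "\<dots> = C1" using w by (simp add: powr_minus field_simps)
            finally show ?thesis .
          qed
          ultimately show ?thesis by simp
        qed
        also have "\<dots> = exp C1 * w" using w by (simp add: exp_add)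
        finally have "?P \<le> C2 * w + exp C1 * w" by simp
        also have "\<dots> \<le> C * w" using w by (simp add: C_def algebra_simps)
        finally show ?thesis by (simp add: w_def)
      qed
    qed
    also have "\<dots> \<le> C * (n * (C3 * F x))" using C FL by (intro mult_left_mono) (auto simp: n_def)
    finally show "prob {\<omega> \<in> space M. real (card I) * ?m + \<delta> * x < (\<Sum>i\<in>I. Z i \<omega>)} \<le> C * C3 * real (card I) * F x"
      by (simp add: n_def algebra_simps)
  qed
qed

end

section \<open>Random sums\<close>

context rv_prob
begin

text \<open>\<open>Q k l x\<close> stands for the conditional probability of exceeding x given the
  population sizes k and l. The hypothesis \<open>fixed\<close> supplies the pointwise limit,
  \<open>below\<close> the integrable majorant for dominated convergence, and \<open>above\<close>
  the lower bound where Y is large.\<close>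

lemma tail_mixture:
  fixes N1 N2 :: "'a \<Rightarrow> nat" and Q :: "nat \<Rightarrow> nat \<Rightarrow> real \<Rightarrow> real" and c1 c2 :: real
  defines "Y \<equiv> \<lambda>\<omega>. c1 * real (N1 \<omega>) + c2 * real (N2 \<omega>)"
  assumes N1[measurable]: "N1 \<in> measurable M (count_space UNIV)"
    and N2[measurable]: "N2 \<in> measurable M (count_space UNIV)"
    and int: "integrable M (\<lambda>\<omega>. real (N1 \<omega>))" "integrable M (\<lambda>\<omega>. real (N2 \<omega>))"
    and Q01: "\<And>k l x. 0 \<le> Q k l x" "\<And>k l x. Q k l x \<le> 1"
    and Y: "regular (upper_tail Y)" and t: "t1 \<in> O(F)" "t2 \<in> O(F)"
    and fixed: "\<And>k l. (\<lambda>x. Q k l x - (real k * t1 x + real l * t2 x + F x)) \<in> o(F)"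
    and below: "\<And>\<delta>. 0 < \<delta> \<Longrightarrow> \<delta> < 1 \<Longrightarrow> \<exists>C. \<forall>\<^sub>F x in at_top. \<forall>k l.
        c1 * real k + c2 * real l \<le> (1 - \<delta>) * x \<longrightarrow> Q k l x \<le> C * (1 + real k + real l) * F x"
    and above: "\<And>\<delta> e. 0 < \<delta> \<Longrightarrow> 0 < e \<Longrightarrow> \<forall>\<^sub>F x in at_top. \<forall>k l.
        (1 + \<delta>) * x < c1 * real k + c2 * real l \<longrightarrow> 1 - e \<le> Q k l x"
  shows "(\<lambda>x. expectation (\<lambda>\<omega>. Q (N1 \<omega>) (N2 \<omega>) x) - (upper_tail Y x
      + expectation (\<lambda>\<omega>. real (N1 \<omega>)) * t1 x + expectation (\<lambda>\<omega>. real (N2 \<omega>)) * t2 x + F x)) \<in> o(F)"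
proof (rule smalloI)
  fix e :: real assume e: "0 < e"
  have [measurable]: "Y \<in> borel_measurable M" unfolding Y_def by measurable
  have [measurable]: "(\<lambda>\<omega>. Q (N1 \<omega>) (N2 \<omega>) x) \<in> borel_measurable M" for x
    by (rule measurable_compose_countable[OF measurable_compose[OF N2] N1]) simp
  have "0 < e / 4" using e by simp
  then obtain \<delta> where \<delta>: "0 < \<delta>" "\<delta> < 1"
      "\<forall>\<^sub>F x in at_top. \<bar>upper_tail Y ((1 - \<delta>) * x) - upper_tail Y x\<bar> \<le> e / 4 * F x"
      "\<forall>\<^sub>F x in at_top. \<bar>upper_tail Y ((1 + \<delta>) * x) - upper_tail Y x\<bar> \<le> e / 4 * F x"
    by (rule regular_near_1[OF Y])
  obtain CY where CY: "0 < CY" "\<forall>\<^sub>F x in at_top. \<bar>upper_tail Y ((1 + \<delta>) * x)\<bar> \<le> CY * F x"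
    using bigoD[OF bigo_scale[OF regular_bigo[OF Y], of "1 + \<delta>"]] \<delta> by auto
  define e' where "e' = e / (4 * CY)"
  have e': "0 < e'" using e CY by (simp add: e'_def)
  obtain C where C: "\<forall>\<^sub>F x in at_top. \<forall>k l.
        c1 * real k + c2 * real l \<le> (1 - \<delta>) * x \<longrightarrow> Q k l x \<le> C * (1 + real k + real l) * F x"
    using below[OF \<delta>(1,2)] by blast
  obtain C1 where C1: "0 < C1" "\<forall>\<^sub>F x in at_top. \<bar>t1 x\<bar> \<le> C1 * F x" using bigoD[OF t(1)] by blast
  obtain C2 where C2: "0 < C2" "\<forall>\<^sub>F x in at_top. \<bar>t2 x\<bar> \<le> C2 * F x" using bigoD[OF t(2)] by blast
  let ?A = "\<lambda>x. {\<omega> \<in> space M. Y \<omega> \<le> (1 - \<delta>) * x}" and ?B = "\<lambda>q x. {\<omega> \<in> space M. q * x < Y \<omega>}"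
  let ?Q = "\<lambda>x \<omega>. Q (N1 \<omega>) (N2 \<omega>) x"
  let ?T = "\<lambda>x k l. real k * t1 x + real l * t2 x + F x"
  let ?\<phi> = "\<lambda>x \<omega>. (indicator (?A x) \<omega> * ?Q x \<omega> - ?T x (N1 \<omega>) (N2 \<omega>)) / F x"
  have intQ: "integrable M (?Q x)" for x
    using Q01 by (intro integrable_const_bound[of _ 1]) auto
  have intI: "integrable M (\<lambda>\<omega>. indicator (S x) \<omega> * ?Q x \<omega>)" if "\<And>x. S x \<in> events" for x S
    using Q01 that by (intro integrable_const_bound[of _ 1]) (auto simp: indicator_def)
  have intT: "integrable M (\<lambda>\<omega>. ?T x (N1 \<omega>) (N2 \<omega>))" for x using int by simp
  have "((\<lambda>x. expectation (?\<phi> x)) \<longlongrightarrow> expectation (\<lambda>\<omega>. 0)) at_top"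
  proof (rule integral_dominated_convergence_at_top[where
        w = "\<lambda>\<omega>. \<bar>C\<bar> * (1 + real (N1 \<omega>) + real (N2 \<omega>)) + (C1 * real (N1 \<omega>) + C2 * real (N2 \<omega>) + 1)"])
    show "AE \<omega> in M. ((\<lambda>x. ?\<phi> x \<omega>) \<longlongrightarrow> 0) at_top"
    proof (rule AE_I2)
      fix \<omega> assume \<omega>: "\<omega> \<in> space M"
      have "((\<lambda>x. (?Q x \<omega> - ?T x (N1 \<omega>) (N2 \<omega>)) / F x) \<longlongrightarrow> 0) at_top"
        using fixed by (rule smalloD_tendsto)
      \<comment> \<open>For a fixed \<omega> the indicator is eventually 1, so the limit is that of
        deterministic population sizes.\<close>
      moreover have "\<forall>\<^sub>F x in at_top. (?Q x \<omega> - ?T x (N1 \<omega>) (N2 \<omega>)) / F x = ?\<phi> x \<omega>"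
        using eventually_ge_at_top[of "Y \<omega> / (1 - \<delta>)"]
      proof eventually_elim
        case (elim x)
        then have "\<omega> \<in> ?A x" using \<omega> \<delta> by (simp add: field_simps)
        then show ?case by simp
      qed
      ultimately show "((\<lambda>x. ?\<phi> x \<omega>) \<longlongrightarrow> 0) at_top" by (rule Lim_transform_eventually)
    qed
    show "\<forall>\<^sub>F x in at_top. AE \<omega> in M. norm (?\<phi> x \<omega>) \<le> \<bar>C\<bar> * (1 + real (N1 \<omega>) + real (N2 \<omega>))
        + (C1 * real (N1 \<omega>) + C2 * real (N2 \<omega>) + 1)"
      using C C1(2) C2(2)
    proof eventually_elim
      case (elim x)
      show ?case
      proof (rule AE_I2)
        fix \<omega> assume \<omega>: "\<omega> \<in> space M"
        let ?k = "real (N1 \<omega>)" and ?l = "real (N2 \<omega>)"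
        have "\<bar>indicator (?A x) \<omega> * ?Q x \<omega>\<bar> \<le> \<bar>C\<bar> * (1 + ?k + ?l) * F x"
        proof (cases "\<omega> \<in> ?A x")
          case True
          then have "?Q x \<omega> \<le> C * (1 + ?k + ?l) * F x" using elim(1) by (auto simp: Y_def)
          also have "\<dots> \<le> \<bar>C\<bar> * (1 + ?k + ?l) * F x"
            using pos[of x] by (intro mult_right_mono) auto
          finally show ?thesis using True Q01 by simp
        qed (use pos[of x] in simp)
        moreover have "\<bar>?k * t1 x\<bar> \<le> ?k * (C1 * F x)" "\<bar>?l * t2 x\<bar> \<le> ?l * (C2 * F x)"
          using elim by (auto simp: abs_mult intro!: mult_left_mono)
        ultimately have "\<bar>indicator (?A x) \<omega> * ?Q x \<omega> - ?T x (N1 \<omega>) (N2 \<omega>)\<bar>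
            \<le> \<bar>C\<bar> * (1 + ?k + ?l) * F x + (?k * (C1 * F x) + ?l * (C2 * F x) + F x)"
          using pos[of x] by linarith
        also have "\<dots> = (\<bar>C\<bar> * (1 + ?k + ?l) + (C1 * ?k + C2 * ?l + 1)) * F x"
          by (simp add: algebra_simps)
        finally show "norm (?\<phi> x \<omega>) \<le> \<bar>C\<bar> * (1 + ?k + ?l) + (C1 * ?k + C2 * ?l + 1)"
          using pos[of x] by (simp add: pos_divide_le_eq abs_divide)
      qed
    qed
    show "integrable M (\<lambda>\<omega>. \<bar>C\<bar> * (1 + real (N1 \<omega>) + real (N2 \<omega>)) + (C1 * real (N1 \<omega>) + C2 * real (N2 \<omega>) + 1))"
      using int by simp
  qed measurable
  then have lim: "((\<lambda>x. expectation (?\<phi> x)) \<longlongrightarrow> 0) at_top" by simp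
  have E\<phi>: "expectation (?\<phi> x) = (expectation (\<lambda>\<omega>. indicator (?A x) \<omega> * ?Q x \<omega>)
      - (expectation (\<lambda>\<omega>. real (N1 \<omega>)) * t1 x + expectation (\<lambda>\<omega>. real (N2 \<omega>)) * t2 x + F x)) / F x" for x
    using int intI[of ?A x] intT[of x] by (simp add: prob_space)
  from tendstoD[OF lim, of "e / 4"] e
  have "\<forall>\<^sub>F x in at_top. \<bar>expectation (?\<phi> x)\<bar> < e / 4" by (simp add: dist_real_def)
  with \<delta>(3,4) CY(2) above[OF \<delta>(1) e'] eventually_gt_at_top[of 0]
  show "\<forall>\<^sub>F x in at_top. \<bar>expectation (?Q x) - (upper_tail Y x + expectation (\<lambda>\<omega>. real (N1 \<omega>)) * t1 x
      + expectation (\<lambda>\<omega>. real (N2 \<omega>)) * t2 x + F x)\<bar> \<le> e * F x"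
  proof eventually_elim
    case (elim x)
    let ?m = "expectation (\<lambda>\<omega>. real (N1 \<omega>)) * t1 x + expectation (\<lambda>\<omega>. real (N2 \<omega>)) * t2 x + F x"
    let ?EA = "expectation (\<lambda>\<omega>. indicator (?A x) \<omega> * ?Q x \<omega>)"
    let ?EB = "expectation (\<lambda>\<omega>. indicator (?B (1 - \<delta>) x) \<omega> * ?Q x \<omega>)"
    have small: "\<bar>?EA - ?m\<bar> \<le> e / 4 * F x"
      using elim(6) pos[of x] unfolding E\<phi> by (simp add: abs_divide pos_divide_less_eq)
    have "expectation (?Q x) = expectation (\<lambda>\<omega>. indicator (?A x) \<omega> * ?Q x \<omega> + indicator (?B (1 - \<delta>) x) \<omega> * ?Q x \<omega>)"
      by (intro Bochner_Integration.integral_cong) (auto simp: indicator_def)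
    also have "\<dots> = ?EA + ?EB"
      by (intro Bochner_Integration.integral_add intI) auto
    finally have split: "expectation (?Q x) = ?EA + ?EB" .
    have prob_ind: "expectation (indicator (?B q x)) = upper_tail Y (q * x)" for q
    proof -
      have "?B q x \<inter> space M = ?B q x" by auto
      then show ?thesis by simp
    qed
    have int_ind: "integrable M (indicat_real (?B q x))" for q
      by (intro integrable_const_bound[of _ 1]) auto
    \<comment> \<open>The window where Y lies between (1 - \<delta>) * x and (1 + \<delta>) * x
      counts fully here and is discarded in the lower bound.\<close>
    have "?EB \<le> expectation (indicat_real (?B (1 - \<delta>) x))"
      using Q01 by (intro integral_mono intI int_ind) (auto simp: indicator_def)
    then have upper: "?EB \<le> upper_tail Y ((1 - \<delta>) * x)" by (simp only: prob_ind)
    have "(1 - e') * upper_tail Y ((1 + \<delta>) * x) = expectation (\<lambda>\<omega>. (1 - e') * indicat_real (?B (1 + \<delta>) x) \<omega>)"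
      using prob_ind[of "1 + \<delta>"] by simp
    also have "\<dots> \<le> ?EB"
    proof (intro integral_mono intI integrable_mult_right int_ind)
      fix \<omega> assume \<omega>: "\<omega> \<in> space M"
      have "(1 - \<delta>) * x \<le> (1 + \<delta>) * x" using elim(5) \<delta> by (intro mult_right_mono) auto
      then have "\<omega> \<in> ?B (1 + \<delta>) x \<Longrightarrow> \<omega> \<in> ?B (1 - \<delta>) x" by auto
      moreover have "\<omega> \<in> ?B (1 + \<delta>) x \<Longrightarrow> 1 - e' \<le> ?Q x \<omega>" using elim(4) by (simp add: Y_def)
      ultimately show "(1 - e') * indicat_real (?B (1 + \<delta>) x) \<omega> \<le> indicator (?B (1 - \<delta>) x) \<omega> * ?Q x \<omega>"
        using Q01 by (cases "\<omega> \<in> ?B (1 + \<delta>) x") (auto simp: indicator_def)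
    qed auto
    finally have lower: "upper_tail Y ((1 + \<delta>) * x) - e' * upper_tail Y ((1 + \<delta>) * x) \<le> ?EB"
      by (simp add: algebra_simps)
    have "e' * upper_tail Y ((1 + \<delta>) * x) \<le> e' * (CY * F x)"
      using elim(3) e' by (intro mult_left_mono) auto
    also have "\<dots> = e / 4 * F x" using CY(1) by (simp add: e'_def)
    finally have "e' * upper_tail Y ((1 + \<delta>) * x) \<le> e / 4 * F x" .
    moreover have "0 < e * F x" using e pos by simp
    moreover note small[unfolded abs_le_iff] elim(1)[unfolded abs_le_iff] elim(2)[unfolded abs_le_iff]
    ultimately show ?case using upper lower unfolding split by (intro abs_leI) linarith+
  qed
qed

text \<open>The separate sample points \<omega> and \<omega>' express the conditioning on (N1, N2)
  as already carried out. Independence between the two offspring families and the immigration W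
  enters through \<open>fixed\<close>; the concentration bounds treat each family alone and are
  joined by union bounds.\<close>

lemma tail_random_sum:
  fixes N1 N2 :: "'a \<Rightarrow> nat" and U V :: "nat \<Rightarrow> 'a \<Rightarrow> real" and W \<xi> \<eta> :: "'a \<Rightarrow> real" and b :: real
  defines "Y \<equiv> \<lambda>\<omega>. (expectation \<xi> + b) * real (N1 \<omega>) + expectation \<eta> * real (N2 \<omega>)"
    and "S \<equiv> \<lambda>k l \<omega>. (\<Sum>i=1..k. U i \<omega>) + (\<Sum>j=1..l. V j \<omega>) + W \<omega>"
  assumes N1[measurable]: "N1 \<in> measurable M (count_space UNIV)"
    and N2[measurable]: "N2 \<in> measurable M (count_space UNIV)"
    and int: "integrable M (\<lambda>\<omega>. real (N1 \<omega>))" "integrable M (\<lambda>\<omega>. real (N2 \<omega>))"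
    and iid: "\<And>k. iid_copies U {1..k} \<xi>" "\<And>l. iid_copies V {1..l} \<eta>"
    and int': "integrable M \<xi>" "integrable M \<eta>"
    and nonneg: "\<And>\<omega>. 0 \<le> \<xi> \<omega>" "\<And>\<omega>. 0 \<le> \<eta> \<omega>" "\<And>\<omega>. 0 \<le> W \<omega>"
    and mean: "0 < expectation \<xi>" "0 < expectation \<eta>" and b: "0 \<le> b"
    and reg: "regular (upper_tail \<xi>)" "regular (upper_tail \<eta>)" "regular (upper_tail Y)"
    and W[measurable]: "W \<in> borel_measurable M" and tail_W: "upper_tail W = F"
    and fixed: "\<And>k l. (\<lambda>x. upper_tail (S k l) x
        - (real k * upper_tail \<xi> x + real l * upper_tail \<eta> x + F x)) \<in> o(F)"
  shows "(\<lambda>x. expectation (\<lambda>\<omega>. upper_tail (\<lambda>\<omega>'. S (N1 \<omega>) (N2 \<omega>) \<omega>' + b * real (N1 \<omega>)) x)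
      - (upper_tail Y x + expectation (\<lambda>\<omega>. real (N1 \<omega>)) * upper_tail \<xi> x
         + expectation (\<lambda>\<omega>. real (N2 \<omega>)) * upper_tail \<eta> x + F x)) \<in> o(F)"
  unfolding Y_def
proof (rule tail_mixture[OF N1 N2 int])
  have [measurable]: "(\<lambda>\<omega>. \<Sum>i=1..k. U i \<omega>) \<in> borel_measurable M"
    "(\<lambda>\<omega>. \<Sum>i=1..k. V i \<omega>) \<in> borel_measurable M" for k
    by (rule borel_measurable_sum, erule iid_copies_measurable[OF iid(1)])
      (rule borel_measurable_sum, erule iid_copies_measurable[OF iid(2)])
  have [measurable]: "S k l \<in> borel_measurable M" for k l
    unfolding S_def by measurable
  let ?Q = "\<lambda>k l. upper_tail (\<lambda>\<omega>'. S k l \<omega>' + b * real k)"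
  show "regular (upper_tail (\<lambda>\<omega>. (expectation \<xi> + b) * real (N1 \<omega>) + expectation \<eta> * real (N2 \<omega>)))"
    using reg(3) by (simp add: Y_def)
  show "upper_tail \<xi> \<in> O(F)" "upper_tail \<eta> \<in> O(F)" using reg regular_bigo by auto
  show "(\<lambda>x. ?Q k l x - (real k * upper_tail \<xi> x + real l * upper_tail \<eta> x + F x)) \<in> o(F)" for k l
  proof -
    have "regular (\<lambda>x. real k * upper_tail \<xi> x + real l * upper_tail \<eta> x + F x)"
      by (intro regular_add regular_cmult reg regular_F)
    then have "regular (upper_tail (S k l))" using fixed by (rule regular_smallo_diff)
    \<comment> \<open>For fixed k the summand b * k is a constant shift, which a regular tail does
      not notice.\<close>
    then have "(\<lambda>x. upper_tail (S k l) (x - b * real k) - upper_tail (S k l) x) \<in> o(F)"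
      using b by (intro regular_shift upper_tail_antimono) auto
    from sum_in_smallo(1)[OF this fixed[of k l]] show ?thesis
      by (simp add: algebra_simps)
  qed
  show "\<exists>C. \<forall>\<^sub>F x in at_top. \<forall>k l. (expectation \<xi> + b) * real k + expectation \<eta> * real l \<le> (1 - \<delta>) * x \<longrightarrow>
      ?Q k l x \<le> C * (1 + real k + real l) * F x" if \<delta>: "0 < \<delta>" "\<delta> < 1" for \<delta>
  proof -
    \<comment> \<open>The excess over the mean is at least \<delta> * x; one of the two sums or the
      immigration must provide a third of it.\<close>
    have \<delta>3: "0 < \<delta> / 3" using \<delta> by simp
    \<comment> \<open>These reciprocals bound the numbers of summands: below the threshold, each
      mean offspring number times its count is at most x.\<close>
    have mpos: "0 < 1 / expectation \<xi>" "0 < 1 / expectation \<eta>" using mean by auto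
    obtain C1 x1 where C1: "0 < C1" "0 < x1"
      "\<And>(Z :: nat \<Rightarrow> 'a \<Rightarrow> real) I x. iid_copies Z I \<xi> \<Longrightarrow> x1 \<le> x \<Longrightarrow> real (card I) \<le> 1 / expectation \<xi> * x \<Longrightarrow>
       prob {\<omega> \<in> space M. real (card I) * expectation \<xi> + \<delta> / 3 * x < (\<Sum>i\<in>I. Z i \<omega>)} \<le> C1 * real (card I) * F x"
      by (rule iid_sum_upper[OF int'(1) nonneg(1) regular_bigo[OF reg(1)] \<delta>3 mpos(1)]) blast
    obtain C2 x2 where C2: "0 < C2" "0 < x2"
      "\<And>(Z :: nat \<Rightarrow> 'a \<Rightarrow> real) I x. iid_copies Z I \<eta> \<Longrightarrow> x2 \<le> x \<Longrightarrow> real (card I) \<le> 1 / expectation \<eta> * x \<Longrightarrow>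
       prob {\<omega> \<in> space M. real (card I) * expectation \<eta> + \<delta> / 3 * x < (\<Sum>i\<in>I. Z i \<omega>)} \<le> C2 * real (card I) * F x"
      by (rule iid_sum_upper[OF int'(2) nonneg(2) regular_bigo[OF reg(2)] \<delta>3 mpos(2)]) blast
    obtain C3 where C3: "0 < C3" "\<forall>\<^sub>F x in at_top. \<bar>F (\<delta> / 3 * x)\<bar> \<le> C3 * F x"
      using bigoD[OF scale_bigo[OF \<delta>3]] by blast
    show ?thesis
    proof (rule exI[of _ "C1 + C2 + C3"])
      show "\<forall>\<^sub>F x in at_top. \<forall>k l. (expectation \<xi> + b) * real k + expectation \<eta> * real l \<le> (1 - \<delta>) * x \<longrightarrow>
        ?Q k l x \<le> (C1 + C2 + C3) * (1 + real k + real l) * F x"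
        using C3(2) eventually_ge_at_top[of x1] eventually_ge_at_top[of x2]
      proof eventually_elim
        case (elim x)
        show ?case
        proof (intro allI impI)
          fix k l :: nat
          assume le: "(expectation \<xi> + b) * real k + expectation \<eta> * real l \<le> (1 - \<delta>) * x"
          let ?EU = "{\<omega> \<in> space M. real k * expectation \<xi> + \<delta> / 3 * x < (\<Sum>i=1..k. U i \<omega>)}"
          let ?EV = "{\<omega> \<in> space M. real l * expectation \<eta> + \<delta> / 3 * x < (\<Sum>i=1..l. V i \<omega>)}"
          let ?EW = "{\<omega> \<in> space M. \<delta> / 3 * x < W \<omega>}"
          have x: "0 < x" "(1 - \<delta>) * x \<le> x" using elim C1 \<delta> by (auto simp: algebra_simps)
          have nn: "0 \<le> expectation \<xi> * real k" "0 \<le> b * real k" "0 \<le> expectation \<eta> * real l"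
            using mean b by auto
          have "expectation \<xi> * real k \<le> x" "expectation \<eta> * real l \<le> x"
            using le x nn by (auto simp: algebra_simps)
          then have kl: "real k \<le> 1 / expectation \<xi> * x" "real l \<le> 1 / expectation \<eta> * x"
            using mean by (auto simp: field_simps)
          have "?Q k l x \<le> prob (?EU \<union> ?EV \<union> ?EW)"
          proof (rule finite_measure_mono)
            show "{\<omega>' \<in> space M. x < S k l \<omega>' + b * real k} \<subseteq> ?EU \<union> ?EV \<union> ?EW"
              using le by (auto simp: S_def algebra_simps)
          qed measurable
          also have "\<dots> \<le> prob (?EU \<union> ?EV) + prob ?EW" by (intro measure_Un_le) measurable
          also have "prob (?EU \<union> ?EV) \<le> prob ?EU + prob ?EV" by (intro measure_Un_le) measurable
          also have "prob ?EU \<le> C1 * real k * F x" using C1(3)[OF iid(1)[of k] elim(2)] kl by simp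
          also have "prob ?EV \<le> C2 * real l * F x" using C2(3)[OF iid(2)[of l] elim(3)] kl by simp
          also have "prob ?EW \<le> C3 * F x" using elim(1) tail_W[THEN fun_cong, of "\<delta> / 3 * x"] by simp
          finally have "?Q k l x \<le> (C1 * real k + C2 * real l + C3) * F x" by (simp add: algebra_simps)
          also have "\<dots> \<le> (C1 + C2 + C3) * (1 + real k + real l) * F x"
            using C1(1) C2(1) C3(1) pos[of x] by (intro mult_right_mono) (auto simp: algebra_simps)
          finally show "?Q k l x \<le> (C1 + C2 + C3) * (1 + real k + real l) * F x" .
        qed
      qed
    qed
  qed
  show "\<forall>\<^sub>F x in at_top. \<forall>k l. (1 + \<delta>) * x < (expectation \<xi> + b) * real k + expectation \<eta> * real l \<longrightarrow>
      1 - e \<le> ?Q k l x" if \<delta>: "0 < \<delta>" and e: "0 < e" for \<delta> e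
  proof -
    \<comment> \<open>From y > (1 + \<delta>) * x follows y - x > \<delta> / (1 + \<delta>) * y;
      each of the two sums is allowed half of this deficit.\<close>
    define d where "d = \<delta> / (1 + \<delta>) / 2"
    have d: "0 < d" using \<delta> by (simp add: d_def)
    obtain s1 where s1: "0 < s1"
      "\<And>(Z :: nat \<Rightarrow> 'a \<Rightarrow> real) I y. iid_copies Z I \<xi> \<Longrightarrow> real (card I) * expectation \<xi> \<le> y \<Longrightarrow>
       prob {\<omega> \<in> space M. (\<Sum>i\<in>I. Z i \<omega>) \<le> real (card I) * expectation \<xi> - d * y} \<le> exp (- s1 * y)"
      by (rule iid_sum_lower[OF int'(1) nonneg(1) mean(1) d]) blast
    obtain s2 where s2: "0 < s2"
      "\<And>(Z :: nat \<Rightarrow> 'a \<Rightarrow> real) I y. iid_copies Z I \<eta> \<Longrightarrow> real (card I) * expectation \<eta> \<le> y \<Longrightarrow>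
       prob {\<omega> \<in> space M. (\<Sum>i\<in>I. Z i \<omega>) \<le> real (card I) * expectation \<eta> - d * y} \<le> exp (- s2 * y)"
      by (rule iid_sum_lower[OF int'(2) nonneg(2) mean(2) d]) blast
    have lim: "((\<lambda>x. exp (- s * x)) \<longlongrightarrow> 0) at_top" if "0 < s" for s :: real
      using filterlim_compose[OF exp_at_bot filterlim_tendsto_neg_mult_at_bot[OF tendsto_const _ filterlim_ident], of "- s"]
        that by simp
    have "((\<lambda>x. exp (- s1 * x) + exp (- s2 * x)) \<longlongrightarrow> 0 + 0) at_top"
      by (intro tendsto_add lim s1 s2)
    then have "\<forall>\<^sub>F x in at_top. exp (- s1 * x) + exp (- s2 * x) < e"
      using e by (intro order_tendstoD) auto
    with eventually_gt_at_top[of 0] show ?thesis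
    proof eventually_elim
      case (elim x)
      show ?case
      proof (intro allI impI)
        fix k l :: nat
        define y where "y = (expectation \<xi> + b) * real k + expectation \<eta> * real l"
        assume "(1 + \<delta>) * x < (expectation \<xi> + b) * real k + expectation \<eta> * real l"
        then have y: "(1 + \<delta>) * x < y" by (simp add: y_def)
        then have xy: "x \<le> y - 2 * d * y" "x \<le> y"
          using \<delta> elim(1) by (auto simp: d_def field_simps intro: order_trans[of x "x + \<delta> * x"] less_imp_le)
        let ?EU = "{\<omega> \<in> space M. (\<Sum>i=1..k. U i \<omega>) \<le> real k * expectation \<xi> - d * y}"
        let ?EV = "{\<omega> \<in> space M. (\<Sum>i=1..l. V i \<omega>) \<le> real l * expectation \<eta> - d * y}"
        have nn: "0 \<le> expectation \<xi> * real k" "0 \<le> b * real k" "0 \<le> expectation \<eta> * real l"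
          using mean b by auto
        then have le: "real k * expectation \<xi> \<le> y" "real l * expectation \<eta> \<le> y"
          by (auto simp: y_def algebra_simps)
        have "1 - ?Q k l x = prob (space M - {\<omega>' \<in> space M. x < S k l \<omega>' + b * real k})"
          by (subst prob_compl) auto
        also have "\<dots> \<le> prob (?EU \<union> ?EV)"
        proof (rule finite_measure_mono)
          show "space M - {\<omega>' \<in> space M. x < S k l \<omega>' + b * real k} \<subseteq> ?EU \<union> ?EV"
          proof safe
            fix \<omega> assume "\<omega> \<in> space M" "\<not> x < S k l \<omega> + b * real k"
              "\<not> (\<Sum>i=1..l. V i \<omega>) \<le> real l * expectation \<eta> - d * y"
            then show "(\<Sum>i=1..k. U i \<omega>) \<le> real k * expectation \<xi> - d * y"
              using xy(1) nonneg(3)[of \<omega>] unfolding S_def y_def by (simp add: algebra_simps)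
          qed
        qed measurable
        also have "\<dots> \<le> prob ?EU + prob ?EV" by (intro measure_Un_le) measurable
        also have "prob ?EU \<le> exp (- s1 * y)" using s1(2)[OF iid(1)[of k], of y] le by simp
        also have "prob ?EV \<le> exp (- s2 * y)" using s2(2)[OF iid(2)[of l], of y] le by simp
        also have "exp (- s1 * y) \<le> exp (- s1 * x)" using xy s1 by simp
        also have "exp (- s2 * y) \<le> exp (- s2 * x)" using xy s2 by simp
        finally show "1 - e \<le> ?Q k l x" using elim(2) by simp
      qed
    qed
  qed
qed (auto simp: measure_nonneg)

end

section \<open>The second-order Galton--Watson process\<close>

lemma measurable_count_space_binary:
  fixes f :: "'a \<Rightarrow> 'b::countable" and g :: "'a \<Rightarrow> 'c::countable"
  assumes "f \<in> measurable N (count_space UNIV)" "g \<in> measurable N (count_space UNIV)"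
  shows "(\<lambda>x. h (f x) (g x)) \<in> measurable N (count_space UNIV)"
  by (rule measurable_compose_countable[OF measurable_compose[OF assms(2)] assms(1)]) simp

lemma measurable_random_sum_nat:
  fixes f :: "nat \<Rightarrow> 'a \<Rightarrow> nat"
  assumes "\<And>i. 1 \<le> i \<Longrightarrow> f i \<in> measurable N (count_space UNIV)" "g \<in> measurable N (count_space UNIV)"
  shows "(\<lambda>x. \<Sum>i=1..g x. f i x) \<in> measurable N (count_space UNIV)"
proof (rule measurable_compose_countable[OF _ assms(2)])
  show "(\<lambda>x. \<Sum>i=1..k. f i x) \<in> measurable N (count_space UNIV)" for k
  proof (induction k)
    case (Suc k)
    have "(\<lambda>x. (\<Sum>i=1..k. f i x) + f (Suc k) x) \<in> measurable N (count_space UNIV)"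
      by (rule measurable_count_space_binary[OF Suc assms(1), where h = "(+)"]) simp
    then show ?case by simp
  qed simp
qed

lemma distr_real_eq:
  assumes "distr M (count_space UNIV) Y = distr M (count_space UNIV) Y'"
    and [measurable]: "Y \<in> measurable M (count_space UNIV)" "Y' \<in> measurable M (count_space UNIV)"
  shows "distr M borel (\<lambda>\<omega>. real (Y \<omega>)) = distr M borel (\<lambda>\<omega>. real (Y' \<omega>))"
proof -
  have "distr (distr M (count_space UNIV) Z) borel real = distr M borel (\<lambda>\<omega>. real (Z \<omega>))"
    if [measurable]: "Z \<in> measurable M (count_space UNIV)" for Z
    by (subst distr_distr) (auto simp: comp_def)
  from this[of Y] this[of Y'] show ?thesis using assms by simp
qed

section \<open>Conditioning on an independent component\<close>

context prob_space
begin

text \<open>By injectivity the singletons {h j} are disjoint, so this is independence of blocks of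
  size one.\<close>

lemma indep_vars_reindex:
  assumes "indep_vars (\<lambda>_. N) Z I" "inj_on h J" "h ` J \<subseteq> I"
  shows "indep_vars (\<lambda>_. N) (\<lambda>j. Z (h j)) J"
proof -
  have "indep_vars (\<lambda>j. PiM {h j} (\<lambda>_. N)) (\<lambda>j \<omega>. restrict (\<lambda>i. Z i \<omega>) {h j}) J"
    using assms by (intro indep_vars_restrict[OF assms(1)]) (auto simp: disjoint_family_on_def inj_on_def)
  from indep_vars_compose2[OF this, of "\<lambda>j f. f (h j)" "\<lambda>_. N"] show ?thesis
    by (simp add: measurable_component_singleton)
qed

lemma indep_var_nn_integral_fubini:
  assumes ind: "indep_var S A T B" and h[measurable]: "h \<in> borel_measurable (S \<Otimes>\<^sub>M T)"
  shows "(\<integral>\<^sup>+\<omega>. h (A \<omega>, B \<omega>) \<partial>M) = (\<integral>\<^sup>+\<omega>. (\<integral>\<^sup>+\<omega>'. h (A \<omega>, B \<omega>') \<partial>M) \<partial>M)"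
proof -
  have [measurable]: "A \<in> measurable M S" "B \<in> measurable M T"
    using ind by (auto dest: indep_var_rv1 indep_var_rv2)
  interpret T: prob_space "distr M T B" by (rule prob_space_distr) simp
  have h': "h \<in> borel_measurable (distr M S A \<Otimes>\<^sub>M distr M T B)"
    by (subst measurable_cong_sets[OF sets_pair_measure_cong[OF sets_distr sets_distr] refl]) simp
  have "(\<integral>\<^sup>+\<omega>. h (A \<omega>, B \<omega>) \<partial>M) = (\<integral>\<^sup>+p. h p \<partial>distr M (S \<Otimes>\<^sub>M T) (\<lambda>\<omega>. (A \<omega>, B \<omega>)))"
    by (subst nn_integral_distr) auto
  also have "\<dots> = (\<integral>\<^sup>+p. h p \<partial>(distr M S A \<Otimes>\<^sub>M distr M T B))"
    using ind by (simp add: indep_var_distribution_eq)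
  also have "\<dots> = (\<integral>\<^sup>+a. \<integral>\<^sup>+b. h (a, b) \<partial>distr M T B \<partial>distr M S A)"
    by (rule T.nn_integral_fst[symmetric]) (rule h')
  also have "\<dots> = (\<integral>\<^sup>+\<omega>. \<integral>\<^sup>+b. h (A \<omega>, b) \<partial>distr M T B \<partial>M)"
  proof (rule nn_integral_distr)
    show "(\<lambda>a. \<integral>\<^sup>+b. h (a, b) \<partial>distr M T B) \<in> borel_measurable (distr M S A)"
      by (rule T.borel_measurable_nn_integral_fst[OF h'])
  qed simp
  also have "\<dots> = (\<integral>\<^sup>+\<omega>. (\<integral>\<^sup>+\<omega>'. h (A \<omega>, B \<omega>') \<partial>M) \<partial>M)"
  proof (rule nn_integral_cong)
    fix \<omega> assume "\<omega> \<in> space M"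
    then have [measurable]: "A \<omega> \<in> space S" using measurable_space[of A M S] by simp
    show "(\<integral>\<^sup>+b. h (A \<omega>, b) \<partial>distr M T B) = (\<integral>\<^sup>+\<omega>'. h (A \<omega>, B \<omega>') \<partial>M)"
      by (rule nn_integral_distr) auto
  qed
  finally show ?thesis .
qed

text \<open>Passing through a countable-valued function of A gives joint measurability from that of
  the single sections \<open>h k\<close>, so sums with a random number of terms need no separate
  argument.\<close>

lemma indep_var_nn_integral_countable:
  fixes \<phi> :: "_ \<Rightarrow> 'c::countable"
  assumes ind: "indep_var S A T B" and [measurable]: "\<phi> \<in> measurable S (count_space UNIV)"
    and [measurable]: "\<And>k. h k \<in> borel_measurable T"
  shows "(\<integral>\<^sup>+\<omega>. h (\<phi> (A \<omega>)) (B \<omega>) \<partial>M) = (\<integral>\<^sup>+\<omega>. (\<integral>\<^sup>+\<omega>'. h (\<phi> (A \<omega>)) (B \<omega>') \<partial>M) \<partial>M)"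
proof -
  have "(\<lambda>p. h (\<phi> (fst p)) (snd p)) \<in> borel_measurable (S \<Otimes>\<^sub>M T)"
    by (rule measurable_compose_countable[where g = "\<lambda>p. \<phi> (fst p)"]) auto
  from indep_var_nn_integral_fubini[OF ind this] show ?thesis by simp
qed

lemma indep_var_prob_mixture:
  fixes \<phi> :: "_ \<Rightarrow> 'c::countable"
  assumes ind: "indep_var S A T B" and \<phi>[measurable]: "\<phi> \<in> measurable S (count_space UNIV)"
    and H[measurable]: "\<And>k. Measurable.pred T (H k)"
  shows "prob {\<omega> \<in> space M. H (\<phi> (A \<omega>)) (B \<omega>)} = expectation (\<lambda>\<omega>. prob {\<omega>' \<in> space M. H (\<phi> (A \<omega>)) (B \<omega>')})"
proof -
  have A[measurable]: "A \<in> measurable M S" and [measurable]: "B \<in> measurable M T"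
    using ind by (auto dest: indep_var_rv1 indep_var_rv2)
  have HA: "Measurable.pred M (\<lambda>\<omega>. H (\<phi> (A \<omega>)) (B \<omega>))"
    by (rule measurable_compose_countable[where g = "\<lambda>\<omega>. \<phi> (A \<omega>)"]) auto
  have indicat: "(\<integral>\<^sup>+\<omega>. indicator {b. P \<omega> b} (B \<omega>) \<partial>M) = ennreal (prob {\<omega> \<in> space M. P \<omega> (B \<omega>)})"
    if [measurable]: "Measurable.pred M (\<lambda>\<omega>. P \<omega> (B \<omega>))" for P
  proof -
    have "(\<integral>\<^sup>+\<omega>. indicator {b. P \<omega> b} (B \<omega>) \<partial>M) = (\<integral>\<^sup>+\<omega>. indicator {\<omega> \<in> space M. P \<omega> (B \<omega>)} \<omega> \<partial>M)"
      by (intro nn_integral_cong) (auto simp: indicator_def)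
    also have "\<dots> = ennreal (prob {\<omega> \<in> space M. P \<omega> (B \<omega>)})"
      by (subst nn_integral_indicator) (auto simp: emeasure_eq_measure)
    finally show ?thesis .
  qed
  have "ennreal (prob {\<omega> \<in> space M. H (\<phi> (A \<omega>)) (B \<omega>)}) = (\<integral>\<^sup>+\<omega>. indicator {b. H (\<phi> (A \<omega>)) b} (B \<omega>) \<partial>M)"
    using HA by (rule indicat[symmetric])
  also have "\<dots> = (\<integral>\<^sup>+\<omega>. (\<integral>\<^sup>+\<omega>'. indicator {b. H (\<phi> (A \<omega>)) b} (B \<omega>') \<partial>M) \<partial>M)"
    by (rule indep_var_nn_integral_countable[OF ind \<phi>, where h = "\<lambda>k. indicator {b. H k b}"])
      (simp add: indicator_def[abs_def])
  also have "\<dots> = (\<integral>\<^sup>+\<omega>. ennreal (prob {\<omega>' \<in> space M. H (\<phi> (A \<omega>)) (B \<omega>')}) \<partial>M)"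
    by (intro nn_integral_cong indicat) simp
  also have "\<dots> = ennreal (expectation (\<lambda>\<omega>. prob {\<omega>' \<in> space M. H (\<phi> (A \<omega>)) (B \<omega>')}))"
  proof (rule nn_integral_eq_integral)
    have "(\<lambda>\<omega>. prob {\<omega>' \<in> space M. H (\<phi> (A \<omega>)) (B \<omega>')}) \<in> borel_measurable M"
      by (rule measurable_compose[OF measurable_compose[OF A \<phi>]]) simp
    then show "integrable M (\<lambda>\<omega>. prob {\<omega>' \<in> space M. H (\<phi> (A \<omega>)) (B \<omega>')})"
      by (intro integrable_const_bound[of _ 1]) auto
  qed simp
  finally show ?thesis by (simp add: integral_nonneg_AE)
qed

end

text \<open>The recursion run on families of values, with the family f itself as sample point. It
  exhibits the process as a deterministic function of the labelled variables, as conditioning on a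
  set of labels requires.\<close>

abbreviation gw2_coord :: "nat \<Rightarrow> (label \<Rightarrow> nat) \<Rightarrow> nat" where
  "gw2_coord \<equiv> gw2_aux (\<lambda>f. f LXm1) (\<lambda>f. f LX0) (\<lambda>n i f. f (LXi n i)) (\<lambda>n j f. f (LEta n j)) (\<lambda>n f. f (LEps n))"

fun generation :: "label \<Rightarrow> nat" where
  "generation LXm1 = 0" | "generation LX0 = 0" | "generation (LXi n i) = n"
| "generation (LEta n i) = n" | "generation (LEps n) = n"

text \<open>The initial values have generation 0, so \<open>past n\<close> determines the process up
  to generation n, and \<open>present (Suc n)\<close> carries all randomness of the next
  step.\<close>

definition past :: "nat \<Rightarrow> label set" where "past n = {l. valid_label l \<and> generation l \<le> n}"
definition present :: "nat \<Rightarrow> label set" where "present n = {l. valid_label l \<and> generation l = n}"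

lemma past_simps [simp]:
  "LXm1 \<in> past n" "LX0 \<in> past n" "LXi k i \<in> past n \<longleftrightarrow> 1 \<le> k \<and> 1 \<le> i \<and> k \<le> n"
  "LEta k i \<in> past n \<longleftrightarrow> 1 \<le> k \<and> 1 \<le> i \<and> k \<le> n" "LEps k \<in> past n \<longleftrightarrow> 1 \<le> k \<and> k \<le> n"
  by (auto simp: past_def valid_label_def)

lemma present_simps [simp]:
  "LXi k i \<in> present n \<longleftrightarrow> 1 \<le> k \<and> 1 \<le> i \<and> k = n"
  "LEta k i \<in> present n \<longleftrightarrow> 1 \<le> k \<and> 1 \<le> i \<and> k = n" "LEps k \<in> present n \<longleftrightarrow> 1 \<le> k \<and> k = n"
  by (auto simp: present_def valid_label_def)

text \<open>The bound is \<open>Suc n\<close> because of the index shift: \<open>gw2_aux\<close> at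
  \<open>Suc n\<close> is the population of generation n.\<close>

lemma gw2_aux_eq_coord:
  assumes "\<And>l. l \<in> past n \<Longrightarrow> f l = basic_rv Xm1 X0 xi eta eps l \<omega>" "k \<le> Suc n"
  shows "gw2_aux Xm1 X0 xi eta eps k \<omega> = gw2_coord k f"
  using assms(2)
proof (induction k rule: induct_nat_012)
  case (ge2 k)
  then have "gw2_aux Xm1 X0 xi eta eps (Suc k) \<omega> = gw2_coord (Suc k) f"
    "gw2_aux Xm1 X0 xi eta eps k \<omega> = gw2_coord k f"
    by auto
  then show ?case using ge2(3) assms(1) by (simp add: basic_rv_def cong: sum.cong_simp)
qed (auto simp: assms(1) basic_rv_def)

lemma measurable_gw2_coord:
  "k \<le> Suc n \<Longrightarrow> gw2_coord k \<in> measurable (PiM (past n) (\<lambda>_. count_space UNIV)) (count_space UNIV)"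
proof (induction k rule: induct_nat_012)
  case 0
  have "gw2_coord 0 = (\<lambda>f. f LXm1)" by (rule ext) simp
  then show ?case by (simp add: measurable_component_singleton)
next
  case 1
  have "gw2_coord (Suc 0) = (\<lambda>f. f LX0)" by (rule ext) simp
  then show ?case by (simp add: measurable_component_singleton)
next
  case (ge2 k)
  let ?N = "PiM (past n) (\<lambda>_. count_space UNIV :: nat measure)"
  have IH: "gw2_coord k \<in> measurable ?N (count_space UNIV)" "gw2_coord (Suc k) \<in> measurable ?N (count_space UNIV)"
    using ge2 by auto
  have "(\<lambda>f. \<Sum>i = 1..gw2_coord (Suc k) f. f (LXi (Suc k) i)) \<in> measurable ?N (count_space UNIV)"
    "(\<lambda>f. \<Sum>i = 1..gw2_coord k f. f (LEta (Suc k) i)) \<in> measurable ?N (count_space UNIV)"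
    "(\<lambda>f. f (LEps (Suc k))) \<in> measurable ?N (count_space UNIV)"
    using IH ge2(3) by (auto intro!: measurable_random_sum_nat measurable_component_singleton)
  note * = measurable_count_space_binary[OF measurable_count_space_binary[OF this(1,2), where h = "(+)"] this(3), where h = "(+)"]
  have "gw2_coord (Suc (Suc k)) = (\<lambda>f. (\<Sum>i = 1..gw2_coord (Suc k) f. f (LXi (Suc k) i))
      + (\<Sum>i = 1..gw2_coord k f. f (LEta (Suc k) i)) + f (LEps (Suc k)))"
    by (rule ext) simp
  then show ?case using * by (simp only:)
qed

text \<open>If the tail vanished at x, it would vanish from there on. The quotient for q = 1 would
  then be 0 / 0 = 0 by the convention for division, against its limit 1.\<close>

lemma (in prob_space) regularly_varying_tail_pos:
  assumes "regularly_varying M (\<lambda>\<omega>. real (Y \<omega>)) \<alpha>" and [measurable]: "Y \<in> measurable M (count_space UNIV)"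
  shows "0 < tail M Y x"
proof (rule ccontr)
  assume "\<not> 0 < tail M Y x"
  then have 0: "tail M Y x = 0" by (simp add: tail_def zero_less_measure_iff)
  have zero: "tail M Y y = 0" if "x \<le> y" for y
  proof -
    have "tail M Y y \<le> tail M Y x" using that unfolding tail_def by (intro upper_tail_antimono) auto
    then show ?thesis using 0 by (simp add: tail_def measure_le_0_iff)
  qed
  have "\<forall>\<^sub>F y in at_top. tail M Y (1 * y) / tail M Y y = 0"
    by (rule eventually_mono[OF eventually_ge_at_top[of x]]) (simp add: zero)
  then have "((\<lambda>y. tail M Y (1 * y) / tail M Y y) \<longlongrightarrow> 0) at_top" by (rule tendsto_eventually)
  moreover have "((\<lambda>y. tail M Y (1 * y) / tail M Y y) \<longlongrightarrow> 1 powr (-\<alpha>)) at_top"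
    using assms(1) unfolding regularly_varying_def tail_def by (auto dest: spec[of _ 1])
  ultimately have "1 powr (-\<alpha>) = (0::real)" by (intro tendsto_unique[OF trivial_limit_at_top_linorder])
  then show False by simp
qed

locale gw2_rv = prob_space M
  for M :: "'a measure" and Xm1 X0 :: "'a \<Rightarrow> nat" and xi eta :: "nat \<Rightarrow> nat \<Rightarrow> 'a \<Rightarrow> nat"
    and eps :: "nat \<Rightarrow> 'a \<Rightarrow> nat" and \<alpha> r :: real +
  assumes model: "gw2_model M Xm1 X0 xi eta eps"
    and alpha: "\<alpha> \<ge> 1"
    and rv_xi: "regularly_varying M (\<lambda>\<omega>. real (xi 1 1 \<omega>)) \<alpha>"
    and rv_eta: "regularly_varying M (\<lambda>\<omega>. real (eta 1 1 \<omega>)) \<alpha>"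
    and rv_eps: "regularly_varying M (\<lambda>\<omega>. real (eps 1 \<omega>)) \<alpha>"
    and tail_xi_eps: "tail M (xi 1 1) \<in> O(tail M (eps 1))"
    and tail_eta_eps: "tail M (eta 1 1) \<in> O(tail M (eps 1))"
    and int_xi: "integrable M (\<lambda>\<omega>. real (xi 1 1 \<omega>))" and pos_xi: "0 < expectation (\<lambda>\<omega>. real (xi 1 1 \<omega>))"
    and int_eta: "integrable M (\<lambda>\<omega>. real (eta 1 1 \<omega>))" and pos_eta: "0 < expectation (\<lambda>\<omega>. real (eta 1 1 \<omega>))"
    and int_eps: "integrable M (\<lambda>\<omega>. real (eps 1 \<omega>))"
    and r: "r > \<alpha>"
    and mom0: "integrable M (\<lambda>\<omega>. real (X0 \<omega>) powr r)"
    and momm1: "integrable M (\<lambda>\<omega>. real (Xm1 \<omega>) powr r)"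
begin

text \<open>The index is shifted as in \<open>gw2_aux\<close>: \<open>X k\<close> is $X_{k-1}$.\<close>

abbreviation X :: "nat \<Rightarrow> 'a \<Rightarrow> nat" where "X \<equiv> gw2_aux Xm1 X0 xi eta eps"
abbreviation m\<xi> :: real where "m\<xi> \<equiv> expectation (\<lambda>\<omega>. real (xi 1 1 \<omega>))"
abbreviation m\<eta> :: real where "m\<eta> \<equiv> expectation (\<lambda>\<omega>. real (eta 1 1 \<omega>))"
abbreviation m\<epsilon> :: real where "m\<epsilon> \<equiv> expectation (\<lambda>\<omega>. real (eps 1 \<omega>))"
abbreviation meanX :: "nat \<Rightarrow> real" where "meanX k \<equiv> expectation (\<lambda>\<omega>. real (X k \<omega>))"

lemma indep: "indep_vars (\<lambda>_. count_space UNIV) (basic_rv Xm1 X0 xi eta eps) {l. valid_label l}"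
  using model by (simp add: gw2_model_def)

lemma measurable_basic_rv:
  assumes "valid_label l"
  shows "basic_rv Xm1 X0 xi eta eps l \<in> measurable M (count_space UNIV)"
  using indep assms unfolding indep_vars_def by blast

lemma measurable_vars [measurable]:
  "X0 \<in> measurable M (count_space UNIV)" "Xm1 \<in> measurable M (count_space UNIV)"
  "1 \<le> n \<Longrightarrow> 1 \<le> i \<Longrightarrow> xi n i \<in> measurable M (count_space UNIV)"
  "1 \<le> n \<Longrightarrow> 1 \<le> i \<Longrightarrow> eta n i \<in> measurable M (count_space UNIV)"
  "1 \<le> n \<Longrightarrow> eps n \<in> measurable M (count_space UNIV)"
  using measurable_basic_rv[of LX0] measurable_basic_rv[of LXm1] measurable_basic_rv[of "LXi n i"]
    measurable_basic_rv[of "LEta n i"] measurable_basic_rv[of "LEps n"]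
  by (auto simp: basic_rv_def valid_label_def)

lemma measurable_vars_1 [measurable]:
  "xi 1 1 \<in> measurable M (count_space UNIV)" "eta 1 1 \<in> measurable M (count_space UNIV)"
  "eps 1 \<in> measurable M (count_space UNIV)"
  by (auto intro: measurable_vars)

lemma distr_vars:
  "1 \<le> n \<Longrightarrow> 1 \<le> i \<Longrightarrow> distr M borel (\<lambda>\<omega>. real (xi n i \<omega>)) = distr M borel (\<lambda>\<omega>. real (xi 1 1 \<omega>))"
  "1 \<le> n \<Longrightarrow> 1 \<le> i \<Longrightarrow> distr M borel (\<lambda>\<omega>. real (eta n i \<omega>)) = distr M borel (\<lambda>\<omega>. real (eta 1 1 \<omega>))"
  "1 \<le> n \<Longrightarrow> distr M borel (\<lambda>\<omega>. real (eps n \<omega>)) = distr M borel (\<lambda>\<omega>. real (eps 1 \<omega>))"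
  using model unfolding gw2_model_def by (intro distr_real_eq measurable_vars; blast intro: order_refl)+

lemma tail_eq_upper_tail: "tail M Y = upper_tail (\<lambda>\<omega>. real (Y \<omega>))"
  by (rule ext) (simp add: tail_def)

sublocale rv_prob M "tail M (eps 1)" \<alpha>
proof unfold_locales
  show "0 < tail M (eps 1) x" for x
    by (rule regularly_varying_tail_pos[OF rv_eps]) simp
  show "tail M (eps 1) y \<le> tail M (eps 1) x" if "x \<le> y" for x y
    using that unfolding tail_eq_upper_tail by (intro upper_tail_antimono) auto
  show "((\<lambda>x. tail M (eps 1) (q * x) / tail M (eps 1) x) \<longlongrightarrow> q powr - \<alpha>) at_top" if "0 < q" for q
    using rv_eps that by (simp add: regularly_varying_def tail_def)
qed (use alpha in auto)

lemma regular_vars: "regular (tail M (xi 1 1))" "regular (tail M (eta 1 1))"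
proof -
  have "tail M (xi 1 1) x \<noteq> 0" "tail M (eta 1 1) x \<noteq> 0" for x
    using regularly_varying_tail_pos[OF rv_xi, of x] regularly_varying_tail_pos[OF rv_eta, of x] by auto
  then show "regular (tail M (xi 1 1))" "regular (tail M (eta 1 1))"
    using rv_xi rv_eta
    by (intro regular_limit tail_xi_eps tail_eta_eps; simp add: regularly_varying_def tail_def)+
qed

section \<open>Offspring and immigration of a single generation\<close>

lemma indep_real: "indep_vars (\<lambda>_. borel) (\<lambda>l \<omega>. real (basic_rv Xm1 X0 xi eta eps l \<omega>)) {l. valid_label l}"
  by (rule indep_vars_compose2[OF indep]) simp

lemma iid_xi: "iid_copies (\<lambda>i \<omega>. real (xi (Suc n) i \<omega>)) {1..k} (\<lambda>\<omega>. real (xi 1 1 \<omega>))"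
  and iid_eta: "iid_copies (\<lambda>i \<omega>. real (eta (Suc n) i \<omega>)) {1..k} (\<lambda>\<omega>. real (eta 1 1 \<omega>))"
proof -
  have "indep_vars (\<lambda>_. borel) (\<lambda>i \<omega>. real (basic_rv Xm1 X0 xi eta eps (LXi (Suc n) i) \<omega>)) {1..k}"
    "indep_vars (\<lambda>_. borel) (\<lambda>i \<omega>. real (basic_rv Xm1 X0 xi eta eps (LEta (Suc n) i) \<omega>)) {1..k}"
    by (rule indep_vars_reindex[OF indep_real]; auto simp: inj_on_def valid_label_def)+
  then show "iid_copies (\<lambda>i \<omega>. real (xi (Suc n) i \<omega>)) {1..k} (\<lambda>\<omega>. real (xi 1 1 \<omega>))"
    "iid_copies (\<lambda>i \<omega>. real (eta (Suc n) i \<omega>)) {1..k} (\<lambda>\<omega>. real (eta 1 1 \<omega>))"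
    using distr_vars(1,2)[of "Suc n"] by (simp_all add: iid_copies_def basic_rv_def)
qed

lemma upper_tail_vars:
  "1 \<le> n \<Longrightarrow> 1 \<le> i \<Longrightarrow> upper_tail (\<lambda>\<omega>. real (xi n i \<omega>)) x = tail M (xi 1 1) x"
  "1 \<le> n \<Longrightarrow> 1 \<le> i \<Longrightarrow> upper_tail (\<lambda>\<omega>. real (eta n i \<omega>)) x = tail M (eta 1 1) x"
  "1 \<le> n \<Longrightarrow> upper_tail (\<lambda>\<omega>. real (eps n \<omega>)) x = tail M (eps 1) x"
  unfolding tail_eq_upper_tail
  by (rule upper_tail_cong_distr, measurable, rule distr_vars, assumption+)+

text \<open>Through their labels the k + l + 1 variables form one independent family, to which the
  single big jump principle for finite sums applies.\<close>

lemma tail_generation_sum: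
  "(\<lambda>x. upper_tail (\<lambda>\<omega>. (\<Sum>i=1..k. real (xi (Suc n) i \<omega>)) + (\<Sum>j=1..l. real (eta (Suc n) j \<omega>)) + real (eps (Suc n) \<omega>)) x
     - (real k * tail M (xi 1 1) x + real l * tail M (eta 1 1) x + tail M (eps 1) x)) \<in> o(tail M (eps 1))"
proof -
  let ?A = "LXi (Suc n) ` {1..k}" and ?B = "LEta (Suc n) ` {1..l}" and ?C = "{LEps (Suc n)}"
  let ?Z = "\<lambda>l \<omega>. real (basic_rv Xm1 X0 xi eta eps l \<omega>)"
  have split: "(\<Sum>l\<in>?A \<union> ?B \<union> ?C. g l) = (\<Sum>i=1..k. g (LXi (Suc n) i)) + (\<Sum>j=1..l. g (LEta (Suc n) j)) + g (LEps (Suc n))"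
    for g :: "label \<Rightarrow> real"
    by (subst sum.union_disjoint, force, force, force, subst sum.union_disjoint, force, force, force)
      (simp add: sum.reindex inj_on_def)
  have "(\<lambda>x. upper_tail (\<lambda>\<omega>. \<Sum>l\<in>?A \<union> ?B \<union> ?C. ?Z l \<omega>) x - (\<Sum>l\<in>?A \<union> ?B \<union> ?C. upper_tail (?Z l) x)) \<in> o(tail M (eps 1))"
  proof (rule tail_sum_indep)
    show "indep_vars (\<lambda>_. borel) ?Z (?A \<union> ?B \<union> ?C)"
      by (rule indep_vars_subset[OF indep_real]) (auto simp: valid_label_def)
    show "regular (upper_tail (?Z i))" if "i \<in> ?A \<union> ?B \<union> ?C" for i
      using that regular_vars regular_F by (auto simp: basic_rv_def upper_tail_vars)
  qed auto
  moreover have "(\<Sum>l\<in>?A \<union> ?B \<union> ?C. upper_tail (?Z l) x)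
      = real k * tail M (xi 1 1) x + real l * tail M (eta 1 1) x + tail M (eps 1) x" for x
    unfolding split by (simp add: basic_rv_def upper_tail_vars cong: sum.cong_simp)
  ultimately show ?thesis unfolding split by (simp add: basic_rv_def)
qed

abbreviation past_vars :: "nat \<Rightarrow> 'a \<Rightarrow> label \<Rightarrow> nat" where
  "past_vars n \<omega> \<equiv> restrict (\<lambda>l. basic_rv Xm1 X0 xi eta eps l \<omega>) (past n)"

abbreviation present_vars :: "nat \<Rightarrow> 'a \<Rightarrow> label \<Rightarrow> nat" where
  "present_vars n \<omega> \<equiv> restrict (\<lambda>l. basic_rv Xm1 X0 xi eta eps l \<omega>) (present n)"

lemma X_eq_coord: "k \<le> Suc n \<Longrightarrow> X k \<omega> = gw2_coord k (past_vars n \<omega>)"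
  by (rule gw2_aux_eq_coord) simp_all

lemma coord_eq_X:
  "gw2_coord (Suc n) (past_vars n \<omega>) = X (Suc n) \<omega>" "gw2_coord n (past_vars n \<omega>) = X n \<omega>"
  by (rule X_eq_coord[symmetric], simp)+

lemma measurable_X [measurable]: "X k \<in> measurable M (count_space UNIV)"
proof -
  have "past_vars k \<in> measurable M (PiM (past k) (\<lambda>_. count_space UNIV))"
    by (rule measurable_restrict) (simp add: past_def measurable_basic_rv)
  from measurable_compose[OF this measurable_gw2_coord[of k k]]
  have "(\<lambda>\<omega>. gw2_coord k (past_vars k \<omega>)) \<in> measurable M (count_space UNIV)" by simp
  moreover have "X k = (\<lambda>\<omega>. gw2_coord k (past_vars k \<omega>))" by (rule ext, rule X_eq_coord) simp
  ultimately show ?thesis by (simp only:)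
qed

lemma indep_generation:
  "indep_var (PiM (past n) (\<lambda>_. count_space UNIV)) (past_vars n)
     (PiM (present (Suc n)) (\<lambda>_. count_space UNIV)) (present_vars (Suc n))"
  by (rule indep_var_restrict[OF indep]) (auto simp: past_def present_def)

lemma measurable_coord_pair:
  "(\<lambda>f. (gw2_coord (Suc n) f, gw2_coord n f)) \<in> measurable (PiM (past n) (\<lambda>_. count_space UNIV)) (count_space UNIV)"
  by (rule measurable_count_space_binary[where h = Pair]; rule measurable_gw2_coord) auto

lemma measurable_generation_sum:
  "(\<lambda>f. (\<Sum>i=1..k. f (LXi (Suc n) i)) + (\<Sum>j=1..l. f (LEta (Suc n) j)) + f (LEps (Suc n)))
     \<in> measurable (PiM (present (Suc n)) (\<lambda>_. count_space UNIV :: nat measure)) (count_space UNIV)"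
  (is "_ \<in> measurable ?N _")
proof -
  have "(\<lambda>f. \<Sum>i=1..k. f (LXi (Suc n) i)) \<in> measurable ?N (count_space UNIV)"
    "(\<lambda>f. \<Sum>j=1..l. f (LEta (Suc n) j)) \<in> measurable ?N (count_space UNIV)"
    "(\<lambda>f. f (LEps (Suc n))) \<in> measurable ?N (count_space UNIV)"
    by (auto intro!: measurable_random_sum_nat measurable_component_singleton)
  from measurable_count_space_binary[OF measurable_count_space_binary[OF this(1,2), where h = "(+)"] this(3), where h = "(+)"]
  show ?thesis .
qed

text \<open>Conditioning on \<open>past n\<close>: it determines both population sizes and is
  independent of the labels in \<open>present (Suc n)\<close>.\<close>

lemma tail_next_generation:
  "upper_tail (\<lambda>\<omega>. real (X (Suc (Suc n)) \<omega>) + b * real (X (Suc n) \<omega>)) x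
    = expectation (\<lambda>\<omega>. upper_tail (\<lambda>\<omega>'. (\<Sum>i=1..X (Suc n) \<omega>. real (xi (Suc n) i \<omega>'))
        + (\<Sum>j=1..X n \<omega>. real (eta (Suc n) j \<omega>')) + real (eps (Suc n) \<omega>') + b * real (X (Suc n) \<omega>)) x)"
proof -
  let ?H = "\<lambda>p f. x < real ((\<Sum>i=1..fst p. f (LXi (Suc n) i)) + (\<Sum>j=1..snd p. f (LEta (Suc n) j)) + f (LEps (Suc n)))
      + b * real (fst p)"
  have "Measurable.pred (PiM (present (Suc n)) (\<lambda>_. count_space UNIV)) (?H p)" for p
    using measurable_compose[OF measurable_generation_sum[of "fst p" n "snd p"],
        of "\<lambda>s. x < real s + b * real (fst p)" "count_space UNIV"] by simp
  from indep_var_prob_mixture[OF indep_generation[of n] measurable_coord_pair[of n], of ?H, OF this]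
  show ?thesis unfolding prod.sel coord_eq_X by (simp add: basic_rv_def cong: sum.cong_simp)
qed

section \<open>First moments of the process\<close>

lemma nn_integral_vars:
  "1 \<le> n \<Longrightarrow> 1 \<le> i \<Longrightarrow> (\<integral>\<^sup>+\<omega>. ennreal (real (xi n i \<omega>)) \<partial>M) = ennreal m\<xi>"
  "1 \<le> n \<Longrightarrow> 1 \<le> i \<Longrightarrow> (\<integral>\<^sup>+\<omega>. ennreal (real (eta n i \<omega>)) \<partial>M) = ennreal m\<eta>"
  "1 \<le> n \<Longrightarrow> (\<integral>\<^sup>+\<omega>. ennreal (real (eps n \<omega>)) \<partial>M) = ennreal m\<epsilon>"
proof -
  have *: "(\<integral>\<^sup>+\<omega>. ennreal (real (Y \<omega>)) \<partial>M) = ennreal (expectation (\<lambda>\<omega>. real (Y' \<omega>)))"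
    if "distr M borel (\<lambda>\<omega>. real (Y \<omega>)) = distr M borel (\<lambda>\<omega>. real (Y' \<omega>))" "integrable M (\<lambda>\<omega>. real (Y' \<omega>))"
      and [measurable]: "Y \<in> measurable M (count_space UNIV)" "Y' \<in> measurable M (count_space UNIV)" for Y Y' :: "'a \<Rightarrow> nat"
  proof -
    have "(\<integral>\<^sup>+\<omega>. ennreal (real (Z \<omega>)) \<partial>M) = (\<integral>\<^sup>+z. ennreal z \<partial>distr M borel (\<lambda>\<omega>. real (Z \<omega>)))"
      if [measurable]: "Z \<in> measurable M (count_space UNIV)" for Z :: "'a \<Rightarrow> nat"
      by (subst nn_integral_distr) auto
    from this[of Y] this[of Y'] have "(\<integral>\<^sup>+\<omega>. ennreal (real (Y \<omega>)) \<partial>M) = (\<integral>\<^sup>+\<omega>. ennreal (real (Y' \<omega>)) \<partial>M)"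
      using that by simp
    also have "\<dots> = ennreal (expectation (\<lambda>\<omega>. real (Y' \<omega>)))"
      using that by (intro nn_integral_eq_integral) auto
    finally show ?thesis .
  qed
  show "1 \<le> n \<Longrightarrow> 1 \<le> i \<Longrightarrow> (\<integral>\<^sup>+\<omega>. ennreal (real (xi n i \<omega>)) \<partial>M) = ennreal m\<xi>"
    by (intro * distr_vars int_xi) (auto intro: measurable_vars)
  show "1 \<le> n \<Longrightarrow> 1 \<le> i \<Longrightarrow> (\<integral>\<^sup>+\<omega>. ennreal (real (eta n i \<omega>)) \<partial>M) = ennreal m\<eta>"
    by (intro * distr_vars int_eta) (auto intro: measurable_vars)
  show "1 \<le> n \<Longrightarrow> (\<integral>\<^sup>+\<omega>. ennreal (real (eps n \<omega>)) \<partial>M) = ennreal m\<epsilon>"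
    by (intro * distr_vars int_eps) (auto intro: measurable_vars)
qed

lemma nn_integral_generation_sum:
  "(\<integral>\<^sup>+\<omega>. ennreal (real ((\<Sum>i=1..k. xi (Suc n) i \<omega>) + (\<Sum>j=1..l. eta (Suc n) j \<omega>) + eps (Suc n) \<omega>)) \<partial>M)
     = ennreal (m\<xi> * real k + m\<eta> * real l + m\<epsilon>)"
proof -
  have [measurable]: "(\<lambda>\<omega>. ennreal (real (xi (Suc n) i \<omega>))) \<in> borel_measurable M"
      "(\<lambda>\<omega>. ennreal (real (eta (Suc n) i \<omega>))) \<in> borel_measurable M" if "i \<in> {1..k}" for i k
    using measurable_vars(3,4)[of "Suc n" i] that by auto
  have [measurable]: "(\<lambda>\<omega>. ennreal (real (eps (Suc n) \<omega>))) \<in> borel_measurable M"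
    using measurable_vars(5)[of "Suc n"] by auto
  have "(\<integral>\<^sup>+\<omega>. ennreal (real ((\<Sum>i=1..k. xi (Suc n) i \<omega>) + (\<Sum>j=1..l. eta (Suc n) j \<omega>) + eps (Suc n) \<omega>)) \<partial>M)
    = (\<integral>\<^sup>+\<omega>. ((\<Sum>i\<in>{1..k}. ennreal (real (xi (Suc n) i \<omega>))) + (\<Sum>j\<in>{1..l}. ennreal (real (eta (Suc n) j \<omega>)))
        + ennreal (real (eps (Suc n) \<omega>))) \<partial>M)"
    by (intro nn_integral_cong) (simp add: sum_nonneg)
  also have "\<dots> = (\<integral>\<^sup>+\<omega>. (\<Sum>i\<in>{1..k}. ennreal (real (xi (Suc n) i \<omega>))) \<partial>M)
      + (\<integral>\<^sup>+\<omega>. (\<Sum>j\<in>{1..l}. ennreal (real (eta (Suc n) j \<omega>))) \<partial>M) + (\<integral>\<^sup>+\<omega>. ennreal (real (eps (Suc n) \<omega>)) \<partial>M)"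
    by (subst nn_integral_add, measurable, subst nn_integral_add, measurable)
  also have "\<dots> = (\<Sum>i\<in>{1..k}. ennreal m\<xi>) + (\<Sum>j\<in>{1..l}. ennreal m\<eta>) + ennreal m\<epsilon>"
    by (subst (1 2) nn_integral_sum) (auto simp: nn_integral_vars cong: sum.cong_simp)
  also have "\<dots> = ennreal (m\<xi> * real k + m\<eta> * real l + m\<epsilon>)"
    using pos_xi pos_eta
    by (simp add: ennreal_of_nat_eq_real_of_nat ennreal_mult[symmetric] ennreal_plus[symmetric] integral_nonneg_AE mult.commute del: ennreal_plus)
  finally show ?thesis .
qed

lemma integrable_initial:
  assumes [measurable]: "Y \<in> measurable M (count_space UNIV)" and "integrable M (\<lambda>\<omega>. real (Y \<omega>) powr r)"
  shows "integrable M (\<lambda>\<omega>. real (Y \<omega>))"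
proof (rule Bochner_Integration.integrable_bound[of M "\<lambda>\<omega>. real (Y \<omega>) powr r"])
  \<comment> \<open>Integer values are 0 or at least 1, and r > 1.\<close>
  have "real (Y \<omega>) \<le> real (Y \<omega>) powr r" for \<omega>
  proof (cases "Y \<omega> = 0")
    case False
    then have "real (Y \<omega>) powr 1 \<le> real (Y \<omega>) powr r" using r alpha by (intro powr_mono) auto
    then show ?thesis using False by simp
  qed simp
  then show "AE \<omega> in M. norm (real (Y \<omega>)) \<le> norm (real (Y \<omega>) powr r)" by simp
qed (use assms in auto)

text \<open>The computation uses the non-negative integral, which presupposes no integrability of
  the new generation; the finite value obtained yields integrability and the mean together.\<close>

lemma integrable_X_mean_step:
  assumes "integrable M (\<lambda>\<omega>. real (X n \<omega>))" "integrable M (\<lambda>\<omega>. real (X (Suc n) \<omega>))"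
  shows "integrable M (\<lambda>\<omega>. real (X (Suc (Suc n)) \<omega>))"
    and "meanX (Suc (Suc n)) = m\<xi> * meanX (Suc n) + m\<eta> * meanX n + m\<epsilon>"
proof -
  let ?h = "\<lambda>p f. ennreal (real ((\<Sum>i=1..fst p. f (LXi (Suc n) i)) + (\<Sum>j=1..snd p. f (LEta (Suc n) j)) + f (LEps (Suc n))))"
  have h: "?h p \<in> borel_measurable (PiM (present (Suc n)) (\<lambda>_. count_space UNIV))" for p
    using measurable_compose[OF measurable_generation_sum[of "fst p" n "snd p"], of "\<lambda>s. ennreal (real s)" borel] by simp
  have "(\<integral>\<^sup>+\<omega>. ennreal (real (X (Suc (Suc n)) \<omega>)) \<partial>M) = (\<integral>\<^sup>+\<omega>. (\<integral>\<^sup>+\<omega>'. ennreal (real ((\<Sum>i=1..X (Suc n) \<omega>. xi (Suc n) i \<omega>')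
      + (\<Sum>j=1..X n \<omega>. eta (Suc n) j \<omega>') + eps (Suc n) \<omega>')) \<partial>M) \<partial>M)"
    using indep_var_nn_integral_countable[OF indep_generation[of n] measurable_coord_pair[of n], of ?h, OF h]
    unfolding prod.sel coord_eq_X by (simp add: basic_rv_def cong: sum.cong_simp)
  also have "\<dots> = (\<integral>\<^sup>+\<omega>. ennreal (m\<xi> * real (X (Suc n) \<omega>) + m\<eta> * real (X n \<omega>) + m\<epsilon>) \<partial>M)"
    unfolding nn_integral_generation_sum ..
  also have "\<dots> = ennreal (expectation (\<lambda>\<omega>. m\<xi> * real (X (Suc n) \<omega>) + m\<eta> * real (X n \<omega>) + m\<epsilon>))"
    using assms pos_xi pos_eta by (intro nn_integral_eq_integral) (auto simp: integral_nonneg_AE)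
  also have "expectation (\<lambda>\<omega>. m\<xi> * real (X (Suc n) \<omega>) + m\<eta> * real (X n \<omega>) + m\<epsilon>)
      = m\<xi> * meanX (Suc n) + m\<eta> * meanX n + m\<epsilon>"
    using assms by (simp add: prob_space)
  finally have nn: "(\<integral>\<^sup>+\<omega>. ennreal (real (X (Suc (Suc n)) \<omega>)) \<partial>M) = ennreal (m\<xi> * meanX (Suc n) + m\<eta> * meanX n + m\<epsilon>)" .
  show "integrable M (\<lambda>\<omega>. real (X (Suc (Suc n)) \<omega>))"
    using nn by (intro integrableI_nonneg) (simp_all del: gw2_aux.simps)
  show "meanX (Suc (Suc n)) = m\<xi> * meanX (Suc n) + m\<eta> * meanX n + m\<epsilon>"
  proof -
    have "meanX (Suc (Suc n)) = enn2real (\<integral>\<^sup>+\<omega>. ennreal (real (X (Suc (Suc n)) \<omega>)) \<partial>M)"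
      by (rule integral_eq_nn_integral) (auto simp del: gw2_aux.simps)
    also have "\<dots> = m\<xi> * meanX (Suc n) + m\<eta> * meanX n + m\<epsilon>"
      unfolding nn using pos_xi pos_eta
      by (intro enn2real_ennreal add_nonneg_nonneg mult_nonneg_nonneg integral_nonneg_AE) auto
    finally show ?thesis .
  qed
qed

lemma integrable_X: "integrable M (\<lambda>\<omega>. real (X k \<omega>))"
proof (induction k rule: induct_nat_012)
  case 0
  then show ?case using integrable_initial[OF measurable_vars(2) momm1] by simp
next
  case 1
  then show ?case using integrable_initial[OF measurable_vars(1) mom0] by simp
next
  case (ge2 k)
  then show ?case by (intro integrable_X_mean_step)
qed

lemmas mean_X_step = integrable_X_mean_step(2)[OF integrable_X integrable_X]

end

section \<open>Tails of linear combinations\<close>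

text \<open>\<open>lam_plus\<close> and \<open>lam_minus\<close> are the roots of z^2 = x * z + y,
  so their powers satisfy the corresponding recursion. The case distinction encodes the convention
  m_(-1) = 0.\<close>

lemma mseq_Suc:
  assumes "0 < y"
  shows "mseq x y (Suc k) = mseq x y k * x + y * (if k = 0 then 0 else mseq x y (k - 1))"
proof -
  define p q where "p = lam_plus x y" and "q = lam_minus x y"
  define d where "d = sqrt (x\<^sup>2 + 4 * y)"
  have d: "0 < d" "d\<^sup>2 = x\<^sup>2 + 4 * y" using assms by (auto simp: d_def add_nonneg_pos)
  have p: "p = (x + d) / 2" and q: "q = (x - d) / 2"
    by (simp_all add: p_def q_def d_def lam_plus_def lam_minus_def)
  have diff: "p - q = d" and sum: "p + q = x" by (auto simp: p q field_simps)
  have prod: "p * q = - y" using d(2) by (simp add: p q field_simps power2_eq_square)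
  \<comment> \<open>The closed form also gives 1 at k = 0, since p - q = d.\<close>
  have m: "mseq x y k = (p ^ (k + 1) - q ^ (k + 1)) / d" for k
    using d(1) diff unfolding mseq_def p_def[symmetric] q_def[symmetric] by auto
  have "p ^ (k + 2) - q ^ (k + 2) = (p ^ (k + 1) - q ^ (k + 1)) * (p + q) - p * q * (p ^ k - q ^ k)"
    by (simp add: algebra_simps)
  then have "mseq x y (Suc k) * d = mseq x y k * d * x + y * (p ^ k - q ^ k)"
    using d(1) unfolding m by (simp add: sum prod)
  moreover have "p ^ k - q ^ k = d * (if k = 0 then 0 else mseq x y (k - 1))"
    using d(1) unfolding m by (cases k) auto
  ultimately have "mseq x y (Suc k) * d = (mseq x y k * x + y * (if k = 0 then 0 else mseq x y (k - 1))) * d"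
    by (simp add: algebra_simps)
  then show ?thesis using d(1) by simp
qed

context gw2_rv
begin

abbreviation t\<xi> :: "real \<Rightarrow> real" where "t\<xi> \<equiv> tail M (xi 1 1)"
abbreviation t\<eta> :: "real \<Rightarrow> real" where "t\<eta> \<equiv> tail M (eta 1 1)"
abbreviation F :: "real \<Rightarrow> real" where "F \<equiv> tail M (eps 1)"

lemma initial_tail_smallo:
  assumes [measurable]: "Y \<in> measurable M (count_space UNIV)" and int: "integrable M (\<lambda>\<omega>. real (Y \<omega>) powr r)"
  shows "upper_tail (\<lambda>\<omega>. real (Y \<omega>)) \<in> o(F)"
proof -
  let ?E = "expectation (\<lambda>\<omega>. real (Y \<omega>) powr r)"
  have "\<forall>\<^sub>F x in at_top. norm (upper_tail (\<lambda>\<omega>. real (Y \<omega>)) x) \<le> ?E * norm (x powr (- r))"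
    using eventually_gt_at_top[of 0]
  proof eventually_elim
    case (elim x)
    have "upper_tail (\<lambda>\<omega>. real (Y \<omega>)) x \<le> prob {\<omega> \<in> space M. x powr r \<le> real (Y \<omega>) powr r}"
      using elim r alpha by (intro finite_measure_mono) (auto intro!: powr_mono2)
    also have "\<dots> \<le> ?E / x powr r"
      using elim int by (intro integral_Markov_inequality_measure[where A = "{}"]) auto
    finally show ?case by (simp add: powr_minus divide_inverse)
  qed
  then have "upper_tail (\<lambda>\<omega>. real (Y \<omega>)) \<in> O(\<lambda>x. x powr (- r))" by (rule bigoI)
  then show ?thesis using powr_smallo[OF r] by (rule landau_o.big_small_trans)
qed

text \<open>The arguments follow the coefficients of a X_n + b X_(n-1) one generation back. Each
  step adds a^\<alpha> times the mean number of individuals producing xi offspring; in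
  \<open>coeff_eta\<close> the parents are one generation older, and in \<open>coeff_eps\<close>
  there is one immigration term.\<close>

fun coeff_xi :: "nat \<Rightarrow> real \<Rightarrow> real \<Rightarrow> real" where
  "coeff_xi 0 a b = 0"
| "coeff_xi (Suc n) a b = coeff_xi n (a * m\<xi> + b) (a * m\<eta>) + a powr \<alpha> * meanX (Suc n)"

fun coeff_eta :: "nat \<Rightarrow> real \<Rightarrow> real \<Rightarrow> real" where
  "coeff_eta 0 a b = 0"
| "coeff_eta (Suc n) a b = coeff_eta n (a * m\<xi> + b) (a * m\<eta>) + a powr \<alpha> * meanX n"

fun coeff_eps :: "nat \<Rightarrow> real \<Rightarrow> real \<Rightarrow> real" where
  "coeff_eps 0 a b = 0"
| "coeff_eps (Suc n) a b = coeff_eps n (a * m\<xi> + b) (a * m\<eta>) + a powr \<alpha>"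

abbreviation limit_tail :: "nat \<Rightarrow> real \<Rightarrow> real \<Rightarrow> real \<Rightarrow> real" where
  "limit_tail n a b x \<equiv> coeff_xi n a b * t\<xi> x + coeff_eta n a b * t\<eta> x + coeff_eps n a b * F x"

lemma regular_limit_tail: "regular (limit_tail n a b)"
  by (intro regular_add regular_cmult regular_vars regular_F)

text \<open>Because \<open>X (Suc n)\<close> and \<open>X n\<close> are dependent, the induction has to be carried out for the
  tails of all their non-negative linear combinations: replacing offspring by their means,
  $a X_{n+1} + b X_n$ turns into $(a m_\xi + b) X_n + a m_\eta X_{n-1}$.\<close>

lemma tail_linear_combination:
  assumes "0 \<le> a" "0 \<le> b"
  shows "(\<lambda>x. upper_tail (\<lambda>\<omega>. a * real (X (Suc n) \<omega>) + b * real (X n \<omega>)) x - limit_tail n a b x) \<in> o(F)"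
  using assms
proof (induction n arbitrary: a b)
  case 0
  \<comment> \<open>If both initial values are at most c * x, the combination is at most (a + b) * c
    * x < x; the added 1 also covers a = b = 0.\<close>
  define c where "c = 1 / (a + b + 1)"
  have "(a + b) * c < 1" using 0 by (simp add: c_def divide_less_eq)
  then have c: "0 < c" "a * c + b * c < 1" using 0 by (simp_all add: distrib_right) (simp add: c_def)
  have "(\<lambda>x. upper_tail (\<lambda>\<omega>. real (X0 \<omega>)) (c * x) + upper_tail (\<lambda>\<omega>. real (Xm1 \<omega>)) (c * x)) \<in> o(F)"
    by (intro sum_in_smallo smallo_scale initial_tail_smallo mom0 momm1 c) auto
  then have small: "(\<lambda>x. upper_tail (\<lambda>\<omega>. a * real (X0 \<omega>) + b * real (Xm1 \<omega>)) x) \<in> o(F)"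
  proof (rule landau_o.big_small_trans[rotated])
    have "\<forall>\<^sub>F x in at_top. norm (upper_tail (\<lambda>\<omega>. a * real (X0 \<omega>) + b * real (Xm1 \<omega>)) x)
        \<le> 1 * norm (upper_tail (\<lambda>\<omega>. real (X0 \<omega>)) (c * x) + upper_tail (\<lambda>\<omega>. real (Xm1 \<omega>)) (c * x))"
      using eventually_gt_at_top[of 0]
    proof eventually_elim
      case (elim x)
      have "upper_tail (\<lambda>\<omega>. a * real (X0 \<omega>) + b * real (Xm1 \<omega>)) x
          \<le> prob ({\<omega> \<in> space M. c * x < real (X0 \<omega>)} \<union> {\<omega> \<in> space M. c * x < real (Xm1 \<omega>)})"
      proof (rule finite_measure_mono)
        show "{\<omega> \<in> space M. x < a * real (X0 \<omega>) + b * real (Xm1 \<omega>)}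
          \<subseteq> {\<omega> \<in> space M. c * x < real (X0 \<omega>)} \<union> {\<omega> \<in> space M. c * x < real (Xm1 \<omega>)}"
        proof (rule subsetI, rule ccontr)
          fix \<omega>
          assume "\<omega> \<in> {\<omega> \<in> space M. x < a * real (X0 \<omega>) + b * real (Xm1 \<omega>)}"
            "\<omega> \<notin> {\<omega> \<in> space M. c * x < real (X0 \<omega>)} \<union> {\<omega> \<in> space M. c * x < real (Xm1 \<omega>)}"
          then have \<omega>: "x < a * real (X0 \<omega>) + b * real (Xm1 \<omega>)" "real (X0 \<omega>) \<le> c * x" "real (Xm1 \<omega>) \<le> c * x"
            by auto
          have "x < a * (c * x) + b * (c * x)"
            using \<omega> 0 mult_left_mono[OF \<omega>(2) 0(1)] mult_left_mono[OF \<omega>(3) 0(2)] by linarith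
          also have "\<dots> = (a * c + b * c) * x" by (simp add: algebra_simps)
          also have "\<dots> \<le> 1 * x" using c elim by (intro mult_right_mono) auto
          finally show False by simp
        qed
      qed measurable
      also have "\<dots> \<le> upper_tail (\<lambda>\<omega>. real (X0 \<omega>)) (c * x) + upper_tail (\<lambda>\<omega>. real (Xm1 \<omega>)) (c * x)"
        by (intro measure_Un_le) measurable
      finally show ?case by simp
    qed
    then show "(\<lambda>x. upper_tail (\<lambda>\<omega>. a * real (X0 \<omega>) + b * real (Xm1 \<omega>)) x)
        \<in> O(\<lambda>x. upper_tail (\<lambda>\<omega>. real (X0 \<omega>)) (c * x) + upper_tail (\<lambda>\<omega>. real (Xm1 \<omega>)) (c * x))"
      by (rule bigoI)
  qed
  then show ?case by simp
next
  case (Suc n)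
  show ?case
  proof (cases "a = 0")
    case True
    \<comment> \<open>Division by a is impossible here, but b * X (Suc n) is already covered by the
      hypothesis with coefficients (b, 0), and \<open>0 powr \<alpha>\<close> = 0 removes the new
      terms.\<close>
    then show ?thesis using Suc.IH[of b 0] Suc.prems by simp
  next
    case False
    then have a: "0 < a" using Suc.prems by simp
    \<comment> \<open>The newest generation gets coefficient 1, as the random sum estimate requires;
      replacing x by x / a undoes this afterwards.\<close>
    define c where "c = b / a"
    have c: "0 \<le> c" using a Suc.prems by (simp add: c_def)
    let ?Y = "\<lambda>\<omega>. (m\<xi> + c) * real (X (Suc n) \<omega>) + m\<eta> * real (X n \<omega>)"
    let ?f = "upper_tail (\<lambda>\<omega>. real (X (Suc (Suc n)) \<omega>) + c * real (X (Suc n) \<omega>))"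
    have mc: "0 \<le> m\<xi> + c" "0 \<le> m\<eta>" using pos_xi pos_eta c by auto
    have regY: "regular (upper_tail ?Y)"
      by (rule regular_smallo_diff[OF regular_limit_tail Suc.IH[OF mc]])
    have W: "upper_tail (\<lambda>\<omega>. real (eps (Suc n) \<omega>)) = F"
      by (rule ext, rule upper_tail_vars) simp
    have "(\<lambda>x. expectation (\<lambda>\<omega>. upper_tail (\<lambda>\<omega>'. (\<Sum>i=1..X (Suc n) \<omega>. real (xi (Suc n) i \<omega>'))
          + (\<Sum>j=1..X n \<omega>. real (eta (Suc n) j \<omega>')) + real (eps (Suc n) \<omega>') + c * real (X (Suc n) \<omega>)) x)
        - (upper_tail ?Y x + meanX (Suc n) * upper_tail (\<lambda>\<omega>. real (xi 1 1 \<omega>)) x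
           + meanX n * upper_tail (\<lambda>\<omega>. real (eta 1 1 \<omega>)) x + F x)) \<in> o(F)"
    proof (rule tail_random_sum[OF measurable_X measurable_X integrable_X integrable_X iid_xi iid_eta
          int_xi int_eta _ _ _ pos_xi pos_eta c])
      show "regular (upper_tail (\<lambda>\<omega>. real (xi 1 1 \<omega>)))" "regular (upper_tail (\<lambda>\<omega>. real (eta 1 1 \<omega>)))"
        using regular_vars unfolding tail_eq_upper_tail by auto
      show "(\<lambda>\<omega>. real (eps (Suc n) \<omega>)) \<in> borel_measurable M"
        using measurable_vars(5)[of "Suc n"] by simp
      show "(\<lambda>x. upper_tail (\<lambda>\<omega>. (\<Sum>i=1..k. real (xi (Suc n) i \<omega>)) + (\<Sum>j=1..l. real (eta (Suc n) j \<omega>)) + real (eps (Suc n) \<omega>)) x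
          - (real k * upper_tail (\<lambda>\<omega>. real (xi 1 1 \<omega>)) x + real l * upper_tail (\<lambda>\<omega>. real (eta 1 1 \<omega>)) x + F x)) \<in> o(F)" for k l
        using tail_generation_sum[of n k l] by (simp only: tail_def)
    qed (use regY W in simp_all)
    then have step: "(\<lambda>x. ?f x - (upper_tail ?Y x + meanX (Suc n) * t\<xi> x + meanX n * t\<eta> x + F x)) \<in> o(F)"
      unfolding tail_next_generation tail_eq_upper_tail .
    have q: "0 < 1 / a" "(1 / a) powr (-\<alpha>) = a powr \<alpha>"
      using a by (auto simp: powr_divide powr_minus field_simps)
    have "(\<lambda>x. ?f (1 / a * x) - (upper_tail ?Y (1 / a * x) + meanX (Suc n) * t\<xi> (1 / a * x) + meanX n * t\<eta> (1 / a * x) + F (1 / a * x))) \<in> o(F)"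
      by (rule smallo_scale[OF step q(1)])
    moreover have "(\<lambda>x. (meanX (Suc n) * t\<xi> (1 / a * x) + meanX n * t\<eta> (1 / a * x) + F (1 / a * x))
        - a powr \<alpha> * (meanX (Suc n) * t\<xi> x + meanX n * t\<eta> x + F x)) \<in> o(F)"
      using regular_scale[OF _ q(1), of "\<lambda>x. meanX (Suc n) * t\<xi> x + meanX n * t\<eta> x + F x"]
      unfolding q(2) by (simp only: regular_add regular_cmult regular_vars regular_F)
    moreover have "?f (1 / a * x) = upper_tail (\<lambda>\<omega>. a * real (X (Suc (Suc n)) \<omega>) + b * real (X (Suc n) \<omega>)) x" for x
    proof -
      have "1 / a * x < real k + c * real l \<longleftrightarrow> x < a * real k + b * real l" for k l :: nat
        using a by (simp add: c_def field_simps)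
      then show ?thesis by (simp only:)
    qed
    \<comment> \<open>The tail of Y is rescaled exactly, by multiplying the inequality by a, so that
      the induction hypothesis applies; only the tails of the basic variables are rescaled by
      regular variation.\<close>
    moreover have "upper_tail ?Y (1 / a * x) = upper_tail (\<lambda>\<omega>. (a * m\<xi> + b) * real (X (Suc n) \<omega>) + a * m\<eta> * real (X n \<omega>)) x" for x
    proof -
      have "1 / a * x < (m\<xi> + c) * real k + m\<eta> * real l \<longleftrightarrow> x < (a * m\<xi> + b) * real k + a * m\<eta> * real l" for k l :: nat
        using a by (simp add: c_def field_simps)
      then show ?thesis by (simp only:)
    qed
    moreover have "(\<lambda>x. upper_tail (\<lambda>\<omega>. (a * m\<xi> + b) * real (X (Suc n) \<omega>) + a * m\<eta> * real (X n \<omega>)) x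
        - limit_tail n (a * m\<xi> + b) (a * m\<eta>) x) \<in> o(F)"
      using Suc.prems pos_xi pos_eta by (intro Suc.IH) auto
    ultimately have "(\<lambda>x. (upper_tail (\<lambda>\<omega>. a * real (X (Suc (Suc n)) \<omega>) + b * real (X (Suc n) \<omega>)) x
         - (upper_tail (\<lambda>\<omega>. (a * m\<xi> + b) * real (X (Suc n) \<omega>) + a * m\<eta> * real (X n \<omega>)) x
            + meanX (Suc n) * t\<xi> (1 / a * x) + meanX n * t\<eta> (1 / a * x) + F (1 / a * x)))
       + ((meanX (Suc n) * t\<xi> (1 / a * x) + meanX n * t\<eta> (1 / a * x) + F (1 / a * x))
          - a powr \<alpha> * (meanX (Suc n) * t\<xi> x + meanX n * t\<eta> x + F x))
       + (upper_tail (\<lambda>\<omega>. (a * m\<xi> + b) * real (X (Suc n) \<omega>) + a * m\<eta> * real (X n \<omega>)) x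
          - limit_tail n (a * m\<xi> + b) (a * m\<eta>) x)) \<in> o(F)"
      by (intro sum_in_smallo(1)) (simp_all only:)
    also have "(\<lambda>x. (upper_tail (\<lambda>\<omega>. a * real (X (Suc (Suc n)) \<omega>) + b * real (X (Suc n) \<omega>)) x
         - (upper_tail (\<lambda>\<omega>. (a * m\<xi> + b) * real (X (Suc n) \<omega>) + a * m\<eta> * real (X n \<omega>)) x
            + meanX (Suc n) * t\<xi> (1 / a * x) + meanX n * t\<eta> (1 / a * x) + F (1 / a * x)))
       + ((meanX (Suc n) * t\<xi> (1 / a * x) + meanX n * t\<eta> (1 / a * x) + F (1 / a * x))
          - a powr \<alpha> * (meanX (Suc n) * t\<xi> x + meanX n * t\<eta> x + F x))
       + (upper_tail (\<lambda>\<omega>. (a * m\<xi> + b) * real (X (Suc n) \<omega>) + a * m\<eta> * real (X n \<omega>)) x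
          - limit_tail n (a * m\<xi> + b) (a * m\<eta>) x))
      = (\<lambda>x. upper_tail (\<lambda>\<omega>. a * real (X (Suc (Suc n)) \<omega>) + b * real (X (Suc n) \<omega>)) x - limit_tail (Suc n) a b x)"
      by (rule ext) (simp add: algebra_simps del: gw2_aux.simps)
    finally show ?thesis .
  qed
qed

text \<open>Starting from (m j, p j) instead of (1, 0) closes the induction: one step leads to (m
  (Suc j), p (Suc j)), by \<open>mseq_Suc\<close>. The case needed later is j = 0.\<close>

lemma coeffs_eq:
  defines "m \<equiv> mseq m\<xi> m\<eta>"
  defines "p \<equiv> \<lambda>j. m\<eta> * (if j = 0 then 0 else m (j - 1))"
  shows "coeff_xi n (m j) (p j) = (\<Sum>k<n. m (j + k) powr \<alpha> * meanX (n - k))"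
    and "coeff_eta n (m j) (p j) = (\<Sum>k<n. m (j + k) powr \<alpha> * meanX (n - k - 1))"
    and "coeff_eps n (m j) (p j) = (\<Sum>k<n. m (j + k) powr \<alpha>)"
proof -
  have step: "m j * m\<xi> + p j = m (Suc j)" "m j * m\<eta> = p (Suc j)" for j
    unfolding m_def p_def using mseq_Suc[OF pos_eta, of m\<xi> j] by simp_all
  show "coeff_xi n (m j) (p j) = (\<Sum>k<n. m (j + k) powr \<alpha> * meanX (n - k))"
  proof (induction n arbitrary: j)
    case (Suc n)
    show ?case unfolding coeff_xi.simps step Suc.IH by (simp add: sum.lessThan_Suc_shift del: sum.lessThan_Suc)
  qed simp
  show "coeff_eta n (m j) (p j) = (\<Sum>k<n. m (j + k) powr \<alpha> * meanX (n - k - 1))"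
  proof (induction n arbitrary: j)
    case (Suc n)
    show ?case unfolding coeff_eta.simps step Suc.IH by (simp add: sum.lessThan_Suc_shift del: sum.lessThan_Suc)
  qed simp
  show "coeff_eps n (m j) (p j) = (\<Sum>k<n. m (j + k) powr \<alpha>)"
  proof (induction n arbitrary: j)
    case (Suc n)
    show ?case unfolding coeff_eps.simps step Suc.IH by (simp add: sum.lessThan_Suc_shift del: sum.lessThan_Suc)
  qed simp
qed

end

section \<open>The explicit tail asymptotics\<close>

lemma inner_vec2: "vec2 a b \<bullet> vec2 c d = a * c + b * d"
  by (simp add: inner_vec_def vec2_def sum_2)

lemma inner_transpose_mult_vec:
  fixes A :: "real^2^2"
  shows "x \<bullet> (transpose A *v y) = (A *v x) \<bullet> y"
  using dot_lmul_matrix[of x "transpose A" y] by (simp add: vector_transpose_matrix)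

lemma matpow_Suc: "matpow A (Suc k) = A ** matpow A k"
  by (simp add: matpow_def)

context gw2_rv
begin

lemma mean_vec:
  "vec2 (meanX (Suc n)) (meanX n) = matpow (Mmat m\<xi> m\<eta>) n *v vec2 (meanX 1) (meanX 0)
     + (\<Sum>i=1..n. matpow (Mmat m\<xi> m\<eta>) (n - i) *v vec2 m\<epsilon> 0)"
proof (induction n)
  case 0
  then show ?case by (simp add: matpow_def)
next
  case (Suc n)
  let ?A = "Mmat m\<xi> m\<eta>"
  have "vec2 (meanX (Suc (Suc n))) (meanX (Suc n)) = ?A *v vec2 (meanX (Suc n)) (meanX n) + vec2 m\<epsilon> 0"
    unfolding mean_X_step by (simp add: vec_eq_iff forall_2 vec2_def Mmat_def matrix_vector_mult_def sum_2 del: gw2_aux.simps)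
  also have "\<dots> = matpow ?A (Suc n) *v vec2 (meanX 1) (meanX 0)
      + ((\<Sum>i=1..n. matpow ?A (Suc n - i) *v vec2 m\<epsilon> 0) + vec2 m\<epsilon> 0)"
    unfolding Suc.IH
    by (simp add: matrix_vector_right_distrib matrix_vector_mul_assoc matpow_Suc Suc_diff_le
        linear_sum[OF matrix_vector_mul_linear] del: gw2_aux.simps cong: sum.cong_simp)
  also have "(\<Sum>i=1..n. matpow ?A (Suc n - i) *v vec2 m\<epsilon> 0) + vec2 m\<epsilon> 0
      = (\<Sum>i=1..Suc n. matpow ?A (Suc n - i) *v vec2 m\<epsilon> 0)"
    by (simp add: matpow_def)
  finally show ?case .
qed

text \<open>The weight m_k^\<alpha> multiplies the means of two consecutive generations.
  \<open>mean_vec\<close> expresses these by powers of the mean matrix, and transposition moves the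
  powers onto the vector of tails.\<close>

lemma limit_tail_eq:
  assumes n: "1 \<le> n"
  shows "limit_tail n 1 0 x =
      vec2 (expectation (\<lambda>\<omega>. real (X0 \<omega>))) (expectation (\<lambda>\<omega>. real (Xm1 \<omega>)))
        \<bullet> (\<Sum>k = 0..n-1. mseq m\<xi> m\<eta> k powr \<alpha> *\<^sub>R (transpose (matpow (Mmat m\<xi> m\<eta>) (n - k - 1)) *v vec2 (t\<xi> x) (t\<eta> x)))
      + vec2 m\<epsilon> 0 \<bullet> (\<Sum>i = 1..n-1. \<Sum>j = 0..n-i-1. mseq m\<xi> m\<eta> j powr \<alpha> *\<^sub>R
            (transpose (matpow (Mmat m\<xi> m\<eta>) (n - i - j - 1)) *v vec2 (t\<xi> x) (t\<eta> x)))
      + (\<Sum>i = 1..n. mseq m\<xi> m\<eta> (n - i) powr \<alpha> * F x)"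
proof -
  let ?m = "\<lambda>k. mseq m\<xi> m\<eta> k powr \<alpha>" and ?P = "matpow (Mmat m\<xi> m\<eta>)" and ?u = "vec2 (t\<xi> x) (t\<eta> x)"
  let ?v = "vec2 (meanX 1) (meanX 0)" and ?e = "vec2 m\<epsilon> 0"
  have range: "{0..n-1} = {..<n}" using n by auto
  have "mseq m\<xi> m\<eta> 0 = 1" by (simp add: mseq_def)
  then have coeffs: "coeff_xi n 1 0 = (\<Sum>k<n. ?m k * meanX (n - k))" "coeff_eta n 1 0 = (\<Sum>k<n. ?m k * meanX (n - k - 1))"
      "coeff_eps n 1 0 = (\<Sum>k<n. ?m k)"
    using coeffs_eq[of n 0] by simp_all
  have "limit_tail n 1 0 x = (\<Sum>k<n. ?m k * meanX (n - k) * t\<xi> x + ?m k * meanX (n - k - 1) * t\<eta> x + ?m k * F x)"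
    unfolding coeffs by (simp only: sum_distrib_right sum.distrib)
  also have "\<dots> = (\<Sum>k<n. ?m k * (vec2 (meanX (Suc (n - k - 1))) (meanX (n - k - 1)) \<bullet> ?u) + ?m k * F x)"
  proof (intro sum.cong refl)
    fix k assume "k \<in> {..<n}"
    then have "Suc (n - k - 1) = n - k" by auto
    then show "?m k * meanX (n - k) * t\<xi> x + ?m k * meanX (n - k - 1) * t\<eta> x + ?m k * F x
        = ?m k * (vec2 (meanX (Suc (n - k - 1))) (meanX (n - k - 1)) \<bullet> ?u) + ?m k * F x"
      by (simp only: inner_vec2 distrib_left mult.assoc)
  qed
  also have "\<dots> = (\<Sum>k<n. ?m k * (vec2 (meanX (Suc (n - k - 1))) (meanX (n - k - 1)) \<bullet> ?u)) + (\<Sum>k<n. ?m k * F x)"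
    by (rule sum.distrib)
  also have "(\<Sum>k<n. ?m k * (vec2 (meanX (Suc (n - k - 1))) (meanX (n - k - 1)) \<bullet> ?u))
      = (\<Sum>k<n. ?m k * ((?P (n - k - 1) *v ?v) \<bullet> ?u)) + (\<Sum>k<n. \<Sum>i=1..n-k-1. ?m k * ((?P (n - k - 1 - i) *v ?e) \<bullet> ?u))"
    unfolding mean_vec by (simp add: inner_add_left inner_sum_left distrib_left sum_distrib_left sum.distrib del: gw2_aux.simps)
  also have "(\<Sum>k<n. ?m k * ((?P (n - k - 1) *v ?v) \<bullet> ?u))
      = ?v \<bullet> (\<Sum>k = 0..n-1. ?m k *\<^sub>R (transpose (?P (n - k - 1)) *v ?u))"
    unfolding range by (simp only: inner_sum_right inner_scaleR_right inner_transpose_mult_vec)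
  also have "(\<Sum>k<n. \<Sum>i=1..n-k-1. ?m k * ((?P (n - k - 1 - i) *v ?e) \<bullet> ?u))
      = ?e \<bullet> (\<Sum>i = 1..n-1. \<Sum>j = 0..n-i-1. ?m j *\<^sub>R (transpose (?P (n - i - j - 1)) *v ?u))"
  proof -
    let ?g = "\<lambda>i j. ?m j * ((?P (n - i - j - 1) *v ?e) \<bullet> ?u)"
    \<comment> \<open>Both orders of summation run over the triangle i + k < n with i at least
      1.\<close>
    have "(\<Sum>k<n. \<Sum>i=1..n-k-1. ?m k * ((?P (n - k - 1 - i) *v ?e) \<bullet> ?u))
        = (\<Sum>k<n. \<Sum>i\<in>{i\<in>{1..n-1}. i + k < n}. ?g i k)"
    proof (intro sum.cong refl)
      fix k assume "k \<in> {..<n}"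
      then show "{1..n-k-1} = {i\<in>{1..n-1}. i + k < n}" by auto
      fix i
      have "n - k - 1 - i = n - i - k - 1" by simp
      then show "?m k * ((?P (n - k - 1 - i) *v ?e) \<bullet> ?u) = ?g i k" by (simp only:)
    qed
    also have "\<dots> = (\<Sum>i=1..n-1. \<Sum>k\<in>{k\<in>{..<n}. i + k < n}. ?g i k)"
      by (rule sum.swap_restrict[symmetric]) auto
    also have "\<dots> = (\<Sum>i=1..n-1. \<Sum>k=0..n-i-1. ?g i k)"
      by (intro sum.cong refl) auto
    also have "\<dots> = ?e \<bullet> (\<Sum>i = 1..n-1. \<Sum>j = 0..n-i-1. ?m j *\<^sub>R (transpose (?P (n - i - j - 1)) *v ?u))"
      by (simp only: inner_sum_right inner_scaleR_right inner_transpose_mult_vec)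
    finally show ?thesis .
  qed
  also have "(\<Sum>k<n. ?m k * F x) = (\<Sum>i = 1..n. ?m (n - i) * F x)"
    by (rule sum.reindex_bij_witness[of _ "\<lambda>i. n - i" "\<lambda>k. n - k"]) auto
  finally show ?thesis by simp
qed

lemma coeffs_nonneg: "0 \<le> coeff_xi n a b" "0 \<le> coeff_eta n a b" "0 \<le> coeff_eps n a b"
  by (induction n arbitrary: a b) (auto intro!: add_nonneg_nonneg mult_nonneg_nonneg integral_nonneg_AE simp del: gw2_aux.simps)

text \<open>The outermost step of \<open>coeff_eps\<close> contributes
  \<open>1 powr \<alpha>\<close> = 1. Hence F is O of the limit, and errors o(F) become relative
  errors.\<close>

lemma limit_tail_ge:
  assumes "1 \<le> n"
  shows "F x \<le> limit_tail n 1 0 x"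
proof -
  obtain k where k: "n = Suc k" using assms by (cases n) auto
  have "1 * F x \<le> coeff_eps n 1 0 * F x"
    using coeffs_nonneg(3)[of k m\<xi> m\<eta>] pos[of x] unfolding k by (intro mult_right_mono) auto
  moreover have "0 \<le> coeff_xi n 1 0 * t\<xi> x" "0 \<le> coeff_eta n 1 0 * t\<eta> x"
    by (auto intro!: mult_nonneg_nonneg coeffs_nonneg simp: tail_def)
  ultimately show ?thesis by linarith
qed

lemma tail_X_asymp:
  assumes "1 \<le> n"
  shows "tail M (X (Suc n)) \<sim>[at_top] limit_tail n 1 0"
    and "regularly_varying M (\<lambda>\<omega>. real (X (Suc n) \<omega>)) \<alpha>"
proof -
  let ?f = "tail M (X (Suc n))" and ?g = "limit_tail n 1 0"
  have diff: "(\<lambda>x. ?f x - ?g x) \<in> o(F)"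
    using tail_linear_combination[of 1 0 n] by (simp add: tail_def del: gw2_aux.simps)
  have "F \<in> O(?g)"
  proof (intro bigoI[of _ 1] always_eventually allI)
    show "norm (F x) \<le> 1 * norm (?g x)" for x
      using limit_tail_ge[OF assms, of x] pos[of x] less_le_trans[OF pos limit_tail_ge[OF assms], of x]
      by (simp only: real_norm_def abs_of_pos mult_1_left)
  qed
  with diff have "(\<lambda>x. ?f x - ?g x) \<in> o(?g)" by (rule landau_o.small_big_trans)
  then show equiv: "?f \<sim>[at_top] ?g" by (rule smallo_imp_asymp_equiv)
  have F: "F \<in> O(?f)"
    using \<open>F \<in> O(?g)\<close> asymp_equiv_imp_bigomega[OF equiv] by (rule bigo_bigomega_trans)
  \<comment> \<open>Needed to pass from the additive form of regular variation back to the
    quotient.\<close>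
  have nz: "\<forall>\<^sub>F x in at_top. ?f x \<noteq> 0"
  proof -
    obtain c where "\<forall>\<^sub>F x in at_top. norm (F x) \<le> c * norm (?f x)" using landau_o.bigE[OF F] by blast
    then show ?thesis
    proof eventually_elim
      case (elim x)
      then show ?case using pos[of x] by auto
    qed
  qed
  have reg: "regular ?f" by (rule regular_smallo_diff[OF regular_limit_tail diff])
  have "((\<lambda>x. ?f (q * x) / ?f x) \<longlongrightarrow> q powr (-\<alpha>)) at_top" if "0 < q" for q
  proof -
    have "(\<lambda>x. ?f (q * x) - q powr (-\<alpha>) * ?f x) \<in> o(?f)"
      using regular_scale[OF reg that] F by (rule landau_o.small_big_trans)
    then have "((\<lambda>x. (?f (q * x) - q powr (-\<alpha>) * ?f x) / ?f x + q powr (-\<alpha>)) \<longlongrightarrow> 0 + q powr (-\<alpha>)) at_top"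
      by (intro tendsto_add tendsto_const smalloD_tendsto)
    moreover have "\<forall>\<^sub>F x in at_top. (?f (q * x) - q powr (-\<alpha>) * ?f x) / ?f x + q powr (-\<alpha>) = ?f (q * x) / ?f x"
      using nz by eventually_elim (simp add: field_simps)
    ultimately show ?thesis by (simp add: Lim_transform_eventually)
  qed
  then show "regularly_varying M (\<lambda>\<omega>. real (X (Suc n) \<omega>)) \<alpha>"
    using alpha by (simp add: regularly_varying_def tail_def del: gw2_aux.simps)
qed

end

theorem theorem3p8:
  fixes M :: "'a measure"
    and Xm1 X0 :: "'a \<Rightarrow> nat"
    and xi eta :: "nat \<Rightarrow> nat \<Rightarrow> 'a \<Rightarrow> nat"
    and eps :: "nat \<Rightarrow> 'a \<Rightarrow> nat"
    and \<alpha> r :: real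
    and n :: nat
  defines "mxi \<equiv> prob_space.expectation M (\<lambda>\<omega>. real (xi 1 1 \<omega>))"
    and "meta \<equiv> prob_space.expectation M (\<lambda>\<omega>. real (eta 1 1 \<omega>))"
    and "meps \<equiv> prob_space.expectation M (\<lambda>\<omega>. real (eps 1 \<omega>))"
    and "u \<equiv> (\<lambda>x::real. vec2 (tail M (xi 1 1) x) (tail M (eta 1 1) x))"
  assumes model: "gw2_model M Xm1 X0 xi eta eps"
    and alpha: "\<alpha> \<ge> 1"
    and rv_xi: "regularly_varying M (\<lambda>\<omega>. real (xi 1 1 \<omega>)) \<alpha>"
    and rv_eta: "regularly_varying M (\<lambda>\<omega>. real (eta 1 1 \<omega>)) \<alpha>"
    and rv_eps: "regularly_varying M (\<lambda>\<omega>. real (eps 1 \<omega>)) \<alpha>"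
    and tail_xi_eta: "tail M (xi 1 1) \<in> \<Theta>(tail M (eta 1 1))"
    and tail_xi_eps: "tail M (xi 1 1) \<in> O(tail M (eps 1))"
    and tail_eta_eps: "tail M (eta 1 1) \<in> O(tail M (eps 1))"
    and int_xi: "integrable M (\<lambda>\<omega>. real (xi 1 1 \<omega>))" and pos_xi: "mxi > 0"
    and int_eta: "integrable M (\<lambda>\<omega>. real (eta 1 1 \<omega>))" and pos_eta: "meta > 0"
    and int_eps: "integrable M (\<lambda>\<omega>. real (eps 1 \<omega>))" and pos_eps: "meps > 0"
    and r: "r > \<alpha>"
    and mom0: "integrable M (\<lambda>\<omega>. real (X0 \<omega>) powr r)"
    and momm1: "integrable M (\<lambda>\<omega>. real (Xm1 \<omega>) powr r)"
    and n: "n \<ge> 1"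
  shows "(\<lambda>x. tail M (gw2 Xm1 X0 xi eta eps (int n)) x) \<sim>[at_top]
           (\<lambda>x. vec2 (prob_space.expectation M (\<lambda>\<omega>. real (X0 \<omega>)))
                      (prob_space.expectation M (\<lambda>\<omega>. real (Xm1 \<omega>)))
                 \<bullet> (\<Sum>k = 0..n-1. mseq mxi meta k powr \<alpha> *\<^sub>R
                        (transpose (matpow (Mmat mxi meta) (n - k - 1)) *v u x))
               + vec2 meps 0
                 \<bullet> (\<Sum>i = 1..n-1. \<Sum>j = 0..n-i-1. mseq mxi meta j powr \<alpha> *\<^sub>R
                        (transpose (matpow (Mmat mxi meta) (n - i - j - 1)) *v u x))
               + (\<Sum>i = 1..n. mseq mxi meta (n - i) powr \<alpha> * tail M (eps 1) x))
       \<and> regularly_varying M (\<lambda>\<omega>. real (gw2 Xm1 X0 xi eta eps (int n) \<omega>)) \<alpha>"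
proof -
  interpret prob_space M using model by (simp add: gw2_model_def)
  interpret gw2_rv M Xm1 X0 xi eta eps \<alpha> r
    using assms by unfold_locales auto
  have X: "gw2 Xm1 X0 xi eta eps (int n) = gw2_aux Xm1 X0 xi eta eps (Suc n)"
    by (rule ext) (simp add: gw2_def nat_add_distrib)
  show ?thesis
    using tail_X_asymp[OF n] unfolding X limit_tail_eq[OF n] mxi_def meta_def meps_def u_def by simp
qed

end
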